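(* No non-trivial free abelian group admits a locally connected minimal group topology.
   Context: All group topologies are assumed Hausdorff. A Hausdorff group topology $\tau$ on a group $G$ is minimal if every Hausdorff group topology $\tau'\subseteq\tau$ on $G$ satisfies $\tau'=\tau$. The topology in question is a single topology that is both locally connected and minimal. *)

theory Defs
  imports "HOL-Analysis.Analysis" "HOL-Algebra.Free_Abelian_Groups"
begin

definition hausdorff_group_topology :: "('a, 'm) monoid_scheme \<Rightarrow> 'a topology \<Rightarrow> bool"
  where "hausdorff_group_topology G T \<longleftrightarrow>
    topspace T = carrier G \<and>
    continuous_map (prod_topology T T) T (\<lambda>(x, y). x \<otimes>\<^bsub>G\<^esub> y) \<and>
    continuous_map T T (\<lambda>x. inv\<^bsub>G\<^esub> x) \<and>
    Hausdorff_space T"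

definition minimal_group_topology :: "('a, 'm) monoid_scheme \<Rightarrow> 'a topology \<Rightarrow> bool"
  where "minimal_group_topology G T \<longleftrightarrow>
    hausdorff_group_topology G T \<and>
    (\<forall>T'. hausdorff_group_topology G T' \<and> (\<forall>U. openin T' U \<longrightarrow> openin T U) \<longrightarrow> T' = T)"

end

(*
  Idea. In a minimal torsion-free abelian group G multiplication by n > 0 is a topological embedding.
  Minimality also makes G precompact: otherwise some sequence is so sparse that declaring suitable
  combinations of its tails to be small yields a strictly coarser Hausdorff group topology. First this
  only gives, for each neighbourhood U, some c > 0 such that cG is covered by finitely many
  translates of U; that suffices for a Folner-type lemma producing continuous characters, and these
  are used to keep the second, final coarsening Hausdorff.

  Let C be the open subgroup generated by a small connected neighbourhood W, and let chi be a
  continuous character. The characters of C / closure(cC) have values in the c-th roots of unity and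
  are trivial by connectedness, so cC is dense in C. Following the division by c along W shows that
  y in C with c y in W has |arg chi(y)| = O(1/c). By precompactness C is a sum of m copies of W, so chi is
  O(m/c)-close to 1 on C for every c, hence trivial. As characters separate points, C = 0, so G is
  discrete and precompact, hence finite, hence trivial.
*)

theory Submission
  imports Defs "HOL-Library.Function_Algebras" "HOL-Computational_Algebra.Primes"
    "HOL-Number_Theory.Cong"
begin

section \<open>Neighbourhood bases and covering by translates\<close>

text \<open>Two coarsenings are needed because the first one works only with coefficients that
  vanish. Its sparse sequence must keep every small nonzero multiple of a new member away from the
  combinations of its predecessors, so it is available only while no \<open>cG\<close> is covered by
  finitely many translates. If precompactness still fails after that, there is a prime
  \<open>p\<close> for which the quotient by the closure of \<open>pG\<close> is not precompact, and
  this yields a sequence that is independent merely modulo \<open>p\<close>. A small combination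
  then has coefficients divisible by a power of \<open>p\<close>, but it need not be zero.
  Hausdorffness is therefore tested on its quotient by \<open>c\<close> with continuous characters,
  and the Folner-type lemma has to be available before precompactness is.

  The lemma is needed again for the quotient by the closure of \<open>cC\<close>, whose topology,
  pulled back to G, is not Hausdorff. For this reason \<open>free_group_base\<close> assumes
  recurrence instead of minimality: finitely many elements have a common arbitrarily large
  multiplier \<open>n\<close> that makes them small. Freeness supplies integer coordinates, and
  these can be reduced modulo such an \<open>n\<close>.\<close>

text \<open>The group sits in a ring only so that its integer multiples can be written \<open>of_int n * x\<close>;
  a free abelian group is realised inside the pointwise ring of integer-valued functions.\<close>

locale group_base =
  fixes H :: "'a::comm_ring_1 set" and N :: "'a set set"
  assumes zero_mem: "0 \<in> H"
    and diff_mem: "x \<in> H \<Longrightarrow> y \<in> H \<Longrightarrow> x - y \<in> H"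
    and nonempty: "N \<noteq> {}"
    and subset: "U \<in> N \<Longrightarrow> U \<subseteq> H"
    and zero: "U \<in> N \<Longrightarrow> 0 \<in> U"
    and sym: "U \<in> N \<Longrightarrow> x \<in> U \<Longrightarrow> - x \<in> U"
    and inter: "U \<in> N \<Longrightarrow> V \<in> N \<Longrightarrow> \<exists>W\<in>N. W \<subseteq> U \<inter> V"
    and half: "U \<in> N \<Longrightarrow> \<exists>V\<in>N. \<forall>x\<in>V. \<forall>y\<in>V. x + y \<in> U"
begin

lemma minus_mem: "x \<in> H \<Longrightarrow> - x \<in> H"
  using diff_mem[OF zero_mem, of x] by simp

lemma add_mem: "x \<in> H \<Longrightarrow> y \<in> H \<Longrightarrow> x + y \<in> H"
  using diff_mem[of x "- y"] minus_mem by simp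

lemma of_nat_mult_mem: "x \<in> H \<Longrightarrow> of_nat n * x \<in> H"
  by (induction n) (auto simp: zero_mem add_mem algebra_simps)

lemma of_int_mult_mem: "x \<in> H \<Longrightarrow> of_int n * x \<in> H"
  using of_nat_mult_mem[of x "nat \<bar>n\<bar>"] minus_mem[of "of_nat (nat \<bar>n\<bar>) * x"]
  by (cases "n \<ge> 0") (auto simp: of_nat_nat)

lemma sum_mem: "(\<And>i. i \<in> I \<Longrightarrow> f i \<in> H) \<Longrightarrow> sum f I \<in> H"
  by (induction I rule: infinite_finite_induct) (auto simp: zero_mem add_mem)

lemma half_diff:
  assumes "U \<in> N"
  obtains V where "V \<in> N" "V \<subseteq> U" "\<And>x y. x \<in> V \<Longrightarrow> y \<in> V \<Longrightarrow> x + y \<in> U"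
    "\<And>x y. x \<in> V \<Longrightarrow> y \<in> V \<Longrightarrow> x - y \<in> U"
proof -
  obtain V where V: "V \<in> N" "\<forall>x\<in>V. \<forall>y\<in>V. x + y \<in> U" using half[OF assms] by blast
  show ?thesis
  proof (rule that[OF V(1)])
    show "V \<subseteq> U" using V zero[OF V(1)] by force
    show "x + y \<in> U" if "x \<in> V" "y \<in> V" for x y using V that by blast
    show "x - y \<in> U" if "x \<in> V" "y \<in> V" for x y
      using V(2) that sym[OF V(1), of y] by force
  qed
qed

lemma third:
  assumes "U \<in> N"
  obtains V where "V \<in> N" "V \<subseteq> U"
    "\<And>x y z. x \<in> V \<Longrightarrow> y \<in> V \<Longrightarrow> z \<in> V \<Longrightarrow> x + y + z \<in> U"
proof -
  obtain V1 where V1: "V1 \<in> N" "V1 \<subseteq> U" "\<And>x y. x \<in> V1 \<Longrightarrow> y \<in> V1 \<Longrightarrow> x + y \<in> U"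
    using half_diff[OF assms] by metis
  obtain V where V: "V \<in> N" "V \<subseteq> V1" "\<And>x y. x \<in> V \<Longrightarrow> y \<in> V \<Longrightarrow> x + y \<in> V1"
    using half_diff[OF V1(1)] by metis
  show ?thesis using that[of V] V1 V by blast
qed

text \<open>The last two summands are merged into one, so halving the neighbourhood pays for one
  summand more.\<close>

lemma fraction:
  assumes "U \<in> N"
  shows "\<exists>V\<in>N. V \<subseteq> U \<and> (\<forall>n\<le>m. \<forall>f. (\<forall>i<n. f i \<in> V) \<longrightarrow> (\<Sum>i<n::nat. f i) \<in> U)"
proof (induction m)
  case 0
  then show ?case using assms zero by force
next
  case (Suc m)
  then obtain V where V: "V \<in> N" "V \<subseteq> U" "\<forall>n\<le>m. \<forall>f. (\<forall>i<n. f i \<in> V) \<longrightarrow> (\<Sum>i<n. f i) \<in> U"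
    by blast
  obtain W where W: "W \<in> N" "W \<subseteq> V" "\<And>x y. x \<in> W \<Longrightarrow> y \<in> W \<Longrightarrow> x + y \<in> V"
    using half_diff[OF V(1)] by metis
  have "(\<Sum>i<n. f i) \<in> U" if n: "n \<le> Suc m" and f: "\<forall>i<n. f i \<in> W" for n and f :: "nat \<Rightarrow> 'a"
  proof (cases "n \<le> m")
    case True
    then show ?thesis using V W f by blast
  next
    case False
    then have n: "n = Suc m" using n by simp
    show ?thesis
    proof (cases m)
      case 0
      then show ?thesis using n f W V by auto
    next
      case (Suc k)
      define g where "g i = (if i = k then f k + f m else f i)" for i
      have "(\<Sum>i<m. g i) \<in> U"
        by (rule V(3)[rule_format]) (use f W n Suc in \<open>auto simp: g_def\<close>)
      also have "(\<Sum>i<m. g i) = (\<Sum>i<n. f i)"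
      proof -
        have "(\<Sum>i<k. g i) = (\<Sum>i<k. f i)" by (rule sum.cong) (auto simp: g_def)
        then show ?thesis unfolding n Suc sum.lessThan_Suc by (simp add: g_def Suc add.assoc)
      qed
      finally show ?thesis .
    qed
  qed
  then show ?case using W V(2) by (intro bexI[of _ W]) auto
qed

text \<open>The shape is a point of \<open>A - A + A - A\<close> plus an error, shifted by one more
  error \<open>u\<close>. The Hausdorff check of the second coarsening ends with such a sum.\<close>

lemma signed_sum6:
  assumes "U \<in> N"
  obtains V where "V \<in> N" "\<And>u a b c d e. u \<in> V \<Longrightarrow> a \<in> V \<Longrightarrow> b \<in> V \<Longrightarrow> c \<in> V \<Longrightarrow> d \<in> V \<Longrightarrow> e \<in> V \<Longrightarrow>
    u + (a - b + c - d + e) \<in> U"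
proof -
  obtain V where V: "V \<in> N" "\<forall>k\<le>6. \<forall>f. (\<forall>i<k. f i \<in> V) \<longrightarrow> (\<Sum>i<k::nat. f i) \<in> U"
    using fraction[OF assms, of 6] by blast
  have "u + (a - b + c - d + e) \<in> U"
    if "u \<in> V" "a \<in> V" "b \<in> V" "c \<in> V" "d \<in> V" "e \<in> V" for u a b c d e
    using V(2)[rule_format, of 6 "\<lambda>i. if i = 0 then u else if i = 1 then a else if i = 2 then - b
      else if i = 3 then c else if i = 4 then - d else e"] that sym[OF V(1)]
    by (simp add: eval_nat_numeral algebra_simps)
  then show ?thesis by (rule that[OF V(1)])
qed

lemma signed_sum5:
  assumes "U \<in> N"
  obtains V where "V \<in> N" "\<And>a b c d e. a \<in> V \<Longrightarrow> b \<in> V \<Longrightarrow> c \<in> V \<Longrightarrow> d \<in> V \<Longrightarrow> e \<in> V \<Longrightarrow>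
    a - b + c - d + e \<in> U"
proof -
  obtain V where V: "V \<in> N" "\<And>u a b c d e. u \<in> V \<Longrightarrow> a \<in> V \<Longrightarrow> b \<in> V \<Longrightarrow> c \<in> V \<Longrightarrow> d \<in> V \<Longrightarrow> e \<in> V \<Longrightarrow>
    u + (a - b + c - d + e) \<in> U"
    by (rule signed_sum6[OF assms], rule that)
  show ?thesis
    by (rule that[OF V(1)]) (use V(2)[OF zero[OF V(1)]] in simp)
qed

lemma fraction_mult:
  assumes "U \<in> N"
  obtains V where "V \<in> N" "V \<subseteq> U" "\<And>x i. x \<in> V \<Longrightarrow> \<bar>i\<bar> \<le> int m \<Longrightarrow> of_int i * x \<in> U"
proof -
  obtain V where V: "V \<in> N" "V \<subseteq> U"
      "\<forall>n\<le>m. \<forall>f. (\<forall>i<n. f i \<in> V) \<longrightarrow> (\<Sum>i<n::nat. f i) \<in> U"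
    using fraction[OF assms] by blast
  have "of_int i * x \<in> U" if "x \<in> V" "\<bar>i\<bar> \<le> int m" for x i
  proof -
    have *: "of_nat k * y \<in> U" if "y \<in> V" "k \<le> m" for y k
      using V(3)[rule_format, OF that(2), of "\<lambda>_. y"] that by simp
    show ?thesis
      using *[of x "nat i"] *[of "- x" "nat (- i)"] that sym[OF V(1)]
      by (cases "i \<ge> 0") (auto simp: of_nat_nat)
  qed
  then show ?thesis using that V by blast
qed

lemma inter_finite:
  assumes "finite I" "\<And>i. i \<in> I \<Longrightarrow> F i \<in> N"
  shows "\<exists>W\<in>N. \<forall>i\<in>I. W \<subseteq> F i"
  using assms
proof (induction rule: finite_induct)
  case empty
  then show ?case using nonempty by blast
next
  case (insert i I)
  then obtain W where W: "W \<in> N" "\<forall>j\<in>I. W \<subseteq> F j" by auto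
  obtain W' where "W' \<in> N" "W' \<subseteq> W \<inter> F i" using inter[OF W(1), of "F i"] insert by auto
  then show ?case using W by blast
qed

definition precompact :: bool
  where "precompact \<longleftrightarrow> (\<forall>U\<in>N. \<exists>E. finite E \<and> E \<subseteq> H \<and> (\<forall>x\<in>H. \<exists>e\<in>E. x - e \<in> U))"

text \<open>Equivalently, finitely many translates of \<open>{x. of_nat c * x \<in> U}\<close> cover
  \<open>H\<close>. In this form it feeds the Folner-type lemma, with that set as
  \<open>A\<close>.\<close>

definition almost_precompact :: bool
  where "almost_precompact \<longleftrightarrow>
    (\<forall>U\<in>N. \<exists>c>0. \<exists>E. finite E \<and> E \<subseteq> H \<and> (\<forall>x\<in>H. \<exists>e\<in>E. of_nat c * (x - e) \<in> U))"

text \<open>Pigeonhole. For each \<open>k\<close> the family of all \<open>k * w\<close> is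
  approximated, after multiplication by \<open>c\<close>, by one of finitely many maps from
  \<open>W\<close> to \<open>E\<close>. Two indices at distance at least \<open>m\<close> share a
  map, and \<open>c\<close> times their difference is the multiplier.\<close>

lemma recurrence:
  assumes ap: almost_precompact and U: "U \<in> N" and W: "finite W" "W \<subseteq> H"
  shows "\<exists>n\<ge>m. \<forall>w\<in>W. of_nat n * w \<in> U"
proof -
  obtain V where V: "V \<in> N" "\<And>x y. x \<in> V \<Longrightarrow> y \<in> V \<Longrightarrow> x - y \<in> U"
    using half_diff[OF U] by metis
  obtain c E where c: "c > 0" and E: "finite E" "E \<subseteq> H" "\<forall>x\<in>H. \<exists>e\<in>E. of_nat c * (x - e) \<in> V"
    using ap[unfolded almost_precompact_def, rule_format, OF V(1)] by blast
  have "\<forall>k w. \<exists>e. w \<in> W \<longrightarrow> e \<in> E \<and> of_nat c * (of_nat k * w - e) \<in> V"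
    using E(3) W(2) of_nat_mult_mem by blast
  then obtain e where e: "\<And>k w. w \<in> W \<Longrightarrow> e k w \<in> E \<and> of_nat c * (of_nat k * w - e k w) \<in> V"
    by metis
  define h where "h k = restrict (e k) W" for k :: nat
  have "finite (range h)"
    by (rule finite_subset[of _ "PiE W (\<lambda>_. E)"]) (use e W E in \<open>auto simp: h_def intro!: finite_PiE\<close>)
  then obtain k0 where inf: "infinite {k. h k = h k0}"
    using pigeonhole_infinite[of UNIV h] by auto
  then obtain k where k: "k \<ge> k0 + m" "h k = h k0"
    using inf[unfolded infinite_nat_iff_unbounded_le] by blast
  have "of_nat (c * (k - k0)) * w \<in> U" if w: "w \<in> W" for w
  proof -
    have "e k w = e k0 w" using fun_cong[OF k(2), of w] w by (simp add: h_def)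
    then have "of_nat (c * (k - k0)) * w
        = of_nat c * (of_nat k * w - e k w) - of_nat c * (of_nat k0 * w - e k0 w)"
      using k(1) by (simp add: of_nat_diff algebra_simps)
    then show ?thesis using V(2) e[OF w, of k] e[OF w, of k0] by simp
  qed
  moreover have "c * (k - k0) \<ge> m"
  proof -
    have "m \<le> 1 * (k - k0)" using k(1) by simp
    also have "\<dots> \<le> c * (k - k0)" using c by (intro mult_right_mono) auto
    finally show ?thesis .
  qed
  ultimately show ?thesis by blast
qed

end

lemma (in group_base) disjoint_translates:
  assumes nonbig: "\<And>E. finite E \<Longrightarrow> E \<subseteq> H \<Longrightarrow> \<exists>x\<in>H. \<forall>e\<in>E. x - e \<notin> D"
    and D: "0 \<in> D" "\<And>x. x \<in> D \<Longrightarrow> - x \<in> D"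
  shows "\<exists>E. finite E \<and> E \<subseteq> H \<and> card E = n \<and> (\<forall>x\<in>E. \<forall>y\<in>E. x \<noteq> y \<longrightarrow> x - y \<notin> D)"
proof (induction n)
  case 0
  then show ?case by auto
next
  case (Suc n)
  then obtain E where E: "finite E" "E \<subseteq> H" "card E = n" "\<forall>x\<in>E. \<forall>y\<in>E. x \<noteq> y \<longrightarrow> x - y \<notin> D"
    by blast
  obtain x where x: "x \<in> H" "\<forall>e\<in>E. x - e \<notin> D" using nonbig[OF E(1,2)] by blast
  have x': "\<forall>e\<in>E. e - x \<notin> D" using x(2) D by (metis minus_diff_eq)
  have "x \<notin> E" using x(2) D(1) by force
  then show ?case using E x x'
    by (intro exI[of _ "insert x E"]) auto
qed

text \<open>An approximate form of B. H. Neumann's lemma on coverings by cosets. Induct on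
  \<open>J\<close>: choose \<open>card P + 1\<close> points \<open>e\<close> pairwise separated
  modulo \<open>D j\<close>, and \<open>x\<close> such that every \<open>x + e\<close> avoids the
  other sets. If every \<open>x + e\<close> fell into a translate of \<open>A j\<close> by a point
  of \<open>P\<close>, two of them would share that point, and their difference would lie in
  \<open>D j\<close>.\<close>

lemma (in group_base) translates_not_covering:
  assumes "finite J"
    and "\<And>j E. j \<in> J \<Longrightarrow> finite E \<Longrightarrow> E \<subseteq> H \<Longrightarrow> \<exists>x\<in>H. \<forall>e\<in>E. x - e \<notin> D j"
    and "\<And>j. j \<in> J \<Longrightarrow> 0 \<in> D j" "\<And>j x. j \<in> J \<Longrightarrow> x \<in> D j \<Longrightarrow> - x \<in> D j"
    and "\<And>j x y. j \<in> J \<Longrightarrow> x \<in> A j \<Longrightarrow> y \<in> A j \<Longrightarrow> x - y \<in> D j"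
    and "finite P" "P \<subseteq> H"
  shows "\<exists>x\<in>H. \<forall>j\<in>J. \<forall>p\<in>P. x - p \<notin> A j"
  using assms
proof (induction J arbitrary: P rule: finite_induct)
  case empty
  then show ?case using zero_mem by auto
next
  case (insert j J)
  obtain E where E: "finite E" "E \<subseteq> H" "card E = Suc (card P)"
      "\<forall>x\<in>E. \<forall>y\<in>E. x \<noteq> y \<longrightarrow> x - y \<notin> D j"
    using disjoint_translates[OF insert.prems(1), of j "Suc (card P)"] insert.prems(2,3) by auto
  define P' where "P' = (\<lambda>(p, e). p - e) ` (P \<times> E)"
  have "\<exists>x\<in>H. \<forall>j\<in>J. \<forall>p\<in>P'. x - p \<notin> A j"
  proof (rule insert.IH)
    show "finite P'" using insert.prems(5) E(1) by (auto simp: P'_def)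
    show "P' \<subseteq> H" using insert.prems(6) E(2) diff_mem by (auto simp: P'_def)
  qed (use insert.prems in auto)
  then obtain x where x: "x \<in> H" "\<And>j p e. j \<in> J \<Longrightarrow> p \<in> P \<Longrightarrow> e \<in> E \<Longrightarrow> x + e - p \<notin> A j"
    by (force simp: P'_def algebra_simps)
  have "\<exists>e\<in>E. \<forall>p\<in>P. x + e - p \<notin> A j"
  proof (rule ccontr)
    assume "\<not> ?thesis"
    then obtain q where q: "\<And>e. e \<in> E \<Longrightarrow> q e \<in> P \<and> x + e - q e \<in> A j" by metis
    have "inj_on q E"
    proof (rule inj_onI, rule ccontr)
      fix e e' assume *: "e \<in> E" "e' \<in> E" "q e = q e'" "e \<noteq> e'"
      have "(x + e - q e) - (x + e' - q e') \<in> D j"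
        using insert.prems(4) q * by blast
      then show False using E(4) * by simp
    qed
    moreover have "q ` E \<subseteq> P" using q by blast
    ultimately have "card E \<le> card P" using card_inj_on_le insert.prems(5) by blast
    then show False using E(3) by simp
  qed
  then obtain e where "e \<in> E" "\<forall>p\<in>P. x + e - p \<notin> A j" by blast
  then show ?case using x E(2) add_mem by (intro bexI[of _ "x + e"]) auto
qed

section \<open>Coarser topologies from sparse sequences\<close>

text \<open>This is the finest group topology coarser than both. It can fail to be Hausdorff even
  when both are, which is why \<open>coarser_sum\<close> asks for separation.\<close>

lemma group_base_sum:
  assumes "group_base H N" "group_base H L"
  shows "group_base H ((\<lambda>(U, V). {u + v | u v. u \<in> U \<and> v \<in> V}) ` (N \<times> L))"
proof -
  interpret N: group_base H N by fact
  interpret L: group_base H L by fact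
  show ?thesis
  proof
    show "0 \<in> H" by (rule N.zero_mem)
    show "x - y \<in> H" if "x \<in> H" "y \<in> H" for x y
      using that by (rule N.diff_mem)
    show "(\<lambda>(U, V). {u + v | u v. u \<in> U \<and> v \<in> V}) ` (N \<times> L) \<noteq> {}"
      using N.nonempty L.nonempty by auto
  next
    fix W assume "W \<in> (\<lambda>(U, V). {u + v | u v. u \<in> U \<and> v \<in> V}) ` (N \<times> L)"
    then obtain U V where UV: "U \<in> N" "V \<in> L" "W = {u + v | u v. u \<in> U \<and> v \<in> V}" by auto
    show "W \<subseteq> H" using UV N.subset L.subset N.add_mem by blast
    show "0 \<in> W" using N.zero[OF UV(1)] L.zero[OF UV(2)] unfolding UV(3) by force
    show "- x \<in> W" if x: "x \<in> W" for x
    proof -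
      obtain u v where uv: "x = u + v" "u \<in> U" "v \<in> V" using x UV(3) by blast
      have "- x = - u + - v" by (simp add: uv(1))
      then show ?thesis
        using N.sym[OF UV(1) uv(2)] L.sym[OF UV(2) uv(3)] unfolding UV(3) by blast
    qed
    show "\<exists>W'\<in>(\<lambda>(U, V). {u + v | u v. u \<in> U \<and> v \<in> V}) ` (N \<times> L). \<forall>x\<in>W'. \<forall>y\<in>W'. x + y \<in> W"
    proof -
      obtain U' where U': "U' \<in> N" "\<forall>x\<in>U'. \<forall>y\<in>U'. x + y \<in> U" using N.half[OF UV(1)] by blast
      obtain V' where V': "V' \<in> L" "\<forall>x\<in>V'. \<forall>y\<in>V'. x + y \<in> V" using L.half[OF UV(2)] by blast
      have "x + y \<in> W" if xy: "x \<in> {u + v | u v. u \<in> U' \<and> v \<in> V'}" "y \<in> {u + v | u v. u \<in> U' \<and> v \<in> V'}" for x y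
      proof -
        obtain u v where uv: "x = u + v" "u \<in> U'" "v \<in> V'" using xy(1) by blast
        obtain u' v' where uv': "y = u' + v'" "u' \<in> U'" "v' \<in> V'" using xy(2) by blast
        have "x + y = (u + u') + (v + v')" by (simp add: uv(1) uv'(1))
        then show ?thesis unfolding UV(3) using U' V' uv uv' by blast
      qed
      then show ?thesis using U'(1) V'(1)
        by (intro bexI[of _ "{u + v | u v. u \<in> U' \<and> v \<in> V'}"]) auto
    qed
  next
    fix W W' assume "W \<in> (\<lambda>(U, V). {u + v | u v. u \<in> U \<and> v \<in> V}) ` (N \<times> L)"
      "W' \<in> (\<lambda>(U, V). {u + v | u v. u \<in> U \<and> v \<in> V}) ` (N \<times> L)"
    then obtain U V U' V' where UV: "U \<in> N" "V \<in> L" "W = {u + v | u v. u \<in> U \<and> v \<in> V}"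
      "U' \<in> N" "V' \<in> L" "W' = {u + v | u v. u \<in> U' \<and> v \<in> V'}" by auto
    obtain U'' V'' where "U'' \<in> N" "U'' \<subseteq> U \<inter> U'" "V'' \<in> L" "V'' \<subseteq> V \<inter> V'"
      using N.inter[OF UV(1,4)] L.inter[OF UV(2,5)] by blast
    then show "\<exists>W''\<in>(\<lambda>(U, V). {u + v | u v. u \<in> U \<and> v \<in> V}) ` (N \<times> L). W'' \<subseteq> W \<inter> W'"
      unfolding UV(3,6) by (intro bexI[of _ "{u + v | u v. u \<in> U'' \<and> v \<in> V''}"]) blast+
  qed
qed

text \<open>Coefficients form a total sequence and the length is a separate argument, so
  combinations of different lengths are padded by zeros and then added coefficientwise.\<close>

definition int_comb :: "(nat \<Rightarrow> 'a::comm_ring_1) \<Rightarrow> (nat \<Rightarrow> int) \<Rightarrow> nat \<Rightarrow> 'a"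
  where "int_comb x a n = (\<Sum>k<n. of_int (a k) * x k)"

lemma int_comb_add: "int_comb x (\<lambda>k. a k + b k) n = int_comb x a n + int_comb x b n"
  by (simp add: int_comb_def algebra_simps sum.distrib)

lemma int_comb_diff: "int_comb x (\<lambda>k. a k - b k) n = int_comb x a n - int_comb x b n"
  by (simp add: int_comb_def algebra_simps sum_subtractf)

lemma int_comb_uminus: "int_comb x (\<lambda>k. - a k) n = - int_comb x a n"
  by (simp add: int_comb_def sum_negf)

lemma int_comb_mult: "int_comb x (\<lambda>k. c * a k) n = of_int c * int_comb x a n"
  by (simp add: int_comb_def sum_distrib_left mult.assoc)

lemma int_comb_extend:
  assumes "n \<le> m" "\<And>k. k \<ge> n \<Longrightarrow> a k = 0"
  shows "int_comb x a m = int_comb x a n"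
  unfolding int_comb_def
  by (rule sum.mono_neutral_right) (use assms in auto)

lemma int_comb_zero: "int_comb x (\<lambda>_. 0) n = 0"
  by (simp add: int_comb_def)

lemma int_comb_Suc: "int_comb x a (Suc n) = int_comb x a n + of_int (a n) * x n"
  by (simp add: int_comb_def)

lemma int_comb_cong: "(\<And>k. k < n \<Longrightarrow> a k = b k) \<Longrightarrow> int_comb x a n = int_comb x b n"
  by (simp add: int_comb_def)

lemma (in group_base) int_comb_mem: "(\<And>k. x k \<in> H) \<Longrightarrow> int_comb x a n \<in> H"
  unfolding int_comb_def by (intro sum_mem of_int_mult_mem)

section \<open>Consequences of minimality and the first coarsening\<close>

locale minimal_group_base = group_base +
  assumes hausdorff: "x \<in> H \<Longrightarrow> x \<noteq> 0 \<Longrightarrow> \<exists>U\<in>N. x \<notin> U"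
    and torsion_free: "x \<in> H \<Longrightarrow> n > 0 \<Longrightarrow> of_nat n * x = 0 \<Longrightarrow> x = 0"
    and minimal: "group_base H M \<Longrightarrow> (\<forall>x\<in>H. x \<noteq> 0 \<longrightarrow> (\<exists>V\<in>M. x \<notin> V)) \<Longrightarrow>
      (\<forall>V\<in>M. \<exists>U\<in>N. U \<subseteq> V) \<Longrightarrow> U \<in> N \<Longrightarrow> \<exists>V\<in>M. V \<subseteq> U"
begin

text \<open>The pullback of the topology along multiplication by \<open>n\<close> is coarser, since
  that map is continuous, and Hausdorff, since \<open>H\<close> is torsion-free. By minimality it is
  the original topology.\<close>

lemma mult_embedding:
  assumes U: "U \<in> N" and n: "n > 0"
  shows "\<exists>V\<in>N. \<forall>x\<in>H. of_nat n * x \<in> V \<longrightarrow> x \<in> U"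
proof -
  define P where "P V = {x \<in> H. of_nat n * x \<in> V}" for V
  have base: "group_base H (P ` N)"
  proof
    show "0 \<in> H" by (rule zero_mem)
    show "x - y \<in> H" if "x \<in> H" "y \<in> H" for x y
      using that by (rule diff_mem)
    show "P ` N \<noteq> {}" using nonempty by auto
  next
    fix W assume "W \<in> P ` N"
    then obtain V where V: "V \<in> N" "W = P V" by blast
    show "W \<subseteq> H" "0 \<in> W" using zero[OF V(1)] zero_mem by (auto simp: V P_def)
    show "- x \<in> W" if "x \<in> W" for x
      using that sym[OF V(1)] minus_mem by (auto simp: V P_def)
    obtain V' where V': "V' \<in> N" "\<forall>x\<in>V'. \<forall>y\<in>V'. x + y \<in> V" using half[OF V(1)] by blast
    have "\<forall>x\<in>P V'. \<forall>y\<in>P V'. x + y \<in> W"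
      using V'(2) add_mem by (auto simp: V P_def ring_distribs)
    then show "\<exists>W'\<in>P ` N. \<forall>x\<in>W'. \<forall>y\<in>W'. x + y \<in> W" using V'(1) by blast
  next
    fix W W' assume "W \<in> P ` N" "W' \<in> P ` N"
    then obtain V V' where V: "V \<in> N" "W = P V" "V' \<in> N" "W' = P V'" by blast
    obtain V'' where "V'' \<in> N" "V'' \<subseteq> V \<inter> V'" using inter[OF V(1,3)] by blast
    then show "\<exists>W''\<in>P ` N. W'' \<subseteq> W \<inter> W'" by (auto simp: V P_def)
  qed
  moreover have "\<forall>x\<in>H. x \<noteq> 0 \<longrightarrow> (\<exists>V\<in>P ` N. x \<notin> V)"
  proof (intro ballI impI)
    fix x assume x: "x \<in> H" "x \<noteq> 0"
    then have "of_nat n * x \<noteq> 0" using torsion_free n by blast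
    then obtain V where "V \<in> N" "of_nat n * x \<notin> V" using hausdorff of_nat_mult_mem x(1) by blast
    then show "\<exists>V\<in>P ` N. x \<notin> V" by (auto simp: P_def)
  qed
  moreover have "\<forall>V\<in>P ` N. \<exists>U\<in>N. U \<subseteq> V"
  proof clarify
    fix V assume "V \<in> N"
    then obtain W where W: "W \<in> N" "\<And>x i. x \<in> W \<Longrightarrow> \<bar>i\<bar> \<le> int n \<Longrightarrow> of_int i * x \<in> V"
      using fraction_mult[of V n] by metis
    have "W \<subseteq> P V" using subset[OF W(1)] W(2)[of _ "int n"] by (auto simp: P_def)
    then show "\<exists>U\<in>N. U \<subseteq> P V" using W(1) by blast
  qed
  ultimately have "\<exists>V\<in>P ` N. V \<subseteq> U" using U by (rule minimal)
  then show ?thesis by (auto simp: P_def)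
qed

text \<open>Minimality makes the sum of the two topologies equal to the first, so \<open>L\<close>
  is at least as fine as \<open>N\<close>. The lemma serves contradictions: \<open>L\<close> is
  built so that its members reach outside a fixed \<open>U\<close>, while the sum with
  \<open>N\<close> stays Hausdorff.\<close>

lemma coarser_sum:
  assumes L: "group_base H L"
    and sep: "\<And>x. x \<in> H \<Longrightarrow> x \<noteq> 0 \<Longrightarrow> \<exists>U\<in>N. \<exists>V\<in>L. \<forall>u\<in>U. \<forall>v\<in>V. x \<noteq> u + v"
    and U: "U \<in> N"
  shows "\<exists>V\<in>L. V \<subseteq> U"
proof -
  interpret L: group_base H L by fact
  let ?M = "(\<lambda>(U, V). {u + v | u v. u \<in> U \<and> v \<in> V}) ` (N \<times> L)"
  have "\<exists>W\<in>?M. W \<subseteq> U"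
  proof (rule minimal[OF group_base_sum[OF group_base_axioms L] _ _ U])
    show "\<forall>x\<in>H. x \<noteq> 0 \<longrightarrow> (\<exists>V\<in>?M. x \<notin> V)"
    proof (intro ballI impI)
      fix x assume "x \<in> H" "x \<noteq> 0"
      then obtain U V where UV: "U \<in> N" "V \<in> L" "\<forall>u\<in>U. \<forall>v\<in>V. x \<noteq> u + v" using sep by blast
      then show "\<exists>V\<in>?M. x \<notin> V"
        by (intro bexI[of _ "{u + v | u v. u \<in> U \<and> v \<in> V}"]) auto
    qed
    show "\<forall>V\<in>?M. \<exists>U\<in>N. U \<subseteq> V"
    proof clarify
      fix U V assume UV: "U \<in> N" "V \<in> L"
      have "x \<in> {u + v | u v. u \<in> U \<and> v \<in> V}" if "x \<in> U" for x
        using that L.zero[OF UV(2)] by force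
      then show "\<exists>U'\<in>N. U' \<subseteq> {u + v | u v. u \<in> U \<and> v \<in> V}" using UV(1) by blast
    qed
  qed
  then obtain U' V where UV: "U' \<in> N" "V \<in> L" "{u + v | u v. u \<in> U' \<and> v \<in> V} \<subseteq> U" by auto
  have "v \<in> U" if "v \<in> V" for v
    using UV(3) zero[OF UV(1)] that by force
  then show ?thesis using UV(2) by blast
qed


text \<open>If no multiplication by a positive integer makes \<open>H\<close> bounded modulo \<open>U\<close>, a sequence \<open>x\<close> can be
  chosen that is sparse modulo \<open>U\<close>; declaring small combinations of its tails to be small gives a
  strictly coarser Hausdorff topology.\<close>

lemma almost_precompact: almost_precompact
proof (rule ccontr)
  assume "\<not> almost_precompact"
  then obtain U where U: "U \<in> N"
    and nonbig: "\<And>c E. c > 0 \<Longrightarrow> finite E \<Longrightarrow> E \<subseteq> H \<Longrightarrow> \<exists>x\<in>H. \<forall>e\<in>E. of_nat c * (x - e) \<notin> U"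
    unfolding almost_precompact_def by meson
  obtain V where V: "V \<in> N" "V \<subseteq> U" "\<And>x y. x \<in> V \<Longrightarrow> y \<in> V \<Longrightarrow> x - y \<in> U"
    using half_diff[OF U] by metis
  \<comment> \<open>The points violating the condition \<open>(d, f)\<close> have their differences
    in \<open>{y. of_int d * y \<in> U}\<close>, and finitely many translates of that set never
    cover \<open>H\<close>. So finitely many conditions can be met at once.\<close>
  have avoid: "\<exists>y\<in>H. \<forall>(d, f)\<in>J. of_int d * y + f \<notin> V"
    if J: "finite J" "\<And>d f. (d, f) \<in> J \<Longrightarrow> d \<noteq> 0" for J :: "(int \<times> 'a) set"
  proof -
    define A where "A = (\<lambda>(d, f). {y. of_int d * y + f \<in> V})"
    define D where "D = (\<lambda>(d :: int, f :: 'a). {y. of_int d * y \<in> U})"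
    have "\<exists>x\<in>H. \<forall>j\<in>J. \<forall>p\<in>{0}. x - p \<notin> A j"
    proof (rule translates_not_covering[where D = D])
      fix j E assume j: "j \<in> J" and E: "finite E" "E \<subseteq> H"
      obtain d f where df: "j = (d, f)" by (cases j)
      have "d \<noteq> 0" using J(2) j df by blast
      then obtain x where x: "x \<in> H" "\<forall>e\<in>E. of_nat (nat \<bar>d\<bar>) * (x - e) \<notin> U"
        using nonbig[of "nat \<bar>d\<bar>" E] E by auto
      have "of_int d * (x - e) \<notin> U" if "e \<in> E" for e
      proof
        assume *: "of_int d * (x - e) \<in> U"
        then have "of_nat (nat \<bar>d\<bar>) * (x - e) \<in> U"
          using sym[OF U *] by (cases "d \<ge> 0") (auto simp: of_nat_nat)
        then show False using x(2) that by blast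
      qed
      then show "\<exists>x\<in>H. \<forall>e\<in>E. x - e \<notin> D j" using x(1) by (auto simp: D_def df)
    next
      fix j x y assume "j \<in> J" "x \<in> A j" "y \<in> A j"
      then show "x - y \<in> D j"
        using V(3)[of "of_int (fst j) * x + snd j" "of_int (fst j) * y + snd j"]
        by (auto simp: A_def D_def algebra_simps split: prod.splits)
    qed (use J(1) zero[OF U] sym[OF U] zero_mem in \<open>auto simp: D_def\<close>)
    then show ?thesis by (auto simp: A_def)
  qed
  \<comment> \<open>The Hausdorff check below subtracts coefficients bounded by
    \<open>2 ^ k\<close>, hence the bound \<open>2 ^ Suc k\<close>.\<close>
  define Q where "Q x k y \<longleftrightarrow> y \<in> H \<and> (\<forall>d. d \<noteq> 0 \<longrightarrow> \<bar>d\<bar> \<le> 2 ^ Suc k \<longrightarrow>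
    (\<forall>a. (\<forall>j. \<bar>a j\<bar> \<le> 2 ^ Suc j) \<longrightarrow> of_int d * y + int_comb x a k \<notin> V))" for x k y
  have "\<exists>x. \<forall>k. Q x k (x k)"
  proof (rule dependent_wf_choice[where R = less_than])
    fix x y :: "nat \<Rightarrow> 'a" and k r
    assume "\<And>z. (z, k) \<in> less_than \<Longrightarrow> x z = y z"
    then have "int_comb x a k = int_comb y a k" for a by (simp add: int_comb_def)
    then show "Q x k r = Q y k r" by (simp add: Q_def)
  next
    fix k and x :: "nat \<Rightarrow> 'a"
    define B where "B = (\<Pi>\<^sub>E j\<in>{..<k}. {- (2 ^ Suc j) .. 2 ^ Suc j :: int})"
    have "finite B" unfolding B_def by (intro finite_PiE) auto
    then obtain y where y: "y \<in> H"
      "\<And>d f. d \<noteq> 0 \<Longrightarrow> \<bar>d\<bar> \<le> 2 ^ Suc k \<Longrightarrow> f \<in> (\<lambda>a. int_comb x a k) ` B \<Longrightarrow> of_int d * y + f \<notin> V"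
      using avoid[of "({- (2 ^ Suc k) .. 2 ^ Suc k} - {0}) \<times> (\<lambda>a. int_comb x a k) ` B"] by force
    have "int_comb x a k \<in> (\<lambda>a. int_comb x a k) ` B" if "\<forall>j. \<bar>a j\<bar> \<le> 2 ^ Suc j" for a
    proof (rule image_eqI)
      show "int_comb x a k = int_comb x (restrict a {..<k}) k" by (rule int_comb_cong) simp
      show "restrict a {..<k} \<in> B" unfolding B_def
        using that by (auto simp: abs_le_iff minus_le_iff)
    qed
    then show "\<exists>r. Q x k r" using y unfolding Q_def by blast
  qed auto
  then obtain x where x: "\<And>k. Q x k (x k)" by blast
  have xH: "x k \<in> H" for k using x[of k] by (simp add: Q_def)
  have sparse: "\<forall>k<n. a k = 0" if "int_comb x a n \<in> V" "\<forall>j. \<bar>a j\<bar> \<le> 2 ^ Suc j" for a n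
    using that(1)
  proof (induction n)
    case (Suc n)
    have "a n = 0"
    proof (rule ccontr)
      assume "a n \<noteq> 0"
      then have "of_int (a n) * x n + int_comb x a n \<notin> V"
        using x[of n] that(2) unfolding Q_def by blast
      then show False using Suc.prems by (simp add: int_comb_Suc add.commute)
    qed
    then show ?case using Suc by (auto simp: int_comb_Suc less_Suc_eq)
  qed simp
  \<comment> \<open>The bound doubles with each step away from \<open>K\<close>, so that the sum of
    two members of \<open>S (Suc K)\<close> lies in \<open>S K\<close>.\<close>
  define S where "S K = {int_comb x a n | a n.
    (\<forall>k. k < K \<or> k \<ge> n \<longrightarrow> a k = 0) \<and> (\<forall>k\<ge>K. \<bar>a k\<bar> \<le> 2 ^ (k - K))}" for K
  have SI: "int_comb x a n \<in> S K" if "\<forall>k. k < K \<or> k \<ge> n \<longrightarrow> a k = 0" "\<forall>k\<ge>K. \<bar>a k\<bar> \<le> 2 ^ (k - K)" for a n K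
    unfolding S_def using that by blast
  have S_mono: "S K' \<subseteq> S K" if "K \<le> K'" for K K'
  proof
    fix v assume "v \<in> S K'"
    then obtain a n where v: "v = int_comb x a n" "\<forall>k. k < K' \<or> k \<ge> n \<longrightarrow> a k = 0"
      "\<forall>k\<ge>K'. \<bar>a k\<bar> \<le> 2 ^ (k - K')" unfolding S_def by blast
    have "\<bar>a k\<bar> \<le> 2 ^ (k - K)" if "k \<ge> K" for k
    proof (cases "k \<ge> K'")
      case True
      have "(2::int) ^ (k - K') \<le> 2 ^ (k - K)" using \<open>K \<le> K'\<close> by (intro power_increasing) auto
      then show ?thesis using v(3) True by (meson order_trans)
    next
      case False
      then show ?thesis using v(2) by simp
    qed
    then show "v \<in> S K" unfolding v(1) using v(2) \<open>K \<le> K'\<close> by (intro SI) auto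
  qed
  have base: "group_base H (range S)"
  proof
    show "0 \<in> H" by (rule zero_mem)
    show "y - z \<in> H" if "y \<in> H" "z \<in> H" for y z using that by (rule diff_mem)
    show "range S \<noteq> {}" by auto
  next
    fix W assume "W \<in> range S"
    then obtain K where W: "W = S K" by blast
    show "W \<subseteq> H" unfolding W S_def using int_comb_mem xH by auto
    have "int_comb x (\<lambda>_. 0) 0 \<in> S K" by (rule SI) auto
    then show "0 \<in> W" by (simp add: W int_comb_zero)
    show "- v \<in> W" if v: "v \<in> W" for v
    proof -
      obtain a n where v: "v = int_comb x a n" "\<forall>k. k < K \<or> k \<ge> n \<longrightarrow> a k = 0"
        "\<forall>k\<ge>K. \<bar>a k\<bar> \<le> 2 ^ (k - K)" using v unfolding W S_def by blast
      then show ?thesis unfolding W v(1) int_comb_uminus[symmetric] by (intro SI) auto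
    qed
    have "v + w \<in> W" if vw: "v \<in> S (Suc K)" "w \<in> S (Suc K)" for v w
    proof -
      obtain a n where v: "v = int_comb x a n" "\<forall>k. k < Suc K \<or> k \<ge> n \<longrightarrow> a k = 0"
        "\<forall>k\<ge>Suc K. \<bar>a k\<bar> \<le> 2 ^ (k - Suc K)" using vw(1) unfolding S_def by blast
      obtain b m where w: "w = int_comb x b m" "\<forall>k. k < Suc K \<or> k \<ge> m \<longrightarrow> b k = 0"
        "\<forall>k\<ge>Suc K. \<bar>b k\<bar> \<le> 2 ^ (k - Suc K)" using vw(2) unfolding S_def by blast
      have "v + w = int_comb x (\<lambda>k. a k + b k) (max n m)"
        unfolding v(1) w(1) int_comb_add
        using int_comb_extend[of n "max n m" a x] int_comb_extend[of m "max n m" b x] v(2) w(2) by simp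
      moreover have "\<bar>a k + b k\<bar> \<le> 2 ^ (k - K)" if "k \<ge> K" for k
      proof (cases "k = K")
        case True
        then show ?thesis using v(2) w(2) by simp
      next
        case False
        then have k: "k \<ge> Suc K" using that by simp
        then have "(2::int) ^ (k - K) = 2 * 2 ^ (k - Suc K)" by (simp add: Suc_diff_le flip: power_Suc)
        then show ?thesis using v(3)[rule_format, OF k] w(3)[rule_format, OF k] by linarith
      qed
      ultimately show ?thesis unfolding W using v(2) w(2) by (auto intro!: SI)
    qed
    then show "\<exists>W'\<in>range S. \<forall>v\<in>W'. \<forall>w\<in>W'. v + w \<in> W" by blast
  next
    fix W W' assume "W \<in> range S" "W' \<in> range S"
    then obtain K K' where "W = S K" "W' = S K'" by blast
    then show "\<exists>W''\<in>range S. W'' \<subseteq> W \<inter> W'"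
      using S_mono[of K "max K K'"] S_mono[of K' "max K K'"] by (intro bexI[of _ "S (max K K')"]) auto
  qed
  have "\<exists>W\<in>range S. W \<subseteq> V"
  proof (rule coarser_sum[OF base _ V(1)])
    fix g assume g: "g \<in> H" "g \<noteq> 0"
    show "\<exists>U\<in>N. \<exists>W\<in>range S. \<forall>u\<in>U. \<forall>v\<in>W. g \<noteq> u + v"
    proof (rule ccontr)
      assume "\<not> ?thesis"
      then have near: "\<exists>u\<in>U. \<exists>v\<in>S K. g = u + v" if "U \<in> N" for U K using that by blast
      obtain V' where V': "V' \<in> N" "\<And>x y. x \<in> V' \<Longrightarrow> y \<in> V' \<Longrightarrow> x - y \<in> V"
        using half_diff[OF V(1)] by metis
      obtain Y where Y: "Y \<in> N" "g \<notin> Y" using hausdorff g by blast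
      obtain Z where Z: "Z \<in> N" "Z \<subseteq> V'" "Z \<subseteq> Y" using inter[OF V'(1) Y(1)] by blast
      obtain u v where uv: "u \<in> V'" "v \<in> S 0" "g = u + v" using near[OF V'(1), of 0] by blast
      then obtain a n where a: "v = int_comb x a n" "\<forall>k\<ge>n. a k = 0" "\<forall>k. \<bar>a k\<bar> \<le> 2 ^ k"
        unfolding S_def by auto
      \<comment> \<open>The second decomposition of \<open>g\<close> uses indices from
        \<open>n\<close> on, the first only indices below \<open>n\<close>. Their difference is a
        small combination in which no cancellation between \<open>a\<close> and \<open>b\<close> can
        occur, so \<open>sparse\<close> kills both.\<close>
      obtain u' v' where uv': "u' \<in> Z" "v' \<in> S n" "g = u' + v'" using near[OF Z(1), of n] by blast
      then obtain b m where b: "v' = int_comb x b m" "\<forall>k. k < n \<or> k \<ge> m \<longrightarrow> b k = 0"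
        "\<forall>k\<ge>n. \<bar>b k\<bar> \<le> 2 ^ (k - n)" unfolding S_def by blast
      have bb: "\<bar>b k\<bar> \<le> 2 ^ k" for k
      proof (cases "k < n")
        case False
        have "(2::int) ^ (k - n) \<le> 2 ^ k" by (intro power_increasing) auto
        then show ?thesis using b(3) False by (meson order_trans not_less)
      qed (use b(2) in auto)
      have "v - v' = u' - u" using uv(3) uv'(3) by (simp add: algebra_simps)
      moreover have "u' - u \<in> V" using V'(2) uv(1) uv'(1) Z(2) by blast
      moreover have "v - v' = int_comb x (\<lambda>k. a k - b k) (max n m)"
        unfolding a(1) b(1) int_comb_diff
        using int_comb_extend[of n "max n m" a x] int_comb_extend[of m "max n m" b x] a(2) b(2) by simp
      moreover have "\<bar>a k - b k\<bar> \<le> 2 ^ Suc k" for k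
        using a(3)[rule_format, of k] bb[of k] abs_triangle_ineq4[of "a k" "b k"] by simp
      ultimately have *: "\<forall>k<max n m. a k - b k = 0"
        by (intro sparse) auto
      have "b k = 0" for k
        using *[rule_format, of k] a(2) b(2) by (cases "k < max n m"; cases "k < n") auto
      then have "v' = 0" unfolding b(1) by (simp add: int_comb_def)
      then have "g \<in> Y" using uv' Z(3) by auto
      then show False using Y(2) by blast
    qed
  qed
  then obtain K where K: "S K \<subseteq> V" by blast
  \<comment> \<open>This combination is \<open>x K\<close> itself: it lies in every candidate
    \<open>S K\<close>, yet its coefficient 1 contradicts \<open>sparse\<close>.\<close>
  have "int_comb x (\<lambda>i. if i = K then 1 else 0) (Suc K) \<in> S K" by (rule SI) auto
  then have "int_comb x (\<lambda>i. if i = K then 1 else 0) (Suc K) \<in> V" using K by blast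
  moreover have "\<bar>if j = K then 1 else 0 :: int\<bar> \<le> 2 ^ Suc j" for j
    using one_le_power[of "2::int" "Suc j"] by auto
  ultimately have "(if K = K then 1 else 0 :: int) = 0" using sparse by blast
  then show False by simp
qed

end

section \<open>Finite Fourier analysis\<close>

text \<open>Representatives of the group \<open>(Z/n)^T\<close>, written as functions on the whole
  index type so that they already are elements of the ambient group.\<close>

definition box :: "'b set \<Rightarrow> int \<Rightarrow> ('b \<Rightarrow> int) set"
  where "box T n = {x. \<forall>i. if i \<in> T then 0 \<le> x i \<and> x i < n else x i = 0}"

text \<open>The self-dual pairing of \<open>(Z/n)^T\<close>: \<open>k\<close> indexes the
  characters. Neither argument has to be reduced modulo \<open>n\<close>, so each \<open>k\<close>
  gives a character of all integer-valued functions.\<close>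

definition fchar :: "'b set \<Rightarrow> int \<Rightarrow> ('b \<Rightarrow> int) \<Rightarrow> ('b \<Rightarrow> int) \<Rightarrow> complex"
  where "fchar T n k x = cis (2 * pi * (real_of_int (\<Sum>i\<in>T. k i * x i) / real_of_int n))"

lemma finite_box: "finite T \<Longrightarrow> finite (box T n)"
proof (rule finite_imageD[of "\<lambda>x. restrict x T"])
  assume "finite T"
  then have "finite (T \<rightarrow>\<^sub>E {0..<n})" by (intro finite_PiE) auto
  moreover have "(\<lambda>x. restrict x T) ` box T n \<subseteq> (T \<rightarrow>\<^sub>E {0..<n})"
    by (auto simp: box_def split: if_splits)
  ultimately show "finite ((\<lambda>x. restrict x T) ` box T n)" by (rule finite_subset[rotated])
  show "inj_on (\<lambda>x. restrict x T) (box T n)"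
  proof (rule inj_onI, rule ext)
    fix x y i assume *: "x \<in> box T n" "y \<in> box T n" "restrict x T = restrict y T"
    show "x i = y i"
      using fun_cong[OF *(3), of i] *(1,2) by (cases "i \<in> T") (auto simp: box_def)
  qed
qed

lemma zero_in_box: "n > 0 \<Longrightarrow> 0 \<in> box T n"
  by (simp add: box_def)

lemma fchar_commute: "fchar T n k x = fchar T n x k"
  by (simp add: fchar_def mult.commute)

lemma fchar_add: "fchar T n k (x + y) = fchar T n k x * fchar T n k y"
  by (simp add: fchar_def cis_mult distrib_left sum.distrib add_divide_distrib)

lemma fchar_uminus: "fchar T n k (- x) = cnj (fchar T n k x)"
  by (simp add: fchar_def cis_cnj sum_negf)

lemma fchar_diff: "fchar T n k (x - y) = fchar T n k x * cnj (fchar T n k y)"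
  using fchar_add[of T n k x "- y"] by (simp add: fchar_uminus)

lemma norm_fchar: "norm (fchar T n k x) = 1"
  by (simp add: fchar_def)

lemma fchar_zero: "fchar T n 0 x = 1" "fchar T n x 0 = 1"
  by (simp_all add: fchar_def)

lemma fchar_eq_1:
  assumes "\<And>i. i \<in> T \<Longrightarrow> n dvd x i" "n > 0"
  shows "fchar T n k x = 1"
proof -
  have "n dvd (\<Sum>i\<in>T. k i * x i)" by (rule dvd_sum) (use assms in auto)
  then obtain m where m: "(\<Sum>i\<in>T. k i * x i) = n * m" by blast
  have "fchar T n k x = cis (2 * pi * real_of_int m)"
    unfolding fchar_def m using assms(2) by simp
  then show ?thesis by (simp add: cis_multiple_2pi)
qed

text \<open>Raising the \<open>i\<close>-th coordinate of \<open>k\<close> by one modulo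
  \<open>n\<close> permutes the box and multiplies every summand by the same \<open>z\<close>, which
  differs from 1.\<close>

lemma sum_fchar_eq_0:
  assumes T: "finite T" and n: "n > 0" and i: "i \<in> T" "\<not> n dvd x i"
  shows "(\<Sum>k\<in>box T n. fchar T n k x) = 0"
proof -
  define e where "e = (\<lambda>j. if j = i then 1 else 0 :: int)"
  define \<phi> where "\<phi> k = k(i := (k i + 1) mod n)" for k :: "'a \<Rightarrow> int"
  define z where "z = fchar T n e x"
  have z: "z = cis (2 * pi * (real_of_int (x i) / real_of_int n))"
    unfolding z_def fchar_def e_def using T i(1)
    by (simp add: if_distrib[of "\<lambda>a. a * _"] cong: if_cong)
  have "z \<noteq> 1"
  proof
    assume "z = 1"
    then have "cos (2 * pi * (real_of_int (x i) / real_of_int n)) = 1"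
      using z by (metis cis.sel(1) one_complex.sel(1))
    then obtain m :: int where "2 * pi * (real_of_int (x i) / real_of_int n) = real_of_int m * 2 * pi"
      by (auto simp: cos_one_2pi_int)
    then have "real_of_int (x i) = real_of_int (m * n)" using n by (simp add: field_simps)
    then have "x i = m * n" by (simp only: of_int_eq_iff)
    then show False using i(2) by simp
  qed
  have step: "fchar T n (\<phi> k) x = fchar T n k x * z" for k
  proof -
    have "fchar T n (\<phi> k) x = fchar T n x ((k + e) + (\<phi> k - (k + e)))"
      by (simp only: add_diff_cancel_left' add.commute[of "k + e"] diff_add_cancel fchar_commute)
    also have "\<dots> = fchar T n x (k + e) * fchar T n x (\<phi> k - (k + e))" by (rule fchar_add)
    also have "fchar T n x (\<phi> k - (k + e)) = 1"
    proof (rule fchar_eq_1[OF _ n])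
      fix j assume "j \<in> T"
      show "n dvd (\<phi> k - (k + e)) j"
      proof (cases "j = i")
        case True
        then show ?thesis by (simp add: \<phi>_def e_def mod_eq_dvd_iff flip: mod_eq_dvd_iff)
      qed (simp add: \<phi>_def e_def)
    qed
    finally show ?thesis unfolding mult_1_right fchar_add z_def fchar_commute[of T n x] .
  qed
  have maps: "\<phi> ` box T n \<subseteq> box T n"
    using n i(1) by (auto simp: box_def \<phi>_def)
  have inj: "inj_on \<phi> (box T n)"
  proof (rule inj_onI, rule ext)
    fix k l j assume *: "k \<in> box T n" "l \<in> box T n" "\<phi> k = \<phi> l"
    show "k j = l j"
    proof (cases "j = i")
      case True
      have kl: "0 \<le> k i" "k i < n" "0 \<le> l i" "l i < n"
        using *(1,2) i(1) unfolding box_def by (auto dest!: spec[of _ i])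
      have "(k i + 1) mod n = (l i + 1) mod n"
        using fun_cong[OF *(3), of i] by (simp add: \<phi>_def)
      then have "n dvd k i - l i" by (simp add: mod_eq_dvd_iff)
      then have "k i - l i = 0" using kl zdvd_imp_le[of n "\<bar>k i - l i\<bar>"] by fastforce
      then show ?thesis using True by simp
    next
      case False
      then show ?thesis using fun_cong[OF *(3), of j] by (simp add: \<phi>_def)
    qed
  qed
  have "\<phi> ` box T n = box T n" using endo_inj_surj[OF finite_box[OF T] maps inj] .
  then have "(\<Sum>k\<in>box T n. fchar T n k x) = (\<Sum>k\<in>box T n. fchar T n (\<phi> k) x)"
    using sum.reindex[OF inj, of "\<lambda>k. fchar T n k x"] by simp
  also have "\<dots> = z * (\<Sum>k\<in>box T n. fchar T n k x)"
    by (simp add: step sum_distrib_left mult.commute)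
  finally have "(1 - z) * (\<Sum>k\<in>box T n. fchar T n k x) = 0" by (simp add: algebra_simps)
  then show ?thesis using \<open>z \<noteq> 1\<close> by simp
qed

lemma box_eqI:
  assumes "x \<in> box T n" "y \<in> box T n" "\<And>i. i \<in> T \<Longrightarrow> n dvd (x - y) i"
  shows "x = y"
proof
  fix i
  show "x i = y i"
  proof (cases "i \<in> T")
    case True
    then have "\<bar>x i - y i\<bar> < n" using assms(1,2) unfolding box_def by (auto dest!: spec[of _ i])
    moreover have "n dvd x i - y i" using assms(3)[OF True] by simp
    ultimately have "x i - y i = 0" using zdvd_imp_le[of n "\<bar>x i - y i\<bar>"] by fastforce
    then show ?thesis by simp
  next
    case False
    then show ?thesis using assms(1,2) by (simp add: box_def)
  qed
qed

lemma fourier_parseval: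
  assumes T: "finite T" and n: "n > 0" and B: "B \<subseteq> box T n"
  shows "(\<Sum>k\<in>box T n. (cmod (\<Sum>b\<in>B. fchar T n k b))\<^sup>2) = real (card (box T n)) * real (card B)"
proof -
  have fin: "finite B" using B finite_box[OF T] finite_subset by blast
  have "complex_of_real (\<Sum>k\<in>box T n. (cmod (\<Sum>b\<in>B. fchar T n k b))\<^sup>2)
      = (\<Sum>k\<in>box T n. \<Sum>a\<in>B. \<Sum>b\<in>B. fchar T n k (a - b))"
    by (simp add: complex_norm_square sum_product fchar_diff del: of_real_power)
  also have "\<dots> = (\<Sum>a\<in>B. \<Sum>b\<in>B. \<Sum>k\<in>box T n. fchar T n k (a - b))"
    by (subst sum.swap) (simp add: sum.swap[of _ "box T n" B])
  also have "\<dots> = (\<Sum>a\<in>B. \<Sum>b\<in>B. if a = b then of_nat (card (box T n)) else 0)"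
  proof (intro sum.cong refl)
    fix a b assume ab: "a \<in> B" "b \<in> B"
    show "(\<Sum>k\<in>box T n. fchar T n k (a - b)) = (if a = b then of_nat (card (box T n)) else 0)"
    proof (cases "a = b")
      case True
      then show ?thesis by (simp add: fchar_zero)
    next
      case False
      then obtain i where "i \<in> T" "\<not> n dvd (a - b) i" using box_eqI[of a T n b] ab B by blast
      then show ?thesis using False sum_fchar_eq_0[OF T n] by auto
    qed
  qed
  also have "\<dots> = complex_of_real (real (card (box T n)) * real (card B))"
    using fin by (simp add: sum.delta)
  finally show ?thesis using of_real_eq_iff by blast
qed

text \<open>Expanding the fourth power turns the sum into one over quadruples from \<open>B\<close>.
  By orthogonality a quadruple contributes only if \<open>x + a - b + c - d\<close> vanishes modulo
  \<open>n\<close>, which \<open>x\<close> excludes.\<close>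

lemma fourier_fourth_moment:
  assumes T: "finite T" and n: "n > 0"
    and x: "\<And>a b c d. a \<in> B \<Longrightarrow> b \<in> B \<Longrightarrow> c \<in> B \<Longrightarrow> d \<in> B \<Longrightarrow> \<exists>i\<in>T. \<not> n dvd (x + a - b + c - d) i"
  shows "(\<Sum>k\<in>box T n. of_real ((cmod (\<Sum>b\<in>B. fchar T n k b)) ^ 4) * fchar T n k x) = 0"
proof -
  have "(\<Sum>k\<in>box T n. of_real ((cmod (\<Sum>b\<in>B. fchar T n k b)) ^ 4) * fchar T n k x)
      = (\<Sum>k\<in>box T n. \<Sum>a\<in>B. \<Sum>b\<in>B. \<Sum>c\<in>B. \<Sum>d\<in>B. fchar T n k (x + a - b + c - d))"
  proof (intro sum.cong refl)
    fix k
    let ?S = "\<Sum>b\<in>B. fchar T n k b"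
    have "complex_of_real ((cmod ?S) ^ 4) = (complex_of_real ((cmod ?S)\<^sup>2))\<^sup>2"
      by (simp flip: power_mult)
    also have "\<dots> = (?S * cnj ?S) * (?S * cnj ?S)"
      by (simp only: complex_norm_square power2_eq_square[of "_ * _"])
    also have "?S * cnj ?S = (\<Sum>a\<in>B. \<Sum>b\<in>B. fchar T n k (a - b))"
      by (simp add: sum_product fchar_diff)
    finally have "of_real ((cmod ?S) ^ 4) * fchar T n k x
        = (\<Sum>a\<in>B. \<Sum>b\<in>B. fchar T n k (a - b)) * (\<Sum>a\<in>B. \<Sum>b\<in>B. fchar T n k (a - b)) * fchar T n k x"
      by simp
    also have "\<dots> = (\<Sum>a\<in>B. \<Sum>b\<in>B. \<Sum>c\<in>B. \<Sum>d\<in>B.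
        fchar T n k (c - d) * (fchar T n k (a - b) * fchar T n k x))"
      by (simp add: sum_distrib_left sum_distrib_right mult.assoc)
    also have "\<dots> = (\<Sum>a\<in>B. \<Sum>b\<in>B. \<Sum>c\<in>B. \<Sum>d\<in>B. fchar T n k (x + a - b + c - d))"
      by (simp add: fchar_diff fchar_add mult_ac)
    finally show "of_real ((cmod ?S) ^ 4) * fchar T n k x
      = (\<Sum>a\<in>B. \<Sum>b\<in>B. \<Sum>c\<in>B. \<Sum>d\<in>B. fchar T n k (x + a - b + c - d))" .
  qed
  also have "\<dots> = (\<Sum>a\<in>B. \<Sum>k\<in>box T n. \<Sum>b\<in>B. \<Sum>c\<in>B. \<Sum>d\<in>B. fchar T n k (x + a - b + c - d))"
    by (rule sum.swap)
  also have "\<dots> = (\<Sum>a\<in>B. \<Sum>b\<in>B. \<Sum>k\<in>box T n. \<Sum>c\<in>B. \<Sum>d\<in>B. fchar T n k (x + a - b + c - d))"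
    by (intro sum.cong refl sum.swap)
  also have "\<dots> = (\<Sum>a\<in>B. \<Sum>b\<in>B. \<Sum>c\<in>B. \<Sum>k\<in>box T n. \<Sum>d\<in>B. fchar T n k (x + a - b + c - d))"
    by (intro sum.cong refl sum.swap)
  also have "\<dots> = (\<Sum>a\<in>B. \<Sum>b\<in>B. \<Sum>c\<in>B. \<Sum>d\<in>B. \<Sum>k\<in>box T n. fchar T n k (x + a - b + c - d))"
    by (intro sum.cong refl sum.swap)
  also have "\<dots> = 0"
  proof (rule sum.neutral, rule ballI, rule sum.neutral, rule ballI, rule sum.neutral, rule ballI,
      rule sum.neutral, rule ballI)
    fix a b c d assume "a \<in> B" "b \<in> B" "c \<in> B" "d \<in> B"
    then obtain i where "i \<in> T" "\<not> n dvd (x + a - b + c - d) i" using x by blast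
    then show "(\<Sum>k\<in>box T n. fchar T n k (x + a - b + c - d)) = 0" by (rule sum_fchar_eq_0[OF T n])
  qed
  finally show ?thesis .
qed


text \<open>Bogolyubov's argument. Over the whole box the sum of \<open>w k * fchar T n k x\<close>
  vanishes by the fourth moment. Parseval bounds the sum of the \<open>q k\<close> by 1, so
  frequencies with \<open>q k < \<kappa>\<close> contribute at most \<open>\<kappa>\<close> in
  modulus, and at most \<open>1 / \<kappa> = 4 * m ^ 4\<close> frequencies remain. The value
  \<open>\<kappa>\<close> is a quarter of the lower bound for \<open>w 0\<close>;
  \<open>folner_prodanov\<close> lives on this gap.\<close>

lemma large_spectrum:
  assumes T: "finite T" and n: "n > 0" and B: "B \<subseteq> box T n"
    and m: "m > 0" "card (box T n) \<le> m * card B"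
    and X: "\<forall>x\<in>X. \<forall>a\<in>B. \<forall>b\<in>B. \<forall>c\<in>B. \<forall>d\<in>B. \<exists>i\<in>T. \<not> n dvd (x + a - b + c - d) i"
  shows "\<exists>L w. L \<subseteq> box T n \<and> card L \<le> 4 * m ^ 4 \<and> (\<forall>k. 0 \<le> w k) \<and> (\<Sum>k\<in>L. w k) \<le> 1 \<and>
    0 \<in> L \<and> w 0 \<ge> 1 / real m ^ 4 \<and>
    (\<forall>x\<in>X. Re (\<Sum>k\<in>L. of_real (w k) * fchar T n k x) \<le> 1 / (4 * real m ^ 4))"
proof -
  define M where "M = real (card (box T n))"
  define q where "q k = (cmod (\<Sum>b\<in>B. fchar T n k b) / M)\<^sup>2" for k
  define w where "w k = (q k)\<^sup>2" for k
  define \<kappa> where "\<kappa> = 1 / (4 * real m ^ 4)"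
  define L where "L = {k \<in> box T n. q k \<ge> \<kappa>}"
  have fin: "finite (box T n)" by (rule finite_box[OF T])
  have "0 \<in> box T n" by (rule zero_in_box[OF n])
  then have M: "M > 0" unfolding M_def using fin by (auto simp: card_gt_0_iff)
  have finB: "finite B" using B fin finite_subset by blast
  have \<kappa>: "\<kappa> > 0" using m(1) by (simp add: \<kappa>_def)
  have cB: "real (card B) \<le> M" unfolding M_def using card_mono[OF fin B] by simp
  have q_nonneg: "q k \<ge> 0" for k by (simp add: q_def)
  have sum_q: "(\<Sum>k\<in>box T n. q k) \<le> 1"
  proof -
    have "(\<Sum>k\<in>box T n. q k) = M * real (card B) / M\<^sup>2"
      using fourier_parseval[OF T n B]
      by (simp add: q_def power_divide M_def flip: sum_divide_distrib)
    also have "\<dots> \<le> 1" using M cB by (simp add: power2_eq_square field_simps)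
    finally show ?thesis .
  qed
  have q_le: "q k \<le> 1" if "k \<in> box T n" for k
    using member_le_sum[of k "box T n" q] that fin q_nonneg sum_q by force
  have LB: "L \<subseteq> box T n" by (auto simp: L_def)
  have finL: "finite L" using LB fin finite_subset by blast
  have "real (card L) * \<kappa> \<le> (\<Sum>k\<in>L. q k)"
    by (rule sum_bounded_below) (simp add: L_def)
  also have "\<dots> \<le> (\<Sum>k\<in>box T n. q k)"
    by (rule sum_mono2[OF fin LB]) (use q_nonneg in auto)
  finally have "real (card L) * \<kappa> \<le> 1" using sum_q by linarith
  then have "real (card L) \<le> real (4 * m ^ 4)"
    using m(1) by (simp add: \<kappa>_def field_simps)
  then have cardL: "card L \<le> 4 * m ^ 4" by (simp only: of_nat_le_iff)
  have sum_w: "(\<Sum>k\<in>L. w k) \<le> 1"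
  proof -
    have "(\<Sum>k\<in>L. w k) \<le> (\<Sum>k\<in>L. q k)"
    proof (rule sum_mono)
      fix k assume "k \<in> L"
      then show "w k \<le> q k"
        using q_le[of k] q_nonneg[of k] LB mult_left_le[of "q k" "q k"] by (auto simp: w_def power2_eq_square)
    qed
    also have "\<dots> \<le> (\<Sum>k\<in>box T n. q k)"
      by (rule sum_mono2[OF fin LB]) (use q_nonneg in auto)
    finally show ?thesis using sum_q by linarith
  qed
  have q0: "q 0 \<ge> 1 / real m ^ 2"
  proof -
    have "M \<le> real m * real (card B)" unfolding M_def using m(2) by (simp flip: of_nat_mult)
    then have "real (card B) / M \<ge> 1 / real m" using M m(1) by (simp add: field_simps)
    then have "(1 / real m)\<^sup>2 \<le> (real (card B) / M)\<^sup>2" by (intro power_mono) auto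
    then show ?thesis by (simp add: q_def fchar_zero power_divide)
  qed
  have w0: "w 0 \<ge> 1 / real m ^ 4"
  proof -
    have "(1 / real m ^ 2)\<^sup>2 \<le> (q 0)\<^sup>2" using q0 by (intro power_mono) auto
    then show ?thesis by (simp add: w_def power_divide flip: power_mult)
  qed
  have "\<kappa> \<le> 1 / real m ^ 2"
  proof -
    have "real m ^ 2 \<le> real m ^ 4" using m(1) by (intro power_increasing) auto
    also have "real m ^ 4 \<le> 4 * real m ^ 4" by simp
    finally show ?thesis using m(1) unfolding \<kappa>_def by (intro divide_left_mono) auto
  qed
  then have "0 \<in> L" using q0 \<open>0 \<in> box T n\<close> unfolding L_def by auto
  moreover have "Re (\<Sum>k\<in>L. of_real (w k) * fchar T n k x) \<le> \<kappa>" if x: "x \<in> X" for x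
  proof -
    let ?f = "\<lambda>k. of_real (w k) * fchar T n k x"
    have wk: "w k = (cmod (\<Sum>b\<in>B. fchar T n k b)) ^ 4 / M ^ 4" for k
      by (simp add: w_def q_def power_divide flip: power_mult)
    have "(\<Sum>k\<in>box T n. ?f k)
        = (\<Sum>k\<in>box T n. of_real ((cmod (\<Sum>b\<in>B. fchar T n k b)) ^ 4) * fchar T n k x) / of_real (M ^ 4)"
      by (simp add: wk sum_divide_distrib)
    also have "\<dots> = 0" using fourier_fourth_moment[OF T n X[rule_format, OF x]] by simp
    finally have "(\<Sum>k\<in>L. ?f k) = - (\<Sum>k\<in>box T n - L. ?f k)"
      using sum.subset_diff[OF LB fin, of ?f] by (simp add: eq_neg_iff_add_eq_0 add.commute)
    then have "Re (\<Sum>k\<in>L. ?f k) \<le> cmod (\<Sum>k\<in>box T n - L. ?f k)"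
      by (metis complex_Re_le_cmod norm_minus_cancel)
    also have "\<dots> \<le> (\<Sum>k\<in>box T n - L. w k)"
      by (rule sum_norm_le) (simp add: norm_mult norm_power norm_fchar w_def q_nonneg)
    also have "\<dots> \<le> (\<Sum>k\<in>box T n - L. \<kappa> * q k)"
    proof (rule sum_mono)
      fix k assume "k \<in> box T n - L"
      then have "q k \<le> \<kappa>" by (auto simp: L_def not_le)
      then show "w k \<le> \<kappa> * q k"
        unfolding w_def power2_eq_square by (rule mult_right_mono) (rule q_nonneg)
    qed
    also have "\<dots> = \<kappa> * (\<Sum>k\<in>box T n - L. q k)" by (simp add: sum_distrib_left)
    also have "\<dots> \<le> \<kappa> * 1"
    proof (rule mult_left_mono)
      have "(\<Sum>k\<in>box T n - L. q k) \<le> (\<Sum>k\<in>box T n. q k)"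
        by (rule sum_mono2[OF fin]) (use q_nonneg in auto)
      then show "(\<Sum>k\<in>box T n - L. q k) \<le> 1" using sum_q by linarith
    qed (use \<kappa> in simp)
    finally show ?thesis by simp
  qed
  ultimately show ?thesis
    unfolding \<kappa>_def using LB cardL sum_w w0
    by (intro exI[of _ L] exI[of _ w]) (auto simp: w_def)
qed

text \<open>Numbering the frequencies and padding with weight 0 gives the data a shape that depends
  on \<open>m\<close> alone and not on \<open>T\<close>, \<open>n\<close> or \<open>X\<close>, as
  the compactness argument in \<open>bohr\<close> requires. The trivial character always receives
  number 0.\<close>

lemma large_spectrum_enumerated:
  assumes T: "finite T" and n: "n > 0" and B: "B \<subseteq> box T n"
    and m: "m > 0" "card (box T n) \<le> m * card B"
    and X: "\<forall>x\<in>X. \<forall>a\<in>B. \<forall>b\<in>B. \<forall>c\<in>B. \<forall>d\<in>B. \<exists>i\<in>T. \<not> n dvd (x + a - b + c - d) i"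
  shows "\<exists>(\<psi> :: nat \<Rightarrow> ('b \<Rightarrow> int) \<Rightarrow> complex) w.
    (\<forall>j x y. \<psi> j (x + y) = \<psi> j x * \<psi> j y) \<and> (\<forall>j x. norm (\<psi> j x) = 1) \<and> (\<forall>x. \<psi> 0 x = 1) \<and>
    (\<forall>j. 0 \<le> w j) \<and> (\<Sum>j\<le>4 * m ^ 4. w j) \<le> 1 \<and> w 0 \<ge> 1 / real m ^ 4 \<and>
    (\<forall>x\<in>X. Re (\<Sum>j\<le>4 * m ^ 4. of_real (w j) * \<psi> j x) \<le> 1 / (4 * real m ^ 4))"
proof -
  obtain L v where "L \<subseteq> box T n \<and> card L \<le> 4 * m ^ 4 \<and> (\<forall>k. 0 \<le> v k) \<and> (\<Sum>k\<in>L. v k) \<le> 1 \<and>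
    0 \<in> L \<and> v 0 \<ge> 1 / real m ^ 4 \<and>
    (\<forall>x\<in>X. Re (\<Sum>k\<in>L. of_real (v k) * fchar T n k x) \<le> 1 / (4 * real m ^ 4))"
    using large_spectrum[OF assms] by (elim exE)
  then have L: "L \<subseteq> box T n" "card L \<le> 4 * m ^ 4" "\<And>k. 0 \<le> v k" "(\<Sum>k\<in>L. v k) \<le> 1"
    "0 \<in> L" "v 0 \<ge> 1 / real m ^ 4"
    "\<And>x. x \<in> X \<Longrightarrow> Re (\<Sum>k\<in>L. of_real (v k) * fchar T n k x) \<le> 1 / (4 * real m ^ 4)"
    by simp_all
  have finL: "finite L" using L(1) finite_box[OF T] finite_subset by blast
  define r where "r = card (L - {0})"
  obtain h where h: "bij_betw h {0..<r} (L - {0})"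
    using ex_bij_betw_nat_finite[of "L - {0}"] finL unfolding r_def by blast
  define R where "R = 4 * m ^ 4"
  have r: "r \<le> R" using card_mono[OF finL, of "L - {0}"] L(2) unfolding r_def R_def by simp
  define \<psi> where "\<psi> j = (case j of 0 \<Rightarrow> fchar T n 0 | Suc i \<Rightarrow> fchar T n (h i))" for j
  define w where "w j = (case j of 0 \<Rightarrow> v 0 | Suc i \<Rightarrow> if i < r then v (h i) else 0)" for j
  have sum_eq: "(\<Sum>j\<le>R. f (w j) (\<psi> j)) = (\<Sum>k\<in>L. f (v k) (fchar T n k))"
    if f: "\<And>c. f 0 c = 0" for f :: "real \<Rightarrow> (('b \<Rightarrow> int) \<Rightarrow> complex) \<Rightarrow> 'd::comm_monoid_add"
  proof -
    have "(\<Sum>j\<le>R. f (w j) (\<psi> j))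
        = f (v 0) (fchar T n 0) + (\<Sum>i<R. f (w (Suc i)) (\<psi> (Suc i)))"
      unfolding sum.atMost_shift by (simp add: w_def \<psi>_def)
    also have "(\<Sum>i<R. f (w (Suc i)) (\<psi> (Suc i))) = (\<Sum>i\<in>{0..<r}. f (w (Suc i)) (\<psi> (Suc i)))"
      by (rule sum.mono_neutral_right) (use r f in \<open>auto simp: w_def\<close>)
    also have "\<dots> = (\<Sum>i\<in>{0..<r}. f (v (h i)) (fchar T n (h i)))"
      by (simp add: w_def \<psi>_def)
    also have "\<dots> = (\<Sum>k\<in>L - {0}. f (v k) (fchar T n k))"
      by (rule sum.reindex_bij_betw[OF h])
    also have "f (v 0) (fchar T n 0) + \<dots> = (\<Sum>k\<in>L. f (v k) (fchar T n k))"
      using sum.remove[OF finL L(5), of "\<lambda>k. f (v k) (fchar T n k)"] by simp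
    finally show ?thesis .
  qed
  show ?thesis unfolding R_def[symmetric]
  proof (intro exI[of _ \<psi>] exI[of _ w] conjI allI ballI)
    show "\<psi> j (x + y) = \<psi> j x * \<psi> j y" "norm (\<psi> j x) = 1" for j x y
      by (auto simp: \<psi>_def fchar_add norm_fchar split: nat.split)
    show "\<psi> 0 x = 1" for x by (simp add: \<psi>_def fchar_zero)
    show "0 \<le> w j" for j using L(3) by (auto simp: w_def split: nat.split)
    show "(\<Sum>j\<le>R. w j) \<le> 1" using sum_eq[of "\<lambda>a c. a"] L(4) by simp
    show "w 0 \<ge> 1 / real m ^ 4" using L(6) by (simp add: w_def)
    show "Re (\<Sum>j\<le>R. of_real (w j) * \<psi> j x) \<le> 1 / (4 * real m ^ 4)" if "x \<in> X" for x
      using sum_eq[of "\<lambda>a c. of_real a * c x"] L(7)[OF that] by simp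
  qed
qed

section \<open>The Folner-Prodanov lemma\<close>

text \<open>A character of the whole type, not only of \<open>H\<close>; the subgroup enters only
  with continuity.\<close>

definition unit_char :: "('a::ab_group_add \<Rightarrow> complex) \<Rightarrow> bool"
  where "unit_char \<theta> \<longleftrightarrow> (\<forall>x y. \<theta> (x + y) = \<theta> x * \<theta> y) \<and> (\<forall>x. norm (\<theta> x) = 1)"

lemma unit_char_add: "unit_char \<theta> \<Longrightarrow> \<theta> (x + y) = \<theta> x * \<theta> y"
  and unit_char_norm: "unit_char \<theta> \<Longrightarrow> norm (\<theta> x) = 1"
  by (auto simp: unit_char_def)

lemma unit_char_zero: "unit_char \<theta> \<Longrightarrow> \<theta> 0 = 1"
  using unit_char_add[of \<theta> 0 0] unit_char_norm[of \<theta> 0] by auto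

lemma unit_char_minus: "unit_char \<theta> \<Longrightarrow> \<theta> (- x) = cnj (\<theta> x)"
proof -
  assume \<theta>: "unit_char \<theta>"
  have "\<theta> (- x) * \<theta> x = 1" using unit_char_add[OF \<theta>, of "- x" x] unit_char_zero[OF \<theta>] by simp
  moreover have "cnj (\<theta> x) * \<theta> x = 1"
    using complex_norm_square[of "\<theta> x"] unit_char_norm[OF \<theta>, of x] by (simp add: mult.commute)
  ultimately show ?thesis
    by (metis mult_right_cancel mult_zero_right zero_neq_one)
qed

lemma unit_char_of_nat_mult:
  fixes \<theta> :: "'a::comm_ring_1 \<Rightarrow> complex"
  shows "unit_char \<theta> \<Longrightarrow> \<theta> (of_nat n * x) = \<theta> x ^ n"
  by (induction n) (simp_all add: unit_char_zero unit_char_add ring_distribs)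

lemma unit_char_dist_add:
  assumes \<theta>: "unit_char \<theta>"
  shows "cmod (\<theta> (x + y) - 1) \<le> cmod (\<theta> x - 1) + cmod (\<theta> y - 1)"
proof -
  have "\<theta> (x + y) - 1 = \<theta> x * (\<theta> y - 1) + (\<theta> x - 1)"
    by (simp add: unit_char_add[OF \<theta>] algebra_simps)
  then have "cmod (\<theta> (x + y) - 1) \<le> cmod (\<theta> x * (\<theta> y - 1)) + cmod (\<theta> x - 1)"
    by (metis norm_triangle_ineq)
  then show ?thesis by (simp add: norm_mult unit_char_norm[OF \<theta>])
qed

lemma unit_char_dist_minus:
  assumes \<theta>: "unit_char \<theta>"
  shows "cmod (\<theta> (- x) - 1) = cmod (\<theta> x - 1)"
proof -
  have "\<theta> (- x) - 1 = cnj (\<theta> x - 1)" by (simp add: unit_char_minus[OF \<theta>])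
  then show ?thesis by (simp only: complex_mod_cnj)
qed

lemma Re_ge_of_dist_1:
  assumes "cmod (z - 1) \<le> r"
  shows "Re z \<ge> 1 - r"
  using abs_Re_le_cmod[of "z - 1"] assms by simp

lemma norm_geometric_sum_le:
  assumes "cmod z = 1" "cmod (z - 1) \<ge> 1"
  shows "cmod (\<Sum>i<n. z ^ i) \<le> 2"
proof -
  have z: "z \<noteq> 1" using assms(2) by auto
  have "cmod (\<Sum>i<n. z ^ i) = cmod (z ^ n - 1) / cmod (z - 1)"
    using geometric_sum[OF z, of n] by (simp add: norm_divide)
  also have "\<dots> \<le> cmod (z ^ n - 1)"
    using assms(2) by (intro divide_le_eq_1_pos[THEN iffD2] mult_imp_div_pos_le)
      (auto intro: order_trans[OF _ mult_left_mono[of 1 "cmod (z - 1)" "cmod (z ^ n - 1)"]])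
  also have "\<dots> \<le> cmod (z ^ n) + 1" by (metis norm_one norm_triangle_ineq4)
  finally show ?thesis using assms(1) by (simp add: norm_power)
qed

context group_base
begin

definition continuous_char :: "('a \<Rightarrow> complex) \<Rightarrow> bool"
  where "continuous_char \<theta> \<longleftrightarrow> unit_char \<theta> \<and> (\<exists>U\<in>N. \<forall>u\<in>U. cmod (\<theta> u - 1) < 1)"

text \<open>If \<open>z\<close> is on the unit circle within distance 1 of 1, then its real part
  exceeds 1/2, and squaring multiplies the distance to 1 by \<open>cmod (z + 1)\<close>, which is at
  least 3/2. Halving the neighbourhood therefore improves the bound by the factor 2/3.\<close>

lemma continuous_charD:
  assumes \<theta>: "continuous_char \<theta>" and \<epsilon>: "\<epsilon> > 0"
  shows "\<exists>U\<in>N. \<forall>u\<in>U. cmod (\<theta> u - 1) < \<epsilon>"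
proof -
  have uc: "unit_char \<theta>" using \<theta> by (simp add: continuous_char_def)
  have "\<exists>U\<in>N. \<forall>u\<in>U. cmod (\<theta> u - 1) < 1 \<and> cmod (\<theta> u - 1) \<le> (2 / 3) ^ k" for k
  proof (induction k)
    case 0
    then show ?case using \<theta> unfolding continuous_char_def by (auto intro: less_imp_le)
  next
    case (Suc k)
    then obtain U where U: "U \<in> N" "\<forall>u\<in>U. cmod (\<theta> u - 1) < 1 \<and> cmod (\<theta> u - 1) \<le> (2 / 3) ^ k" by blast
    obtain V where V: "V \<in> N" "V \<subseteq> U" "\<And>x y. x \<in> V \<Longrightarrow> y \<in> V \<Longrightarrow> x + y \<in> U"
      using half_diff[OF U(1)] by metis
    have "cmod (\<theta> u - 1) \<le> (2 / 3) ^ Suc k" if u: "u \<in> V" for u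
    proof -
      let ?z = "\<theta> u"
      have lt: "cmod (?z - 1) < 1" using U(2) V(2) u by blast
      have "Re ?z > 1 / 2"
      proof -
        have "(cmod (?z - 1))\<^sup>2 < 1" using lt by (simp add: power_less_one_iff abs_square_less_1)
        moreover have "(Re ?z)\<^sup>2 + (Im ?z)\<^sup>2 = 1"
          using unit_char_norm[OF uc, of u] by (metis cmod_power2 one_power2)
        ultimately show ?thesis by (simp add: cmod_power2 power2_diff algebra_simps)
      qed
      then have "cmod (?z + 1) \<ge> 3 / 2" using complex_Re_le_cmod[of "?z + 1"] by simp
      then have "(3 / 2) * cmod (?z - 1) \<le> cmod (?z + 1) * cmod (?z - 1)"
        by (intro mult_right_mono) auto
      also have "\<dots> = cmod (\<theta> (u + u) - 1)"
        unfolding unit_char_add[OF uc] norm_mult[symmetric] by (simp add: algebra_simps)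
      also have "\<dots> \<le> (2 / 3) ^ k" using U(2) V(3)[OF u u] by blast
      finally show ?thesis by simp
    qed
    then show ?case using U V by blast
  qed
  moreover obtain k where "(2 / 3 :: real) ^ k < \<epsilon>"
    using real_arch_pow_inv[OF \<epsilon>, of "2 / 3"] by auto
  ultimately show ?thesis by (meson le_less_trans)
qed

text \<open>The averages run over multiples of small elements at which a discontinuous character stays far
  from \<open>1\<close>, so they become geometric sums.\<close>

lemma average_discontinuous:
  fixes n :: nat
  assumes U: "U \<in> N" and \<delta>: "\<delta> > 0" and uc: "\<And>j. j < n \<Longrightarrow> unit_char (\<theta> j)"
  shows "\<exists>(I :: (nat \<Rightarrow> nat) set) f. finite I \<and> I \<noteq> {} \<and> (\<forall>g\<in>I. f g \<in> U) \<and>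
    (\<forall>j<n. \<not> continuous_char (\<theta> j) \<longrightarrow> cmod (\<Sum>g\<in>I. \<theta> j (f g)) \<le> \<delta> * real (card I))"
proof -
  \<comment> \<open>A geometric sum of modulus at most 2 is to be at most \<open>\<delta>\<close>
    times its number \<open>M\<close> of terms.\<close>
  obtain M :: nat where M: "2 / \<delta> < real M" using reals_Archimedean2 by blast
  then have M0: "M > 0" using \<delta> by (smt (verit) divide_pos_pos of_nat_0_less_iff)
  obtain V where V: "V \<in> N" "V \<subseteq> U" "\<forall>k\<le>n. \<forall>f. (\<forall>i<k. f i \<in> V) \<longrightarrow> (\<Sum>i<k. f i) \<in> U"
    using fraction[OF U, of n] by blast
  obtain W where W: "W \<in> N" "W \<subseteq> V" "\<And>x i. x \<in> W \<Longrightarrow> \<bar>i\<bar> \<le> int M \<Longrightarrow> of_int i * x \<in> V"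
    using fraction_mult[OF V(1), of M] by blast
  have "\<exists>p. p \<in> W \<and> (j < n \<and> \<not> continuous_char (\<theta> j) \<longrightarrow> cmod (\<theta> j p - 1) \<ge> 1)" for j
    using W(1) zero[OF W(1)] uc[of j] unfolding continuous_char_def by (meson not_less)
  then obtain p where p: "\<And>j. p j \<in> W" "\<And>j. j < n \<Longrightarrow> \<not> continuous_char (\<theta> j) \<Longrightarrow> cmod (\<theta> j (p j) - 1) \<ge> 1"
    by metis
  define I where "I = (\<Pi>\<^sub>E j\<in>{..<n}. {..<M})"
  \<comment> \<open>There is one independent multiplier for each character, so one family serves
    them all. The sum for \<open>\<theta> j\<close> factorises into \<open>n\<close> geometric sums:
    the factor at \<open>p j\<close> is at most 2, every other one at most \<open>M\<close>.\<close>
  define f where "f g = (\<Sum>j<n. of_nat (g j) * p j)" for g :: "nat \<Rightarrow> nat"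
  have finI: "finite I" unfolding I_def by (intro finite_PiE) auto
  have neI: "I \<noteq> {}" unfolding I_def using M0 by (auto simp: PiE_eq_empty_iff)
  have cardI: "card I = M ^ n" unfolding I_def by (simp add: card_PiE)
  have "f g \<in> U" if g: "g \<in> I" for g
  proof -
    have "of_nat (g j) * p j \<in> V" if "j < n" for j
      using W(3)[OF p(1), of "int (g j)" j] g that unfolding I_def by (force simp: PiE_iff)
    then show ?thesis unfolding f_def by (intro V(3)[rule_format]) auto
  qed
  moreover have "cmod (\<Sum>g\<in>I. \<theta> j (f g)) \<le> \<delta> * real (card I)"
    if j: "j < n" "\<not> continuous_char (\<theta> j)" for j
  proof -
    have \<theta>: "unit_char (\<theta> j)" using uc j by blast
    have \<theta>_sum: "\<theta> j (\<Sum>i<k. h i) = (\<Prod>i<k. \<theta> j (h i))" for k and h :: "nat \<Rightarrow> 'a"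
      by (induction k) (simp_all add: unit_char_zero[OF \<theta>] unit_char_add[OF \<theta>])
    have "(\<Sum>g\<in>I. \<theta> j (f g)) = (\<Sum>g\<in>I. \<Prod>i<n. \<theta> j (p i) ^ g i)"
      by (simp add: f_def \<theta>_sum unit_char_of_nat_mult[OF \<theta>])
    also have "\<dots> = (\<Prod>i<n. \<Sum>k<M. \<theta> j (p i) ^ k)"
      unfolding I_def by (rule prod_sum_PiE[symmetric]) auto
    finally have "cmod (\<Sum>g\<in>I. \<theta> j (f g)) = (\<Prod>i<n. cmod (\<Sum>k<M. \<theta> j (p i) ^ k))"
      by (simp flip: prod_norm)
    also have "\<dots> = cmod (\<Sum>k<M. \<theta> j (p j) ^ k) * (\<Prod>i\<in>{..<n} - {j}. cmod (\<Sum>k<M. \<theta> j (p i) ^ k))"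
      using j(1) by (subst prod.remove[of _ j]) auto
    also have "\<dots> \<le> 2 * (\<Prod>i\<in>{..<n} - {j}. real M)"
    proof (intro mult_mono prod_mono conjI norm_ge_zero prod_nonneg)
      show "cmod (\<Sum>k<M. \<theta> j (p j) ^ k) \<le> 2"
        by (rule norm_geometric_sum_le) (use unit_char_norm[OF \<theta>] p(2)[OF j] in auto)
      show "cmod (\<Sum>k<M. \<theta> j (p i) ^ k) \<le> real M" for i
        using sum_norm_le[of "{..<M}" "\<lambda>k. \<theta> j (p i) ^ k" "\<lambda>_. 1"] unit_char_norm[OF \<theta>]
        by (simp add: norm_power)
    qed auto
    also have "\<dots> = 2 * real M ^ (n - 1)" using j(1) by (simp add: card_Diff_singleton)
    also have "\<dots> \<le> \<delta> * real M * real M ^ (n - 1)"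
      using M \<delta> by (intro mult_right_mono) (auto simp: field_simps)
    also have "\<dots> = \<delta> * real (card I)"
      using j(1) by (simp add: cardI mult.assoc flip: power_Suc)
    finally show ?thesis .
  qed
  ultimately show ?thesis using finI neI by blast
qed

end

section \<open>Reduction modulo n in a free abelian group\<close>

lemma abs_div_le:
  fixes x n k :: int
  assumes n: "n > 0" and x: "- (k * n) \<le> x" "x < (k + 1) * n"
  shows "\<bar>x div n\<bar> \<le> k"
proof -
  have "x div n \<le> (k * n + (n - 1)) div n"
    using n x(2) by (intro zdiv_mono1) (auto simp: algebra_simps)
  also have "\<dots> = k" using n by (simp add: div_pos_pos_trivial)
  finally have "x div n \<le> k" .
  moreover have "(- k * n) div n \<le> x div n" using n x(1) by (intro zdiv_mono1) auto
  moreover have "(- k * n) div n = - k" using n by (intro nonzero_mult_div_cancel_right) simp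
  ultimately show ?thesis by linarith
qed

locale free_group_base = group_base H N for H :: "('b \<Rightarrow> int) set" and N +
  fixes S :: "'b set"
  assumes H_eq: "H = {x. finite {i. x i \<noteq> 0} \<and> {i. x i \<noteq> 0} \<subseteq> S}"
    and recur: "U \<in> N \<Longrightarrow> finite W \<Longrightarrow> W \<subseteq> H \<Longrightarrow> \<exists>n\<ge>m. \<forall>w\<in>W. of_nat n * w \<in> U"
begin

lemma in_HI: "finite T \<Longrightarrow> T \<subseteq> S \<Longrightarrow> (\<And>i. i \<notin> T \<Longrightarrow> x i = 0) \<Longrightarrow> x \<in> H"
  unfolding H_eq by (auto intro: finite_subset[of _ T])

text \<open>The set \<open>A - A + A - A + U\<close>. Its fourfold pattern comes from the fourth
  moment.\<close>

definition shifted_combs :: "('b \<Rightarrow> int) set \<Rightarrow> ('b \<Rightarrow> int) set \<Rightarrow> ('b \<Rightarrow> int) set"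
  where "shifted_combs A U = {a - b + c - d + u | a b c d u. a \<in> A \<and> b \<in> A \<and> c \<in> A \<and> d \<in> A \<and> u \<in> U}"

lemma shifted_combsI:
  "a \<in> A \<Longrightarrow> b \<in> A \<Longrightarrow> c \<in> A \<Longrightarrow> d \<in> A \<Longrightarrow> u \<in> U \<Longrightarrow> a - b + c - d + u \<in> shifted_combs A U"
  unfolding shifted_combs_def by blast

text \<open>By recurrence \<open>H\<close> may be reduced modulo \<open>n\<close> on finitely many coordinates at the cost of
  an error in \<open>U\<close> only, which makes finite Fourier analysis applicable.\<close>

lemma bohr_finite:
  assumes U: "U \<in> N" and E: "finite E" "E \<subseteq> H" "\<forall>x\<in>H. \<exists>e\<in>E. x - e \<in> A" and "A \<subseteq> H"
    and X: "finite X" "X \<subseteq> H" "X \<inter> shifted_combs A U = {}"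
  shows "\<exists>(\<psi> :: nat \<Rightarrow> ('b \<Rightarrow> int) \<Rightarrow> complex) w.
    (\<forall>j x y. \<psi> j (x + y) = \<psi> j x * \<psi> j y) \<and> (\<forall>j x. norm (\<psi> j x) = 1) \<and> (\<forall>x. \<psi> 0 x = 1) \<and>
    (\<forall>j. 0 \<le> w j) \<and> (\<Sum>j\<le>4 * card E ^ 4. w j) \<le> 1 \<and> w 0 \<ge> 1 / real (card E) ^ 4 \<and>
    (\<forall>x\<in>X. Re (\<Sum>j\<le>4 * card E ^ 4. of_real (w j) * \<psi> j x) \<le> 1 / (4 * real (card E) ^ 4))"
proof -
  define T where "T = (\<Union>x\<in>X \<union> E. {i. x i \<noteq> 0})"
  have T: "finite T" "T \<subseteq> S" using X(1,2) E(1,2) unfolding T_def H_eq by auto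
  have off_T: "x i = 0" if "x \<in> X \<union> E" "i \<notin> T" for x i using that unfolding T_def by blast
  obtain r where r: "\<And>x i. x \<in> X \<union> E \<Longrightarrow> \<bar>x i\<bar> \<le> int r"
  proof -
    have "finite ((\<lambda>(x, i). nat \<bar>x i\<bar>) ` ((X \<union> E) \<times> T))" using X(1) E(1) T(1) by auto
    then obtain r where r: "\<forall>k\<in>(\<lambda>(x, i). nat \<bar>x i\<bar>) ` ((X \<union> E) \<times> T). k \<le> r"
      using finite_nat_set_iff_bounded_le by meson
    show ?thesis
    proof (rule that[of r])
      fix x i assume x: "x \<in> X \<union> E"
      show "\<bar>x i\<bar> \<le> int r"
      proof (cases "i \<in> T")
        case True
        then have "nat \<bar>x i\<bar> \<le> r" using r x by force
        then show ?thesis by simp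
      qed (use off_T[OF x] in simp)
    qed
  qed
  obtain V where V: "V \<in> N"
    "\<And>a b c d e. a \<in> V \<Longrightarrow> b \<in> V \<Longrightarrow> c \<in> V \<Longrightarrow> d \<in> V \<Longrightarrow> e \<in> V \<Longrightarrow> a - b + c - d + e \<in> U"
    by (rule signed_sum5[OF U], rule that)
  \<comment> \<open>All vectors on \<open>T\<close> with entries between -3 and 3, whence 7 values.
    These contain the quotients by \<open>n\<close> that occur when \<open>b - e\<close> or
    \<open>x + a - b + c - d\<close> is reduced modulo \<open>n\<close>, once \<open>n\<close>
    exceeds the coordinates of \<open>e\<close> and \<open>x\<close>.\<close>
  define W where "W = (\<lambda>y i. if i \<in> T then y i - 3 else 0) ` box T 7"
  have W: "finite W" "W \<subseteq> H"
    using finite_box[OF T(1)] in_HI[OF T] unfolding W_def by auto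
  have WI: "w \<in> W" if "\<And>i. i \<in> T \<Longrightarrow> \<bar>w i\<bar> \<le> 3" "\<And>i. i \<notin> T \<Longrightarrow> w i = 0" for w
    unfolding W_def
  proof (rule image_eqI)
    show "w = (\<lambda>i. if i \<in> T then (if i \<in> T then w i + 3 else 0) - 3 else 0)" using that by auto
    show "(\<lambda>i. if i \<in> T then w i + 3 else 0) \<in> box T 7" using that(1) by (force simp: box_def abs_le_iff)
  qed
  \<comment> \<open>The modulus must exceed all coordinates of \<open>X\<close> and
    \<open>E\<close>, and \<open>k\<close> times each vector of \<open>W\<close> must be
    small.\<close>
  obtain k where k: "k \<ge> Suc r" "\<And>w. w \<in> W \<Longrightarrow> of_nat k * w \<in> V"
    using recur[OF V(1) W] by blast
  define n where "n = int k"
  have n: "n > 0" "n > int r" using k(1) by (auto simp: n_def)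
  have nW: "(\<lambda>i. n * w i) \<in> V" if "w \<in> W" for w
  proof -
    have "(\<lambda>i. n * w i) = of_nat k * w" by (auto simp: n_def)
    then show ?thesis using k(2)[OF that] by simp
  qed
  \<comment> \<open>\<open>A\<close> is thickened by \<open>V\<close> because reducing a point
    modulo \<open>n\<close> moves it by an element of \<open>V\<close>.\<close>
  define B where "B = {b \<in> box T n. \<exists>a\<in>A. \<exists>v\<in>V. b = a + v}"
  define red where "red x = (\<lambda>i. if i \<in> T then x i mod n else 0)" for x :: "'b \<Rightarrow> int"
  have B: "B \<subseteq> box T n" by (auto simp: B_def)
  have box_off: "x i = 0" if "x \<in> box T n" "i \<notin> T" for x i
    using that unfolding box_def by (auto dest: spec[of _ i])
  have box_on: "0 \<le> x i \<and> x i < n" if "x \<in> box T n" "i \<in> T" for x i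
    using that unfolding box_def by (auto dest: spec[of _ i])
  have redB: "red (b - e) \<in> B" if b: "b \<in> box T n" and e: "e \<in> E" and a: "b - e \<in> A" for b e
  proof -
    define w where "w = (\<lambda>i. if i \<in> T then - ((b - e) i div n) else 0)"
    have "w \<in> W"
    proof (rule WI)
      fix i assume i: "i \<in> T"
      have "- (3 * n) \<le> (b - e) i" "(b - e) i < (3 + 1) * n"
        using box_on[OF b i] r[of e i] e n by auto
      then have "\<bar>(b - e) i div n\<bar> \<le> 3" by (rule abs_div_le[OF n(1)])
      then show "\<bar>w i\<bar> \<le> 3" using i by (simp add: w_def)
    qed (simp add: w_def)
    moreover have "red (b - e) = (b - e) + (\<lambda>i. n * w i)"
    proof
      fix i
      show "red (b - e) i = ((b - e) + (\<lambda>i. n * w i)) i"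
      proof (cases "i \<in> T")
        case True
        then show ?thesis by (simp add: red_def w_def minus_mult_div_eq_mod[symmetric])
      next
        case False
        then show ?thesis using box_off[OF b] off_T[of e] e by (simp add: red_def w_def)
      qed
    qed
    moreover have "red (b - e) \<in> box T n" using n(1) by (auto simp: red_def box_def)
    ultimately show ?thesis unfolding B_def using a nW by blast
  qed
  \<comment> \<open>A box element \<open>b\<close> is recovered from the centre \<open>e b\<close>
    and the residue of \<open>b - e b\<close>, which lies in \<open>B\<close>. Hence
    \<open>B\<close> has density at least \<open>1 / card E\<close> in the box.\<close>
  have card_box: "card (box T n) \<le> card E * card B"
  proof -
    have "\<forall>b\<in>box T n. \<exists>e\<in>E. b - e \<in> A"
      using E(3) in_HI[OF T] box_off by blast
    then obtain e where e: "\<And>b. b \<in> box T n \<Longrightarrow> e b \<in> E \<and> b - e b \<in> A" by metis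
    have "card (box T n) \<le> card (E \<times> B)"
    proof (rule card_inj_on_le)
      show "inj_on (\<lambda>b. (e b, red (b - e b))) (box T n)"
      proof (rule inj_onI)
        fix b b' assume *: "b \<in> box T n" "b' \<in> box T n" "(e b, red (b - e b)) = (e b', red (b' - e b'))"
        show "b = b'"
        proof (rule box_eqI[OF *(1,2)])
          fix i assume i: "i \<in> T"
          have "(b - e b) i mod n = (b' - e b) i mod n"
          proof -
            have e_eq: "e b = e b'" "red (b - e b) = red (b' - e b')" using *(3) by auto
            show ?thesis using fun_cong[OF e_eq(2), of i] e_eq(1) i by (simp add: red_def)
          qed
          then show "n dvd (b - b') i" by (simp add: mod_eq_dvd_iff)
        qed
      qed
      show "(\<lambda>b. (e b, red (b - e b))) ` box T n \<subseteq> E \<times> B" using e redB by auto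
      show "finite (E \<times> B)" using E(1) B finite_box[OF T(1)] finite_subset by blast
    qed
    then show ?thesis by (simp add: card_cartesian_product)
  qed
  have E0: "card E > 0" using E(1) bspec[OF E(3) zero_mem] by (auto simp: card_gt_0_iff)
  \<comment> \<open>A congruence to 0 modulo \<open>n\<close> becomes an equality up to
    \<open>n\<close> times a vector of \<open>W\<close>. With the four errors hidden in
    \<open>B\<close> this makes five elements of \<open>V\<close>, the number that \<open>V\<close>
    was chosen to absorb into \<open>U\<close>.\<close>
  have X0: "\<forall>x\<in>X. \<forall>a\<in>B. \<forall>b\<in>B. \<forall>c\<in>B. \<forall>d\<in>B. \<exists>i\<in>T. \<not> n dvd (x + a - b + c - d) i"
  proof (intro ballI, rule ccontr)
    fix x a b c d assume x: "x \<in> X" and B4: "a \<in> B" "b \<in> B" "c \<in> B" "d \<in> B"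
      and no: "\<not> (\<exists>i\<in>T. \<not> n dvd (x + a - b + c - d) i)"
    define w where "w = (\<lambda>i. if i \<in> T then (x + a - b + c - d) i div n else 0)"
    have bx: "a \<in> box T n" "b \<in> box T n" "c \<in> box T n" "d \<in> box T n" using B4 B by auto
    have "w \<in> W"
    proof (rule WI)
      fix i assume i: "i \<in> T"
      have "- (3 * n) \<le> (x + a - b + c - d) i" "(x + a - b + c - d) i < (3 + 1) * n"
        using box_on[OF bx(1) i] box_on[OF bx(2) i] box_on[OF bx(3) i] box_on[OF bx(4) i] r[of x i] x n
        by auto
      then have "\<bar>(x + a - b + c - d) i div n\<bar> \<le> 3" by (rule abs_div_le[OF n(1)])
      then show "\<bar>w i\<bar> \<le> 3" using i by (simp add: w_def)
    qed (simp add: w_def)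
    then have nw: "(\<lambda>i. n * w i) \<in> V" by (rule nW)
    have eq: "x + a - b + c - d = (\<lambda>i. n * w i)"
    proof
      fix i
      show "(x + a - b + c - d) i = n * w i"
      proof (cases "i \<in> T")
        case True
        then show ?thesis using no by (simp add: w_def dvd_mult_div_cancel)
      next
        case False
        then show ?thesis using box_off[OF bx(1)] box_off[OF bx(2)] box_off[OF bx(3)] box_off[OF bx(4)]
          off_T[of x] x by (simp add: w_def)
      qed
    qed
    obtain a' va where a: "a' \<in> A" "va \<in> V" "a = a' + va" using B4(1) by (auto simp: B_def)
    obtain b' vb where b: "b' \<in> A" "vb \<in> V" "b = b' + vb" using B4(2) by (auto simp: B_def)
    obtain c' vc where c: "c' \<in> A" "vc \<in> V" "c = c' + vc" using B4(3) by (auto simp: B_def)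
    obtain d' vd where d: "d' \<in> A" "vd \<in> V" "d = d' + vd" using B4(4) by (auto simp: B_def)
    have "x = (\<lambda>i. n * w i) - a + b - c + d" unfolding eq[symmetric] by (simp add: algebra_simps)
    also have "\<dots> = b' - a' + d' - c' + (vb - va + vd - vc + (\<lambda>i. n * w i))"
      unfolding a(3) b(3) c(3) d(3) by (simp add: algebra_simps)
    finally have "x = b' - a' + d' - c' + (vb - va + vd - vc + (\<lambda>i. n * w i))" .
    moreover have "vb - va + vd - vc + (\<lambda>i. n * w i) \<in> U"
      by (rule V(2)[OF b(2) a(2) d(2) c(2) nw])
    ultimately have "x \<in> shifted_combs A U"
      using shifted_combsI[OF b(1) a(1) d(1) c(1)] by simp
    then show False using X(3) x by blast
  qed
  show ?thesis by (rule large_spectrum_enumerated[OF T(1) n(1) B E0 card_box X0])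
qed

lemma compact_PiE_cball: "compact {\<phi> :: 'c \<Rightarrow> complex. \<forall>p. cmod (\<phi> p) \<le> 1}"
proof -
  have "compactin (product_topology (\<lambda>_. euclidean) UNIV) (PiE UNIV (\<lambda>_ :: 'c. cball (0 :: complex) 1))"
    by (auto simp: compactin_PiE)
  then have "compact (PiE UNIV (\<lambda>_ :: 'c. cball (0 :: complex) 1))"
    by (simp add: euclidean_product_topology)
  moreover have "PiE UNIV (\<lambda>_ :: 'c. cball (0 :: complex) 1) = {\<phi>. \<forall>p. cmod (\<phi> p) \<le> 1}"
    by (auto simp: PiE_iff)
  ultimately show ?thesis by simp
qed

text \<open>The number of characters in \<open>bohr_finite\<close> and all its constants are
  independent of the finite set \<open>X\<close>. Each requirement is a closed condition on a point
  of a compact product of discs, so the finite intersection property yields one solution for the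
  whole complement.\<close>

lemma bohr:
  assumes U: "U \<in> N" and E: "finite E" "E \<subseteq> H" "\<forall>x\<in>H. \<exists>e\<in>E. x - e \<in> A" and A: "A \<subseteq> H"
  shows "\<exists>(\<psi> :: nat \<Rightarrow> ('b \<Rightarrow> int) \<Rightarrow> complex) w.
    (\<forall>j. unit_char (\<psi> j)) \<and> (\<forall>x. \<psi> 0 x = 1) \<and>
    (\<forall>j. 0 \<le> w j) \<and> (\<Sum>j\<le>4 * card E ^ 4. w j) \<le> 1 \<and> w 0 \<ge> 1 / real (card E) ^ 4 \<and>
    (\<forall>x\<in>H - shifted_combs A U.
      Re (\<Sum>j\<le>4 * card E ^ 4. of_real (w j) * \<psi> j x) \<le> 1 / (4 * real (card E) ^ 4))"
proof -
  define R where "R = 4 * card E ^ 4"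
  \<comment> \<open>The coordinate \<open>(j, Some x)\<close> stands for \<open>\<psi> j x\<close>
    and \<open>(j, None)\<close> for the weight \<open>w j\<close>, so that characters and weights
    form a single point.\<close>
  define K where "K = {\<phi> :: nat \<times> ('b \<Rightarrow> int) option \<Rightarrow> complex. \<forall>p. cmod (\<phi> p) \<le> 1}"
  define C where "C = {\<phi> :: nat \<times> ('b \<Rightarrow> int) option \<Rightarrow> complex.
    (\<forall>j x y. \<phi> (j, Some (x + y)) = \<phi> (j, Some x) * \<phi> (j, Some y)) \<and>
    (\<forall>j x. cmod (\<phi> (j, Some x)) = 1) \<and> (\<forall>x. \<phi> (0, Some x) = 1) \<and>
    (\<forall>j. Im (\<phi> (j, None)) = 0) \<and> (\<forall>j. 0 \<le> Re (\<phi> (j, None))) \<and>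
    Re (\<Sum>j\<le>R. \<phi> (j, None)) \<le> 1 \<and> Re (\<phi> (0, None)) \<ge> 1 / real (card E) ^ 4}"
  define F where "F x = {\<phi> :: nat \<times> ('b \<Rightarrow> int) option \<Rightarrow> complex.
    Re (\<Sum>j\<le>R. \<phi> (j, None) * \<phi> (j, Some x)) \<le> 1 / (4 * real (card E) ^ 4)}" for x
  note cont = continuous_on_product_coordinates
  have closedC: "closed C" unfolding C_def
    by (intro closed_Collect_conj closed_Collect_all closed_Collect_eq closed_Collect_le
        continuous_intros cont)
  have closedF: "closed (F x)" for x unfolding F_def
    by (intro closed_Collect_le continuous_intros cont)
  have "K \<inter> C \<inter> (\<Inter>x\<in>H - shifted_combs A U. F x) \<noteq> {}"
  proof (rule compact_imp_fip_image)
    show "compact (K \<inter> C)"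
      unfolding K_def by (intro compact_Int_closed compact_PiE_cball closedC)
    show "closed (F x)" for x by (rule closedF)
    fix X assume X: "finite X" "X \<subseteq> H - shifted_combs A U"
    have X': "X \<subseteq> H" "X \<inter> shifted_combs A U = {}" using X(2) by blast+
    obtain \<psi> :: "nat \<Rightarrow> ('b \<Rightarrow> int) \<Rightarrow> complex" and w where
      "(\<forall>j x y. \<psi> j (x + y) = \<psi> j x * \<psi> j y) \<and> (\<forall>j x. norm (\<psi> j x) = 1) \<and> (\<forall>x. \<psi> 0 x = 1) \<and>
      (\<forall>j. 0 \<le> w j) \<and> (\<Sum>j\<le>4 * card E ^ 4. w j) \<le> 1 \<and> w 0 \<ge> 1 / real (card E) ^ 4 \<and>
      (\<forall>x\<in>X. Re (\<Sum>j\<le>4 * card E ^ 4. of_real (w j) * \<psi> j x) \<le> 1 / (4 * real (card E) ^ 4))"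
      using bohr_finite[OF U E A X(1) X'] by (elim exE)
    then have \<psi>: "\<And>j x y. \<psi> j (x + y) = \<psi> j x * \<psi> j y" "\<And>j x. norm (\<psi> j x) = 1" "\<And>x. \<psi> 0 x = 1"
      "\<And>j. 0 \<le> w j" "(\<Sum>j\<le>R. w j) \<le> 1" "w 0 \<ge> 1 / real (card E) ^ 4"
      "\<And>x. x \<in> X \<Longrightarrow> Re (\<Sum>j\<le>R. of_real (w j) * \<psi> j x) \<le> 1 / (4 * real (card E) ^ 4)"
      unfolding R_def by simp_all
    \<comment> \<open>Only weights with index at most \<open>R\<close> are known to be at most 1.
      The others are cut to 0 to keep the point in the product of discs.\<close>
    define w' where "w' j = (if j \<le> R then w j else 0)" for j
    define \<phi> where "\<phi> = (\<lambda>(j, z). case z of None \<Rightarrow> complex_of_real (w' j) | Some x \<Rightarrow> \<psi> j x)"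
    have w': "0 \<le> w' j" "w' j \<le> 1" for j
      using \<psi>(4,5) member_le_sum[of j "{..R}" w] by (force simp: w'_def)+
    have sums: "(\<Sum>j\<le>R. f (w' j) j) = (\<Sum>j\<le>R. f (w j) j)" for f :: "real \<Rightarrow> nat \<Rightarrow> complex"
      by (rule sum.cong) (auto simp: w'_def)
    have "\<phi> \<in> K"
      unfolding K_def \<phi>_def using w' \<psi>(2) by (auto split: option.split)
    moreover have "\<phi> \<in> C"
      unfolding C_def \<phi>_def using w' \<psi> sums[of "\<lambda>a _. of_real a"]
      by (auto simp: w'_def simp flip: of_real_sum)
    moreover have "\<phi> \<in> F x" if "x \<in> X" for x
    proof -
      have "(\<Sum>j\<le>R. \<phi> (j, None) * \<phi> (j, Some x)) = (\<Sum>j\<le>R. of_real (w j) * \<psi> j x)"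
        using sums[of "\<lambda>a j. of_real a * \<psi> j x"] by (simp add: \<phi>_def)
      then show ?thesis unfolding F_def mem_Collect_eq using \<psi>(7)[OF that] by (simp only:)
    qed
    ultimately show "K \<inter> C \<inter> (\<Inter>x\<in>X. F x) \<noteq> {}" by blast
  qed
  then obtain \<phi> where \<phi>: "\<phi> \<in> C" "\<And>x. x \<in> H - shifted_combs A U \<Longrightarrow> \<phi> \<in> F x" by blast
  define \<psi> where "\<psi> j x = \<phi> (j, Some x)" for j x
  define w where "w j = Re (\<phi> (j, None))" for j
  have \<phi>w: "\<phi> (j, None) = complex_of_real (w j)" for j
    using \<phi>(1) unfolding C_def w_def by (simp add: complex_eq_iff)
  have "\<forall>j. unit_char (\<psi> j)" "\<forall>x. \<psi> 0 x = 1" "\<forall>j. 0 \<le> w j" "w 0 \<ge> 1 / real (card E) ^ 4"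
    using \<phi>(1) unfolding C_def \<psi>_def w_def unit_char_def by simp_all
  moreover have "(\<Sum>j\<le>R. w j) \<le> 1"
    using \<phi>(1) unfolding C_def w_def by simp
  moreover have "Re (\<Sum>j\<le>R. of_real (w j) * \<psi> j x) \<le> 1 / (4 * real (card E) ^ 4)"
    if "x \<in> H - shifted_combs A U" for x
  proof -
    have "(\<Sum>j\<le>R. of_real (w j) * \<psi> j x) = (\<Sum>j\<le>R. \<phi> (j, None) * \<phi> (j, Some x))"
      by (simp only: \<phi>w \<psi>_def)
    then show ?thesis using \<phi>(2)[OF that] unfolding F_def mem_Collect_eq by (simp only:)
  qed
  ultimately show ?thesis unfolding R_def by blast
qed

text \<open>The characters from \<open>bohr\<close> may be discontinuous. If \<open>y\<close> is
  outside the target set, then all \<open>y + f g\<close> with \<open>f g\<close> in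
  \<open>U2\<close> are outside the set for \<open>U1\<close>, so the weighted real part averages to
  at most \<open>\<alpha> / 4\<close>. On the other hand, a continuous character is within
  \<open>1/8 + 1/8\<close> of 1 there and has real part at least 3/4, while the discontinuous ones
  average out to at least \<open>- \<alpha> / 4\<close> in total. Since the trivial character has
  weight at least \<open>\<alpha>\<close>, the average is at least
  \<open>\<alpha> / 2\<close>.\<close>

lemma folner_prodanov:
  assumes U: "U \<in> N" and E: "finite E" "E \<subseteq> H" "\<forall>x\<in>H. \<exists>e\<in>E. x - e \<in> A" and A: "A \<subseteq> H"
  shows "\<exists>\<Theta>. finite \<Theta> \<and> (\<forall>\<theta>\<in>\<Theta>. continuous_char \<theta>) \<and>
    (\<forall>y\<in>H. (\<forall>\<theta>\<in>\<Theta>. cmod (\<theta> y - 1) \<le> 1 / 8) \<longrightarrow> y \<in> shifted_combs A U)"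
proof -
  obtain U1 where U1: "U1 \<in> N" "U1 \<subseteq> U" "\<And>x y. x \<in> U1 \<Longrightarrow> y \<in> U1 \<Longrightarrow> x - y \<in> U"
    using half_diff[OF U] by metis
  define R where "R = 4 * card E ^ 4"
  define \<alpha> where "\<alpha> = 1 / real (card E) ^ 4"
  have "card E > 0" using E(1) bspec[OF E(3) zero_mem] by (auto simp: card_gt_0_iff)
  then have \<alpha>: "\<alpha> > 0" by (simp add: \<alpha>_def)
  obtain \<psi> :: "nat \<Rightarrow> ('b \<Rightarrow> int) \<Rightarrow> complex" and w where
    "(\<forall>j. unit_char (\<psi> j)) \<and> (\<forall>x. \<psi> 0 x = 1) \<and>
    (\<forall>j. 0 \<le> w j) \<and> (\<Sum>j\<le>4 * card E ^ 4. w j) \<le> 1 \<and> w 0 \<ge> 1 / real (card E) ^ 4 \<and>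
    (\<forall>x\<in>H - shifted_combs A U1.
      Re (\<Sum>j\<le>4 * card E ^ 4. of_real (w j) * \<psi> j x) \<le> 1 / (4 * real (card E) ^ 4))"
    using bohr[OF U1(1) E A] by (elim exE)
  then have \<psi>: "\<And>j. unit_char (\<psi> j)" "\<And>x. \<psi> 0 x = 1" "\<And>j. 0 \<le> w j" "(\<Sum>j\<le>R. w j) \<le> 1" "w 0 \<ge> \<alpha>"
    "\<And>x. x \<in> H \<Longrightarrow> x \<notin> shifted_combs A U1 \<Longrightarrow> Re (\<Sum>j\<le>R. of_real (w j) * \<psi> j x) \<le> \<alpha> / 4"
    unfolding R_def \<alpha>_def by (simp_all add: mult.commute[of _ 4])
  define P where "P = {j. j \<le> R \<and> continuous_char (\<psi> j)}"
  have finP: "finite P" by (simp add: P_def)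
  have "\<forall>j. \<exists>V. j \<in> P \<longrightarrow> V \<in> N \<and> (\<forall>v\<in>V. cmod (\<psi> j v - 1) < 1 / 8)"
    using continuous_charD[of "\<psi> _" "1 / 8"] unfolding P_def by auto
  then obtain G where G: "\<And>j. j \<in> P \<Longrightarrow> G j \<in> N \<and> (\<forall>v\<in>G j. cmod (\<psi> j v - 1) < 1 / 8)" by metis
  obtain V where V: "V \<in> N" "\<forall>j\<in>P. V \<subseteq> G j" using inter_finite[OF finP, of G] G by blast
  obtain U2 where U2: "U2 \<in> N" "U2 \<subseteq> U1 \<inter> V" using inter[OF U1(1) V(1)] by blast
  obtain I :: "(nat \<Rightarrow> nat) set" and f where I: "finite I" "I \<noteq> {}" "\<And>g. g \<in> I \<Longrightarrow> f g \<in> U2"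
    "\<And>j. j < Suc R \<Longrightarrow> \<not> continuous_char (\<psi> j) \<Longrightarrow> cmod (\<Sum>g\<in>I. \<psi> j (f g)) \<le> \<alpha> / 4 * real (card I)"
    using average_discontinuous[OF U2(1), of "\<alpha> / 4" "Suc R" \<psi>] \<alpha> \<psi>(1) by auto
  have cI: "real (card I) > 0" using I(1,2) by (simp add: card_gt_0_iff)
  have "y \<in> shifted_combs A U" if y: "y \<in> H" "\<forall>j\<in>P. cmod (\<psi> j y - 1) \<le> 1 / 8" for y
  proof (rule ccontr)
    assume not: "y \<notin> shifted_combs A U"
    have far: "y + f g \<notin> shifted_combs A U1" if g: "g \<in> I" for g
    proof
      assume "y + f g \<in> shifted_combs A U1"
      then obtain a b c d u where *: "a \<in> A" "b \<in> A" "c \<in> A" "d \<in> A" "u \<in> U1" "y + f g = a - b + c - d + u"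
        unfolding shifted_combs_def by blast
      have "y = a - b + c - d + (u - f g)" using *(6) by (simp add: algebra_simps)
      moreover have "u - f g \<in> U" using U1(3)[OF *(5)] I(3)[OF g] U2(2) by blast
      ultimately show False using not shifted_combsI[OF *(1-4)] by simp
    qed
    have fH: "y + f g \<in> H" if "g \<in> I" for g
      using add_mem[OF y(1)] I(3)[OF that] subset[OF U2(1)] by blast
    define s where "s j = Re (\<psi> j y * (\<Sum>g\<in>I. \<psi> j (f g)))" for j
    have "(\<Sum>j\<le>R. w j * s j) = Re (\<Sum>j\<le>R. of_real (w j) * (\<psi> j y * (\<Sum>g\<in>I. \<psi> j (f g))))"
      by (simp add: s_def)
    also have "\<dots> = Re (\<Sum>j\<le>R. \<Sum>g\<in>I. of_real (w j) * \<psi> j (y + f g))"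
      by (simp only: unit_char_add[OF \<psi>(1)] sum_distrib_left)
    also have "\<dots> = Re (\<Sum>g\<in>I. \<Sum>j\<le>R. of_real (w j) * \<psi> j (y + f g))"
      by (subst sum.swap) (rule refl)
    also have "\<dots> = (\<Sum>g\<in>I. Re (\<Sum>j\<le>R. of_real (w j) * \<psi> j (y + f g)))" by simp
    also have "\<dots> \<le> (\<Sum>g\<in>I. \<alpha> / 4)"
      by (intro sum_mono \<psi>(6)) (use fH far in auto)
    finally have upper: "(\<Sum>j\<le>R. w j * s j) \<le> real (card I) * (\<alpha> / 4)" by simp
    have s_cont: "s j \<ge> 3 / 4 * real (card I)" if j: "j \<in> P" for j
    proof -
      have "(\<Sum>g\<in>I. 3 / 4) \<le> (\<Sum>g\<in>I. Re (\<psi> j (y + f g)))"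
      proof (rule sum_mono)
        fix g assume g: "g \<in> I"
        have "cmod (\<psi> j (f g) - 1) \<le> 1 / 8" using G[OF j] V(2) j U2(2) I(3)[OF g] by (meson le_infE less_imp_le subset_iff)
        then have "cmod (\<psi> j (y + f g) - 1) \<le> 1 / 4"
          using unit_char_dist_add[OF \<psi>(1), of j y "f g"] y(2) j by force
        from Re_ge_of_dist_1[OF this] show "3 / 4 \<le> Re (\<psi> j (y + f g))" by simp
      qed
      also have "\<dots> = s j" by (simp add: s_def unit_char_add[OF \<psi>(1)] sum_distrib_left)
      finally show ?thesis by simp
    qed
    have s_disc: "s j \<ge> - (\<alpha> / 4 * real (card I))" if j: "j \<le> R" "j \<notin> P" for j
    proof -
      have "\<bar>s j\<bar> \<le> cmod (\<psi> j y * (\<Sum>g\<in>I. \<psi> j (f g)))" unfolding s_def by (rule abs_Re_le_cmod)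
      also have "\<dots> \<le> \<alpha> / 4 * real (card I)"
        using I(4)[of j] j by (simp add: norm_mult unit_char_norm[OF \<psi>(1)] P_def)
      finally show ?thesis by linarith
    qed
    have uc0: "unit_char (\<psi> 0)" by (rule \<psi>(1))
    \<comment> \<open>The trivial character is continuous, so the positive main term is always
      present.\<close>
    have "0 \<in> P" unfolding P_def continuous_char_def using uc0 \<psi>(2) U by auto
    have "\<alpha> * (3 / 4 * real (card I)) - \<alpha> / 4 * real (card I) * 1
        \<le> w 0 * s 0 + (\<Sum>j\<in>{..R} - {0}. - (\<alpha> / 4 * real (card I)) * w j)"
    proof -
      have "\<alpha> * (3 / 4 * real (card I)) \<le> w 0 * s 0"
        using \<psi>(5) s_cont[OF \<open>0 \<in> P\<close>] \<alpha> cI by (intro mult_mono) auto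
      moreover have "(\<Sum>j\<in>{..R} - {0}. w j) \<le> 1"
        using \<psi>(3,4) sum_mono2[of "{..R}" "{..R} - {0}" w] by force
      then have "\<alpha> / 4 * real (card I) * (\<Sum>j\<in>{..R} - {0}. w j) \<le> \<alpha> / 4 * real (card I) * 1"
        using \<alpha> cI by (intro mult_left_mono) auto
      moreover have "(\<Sum>j\<in>{..R} - {0}. - (\<alpha> / 4 * real (card I)) * w j)
          = - (\<alpha> / 4 * real (card I) * (\<Sum>j\<in>{..R} - {0}. w j))"
        by (simp only: sum_distrib_left sum_negf mult_minus_left)
      ultimately show ?thesis by linarith
    qed
    also have "\<dots> \<le> w 0 * s 0 + (\<Sum>j\<in>{..R} - {0}. w j * s j)"
    proof (intro add_left_mono sum_mono)
      fix j assume j: "j \<in> {..R} - {0}"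
      have "- (\<alpha> / 4 * real (card I)) \<le> s j"
      proof (cases "j \<in> P")
        case True
        have "0 \<le> s j" using s_cont[OF True] cI by linarith
        moreover have "0 \<le> \<alpha> / 4 * real (card I)" using \<alpha> by simp
        ultimately show ?thesis by linarith
      next
        case False
        then show ?thesis using s_disc j by auto
      qed
      then show "- (\<alpha> / 4 * real (card I)) * w j \<le> w j * s j"
        using mult_left_mono[OF _ \<psi>(3)] by (metis mult.commute)
    qed
    also have "\<dots> = (\<Sum>j\<le>R. w j * s j)" by (subst sum.remove[of "{..R}" 0]) auto
    finally have "\<alpha> * (3 / 4 * real (card I)) - \<alpha> / 4 * real (card I) * 1 \<le> real (card I) * (\<alpha> / 4)"
      using upper by linarith
    then have "\<alpha> * real (card I) \<le> 0" by (simp add: algebra_simps)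
    then show False using mult_pos_pos[OF \<alpha> cI] by linarith
  qed
  then show ?thesis
    by (intro exI[of _ "\<psi> ` P"]) (auto simp: finP, auto simp: P_def)
qed

end

section \<open>Precompactness\<close>

lemma cmod_cis_add: "cmod (cis (x + y) - 1) \<le> cmod (cis x - 1) + cmod (cis y - 1)"
proof -
  have "cis (x + y) - 1 = cis x * (cis y - 1) + (cis x - 1)" by (simp add: cis_mult algebra_simps)
  then have "cmod (cis (x + y) - 1) \<le> cmod (cis x * (cis y - 1)) + cmod (cis x - 1)"
    by (metis norm_triangle_ineq)
  then show ?thesis by (simp add: norm_mult)
qed

lemma cmod_cis_minus: "cmod (cis (- x) - 1) = cmod (cis x - 1)"
proof -
  have "cis (- x) - 1 = cnj (cis x - 1)" by (simp add: cis_cnj)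
  then show ?thesis by (simp only: complex_mod_cnj)
qed

lemma cmod_cis_diff: "cmod (cis (x - y) - 1) = cmod (cis x - cis y)"
proof -
  have "cis x - cis y = cis y * (cis (x - y) - 1)" by (simp add: cis_mult algebra_simps)
  then show ?thesis by (simp add: norm_mult)
qed

text \<open>For each sequence in turn, pigeonhole on the compact unit circle thins out an infinite
  index set. The resulting pair makes a difference of two far-out members satisfy any given phase
  conditions.\<close>

lemma almost_constant_phases:
  fixes \<Phi> :: "(nat \<Rightarrow> real) set"
  assumes "finite \<Phi>" "\<epsilon> > 0"
  shows "\<exists>k l. m \<le> k \<and> k < l \<and> (\<forall>s\<in>\<Phi>. cmod (cis (s k - s l) - 1) < \<epsilon>)"
proof -
  have "\<exists>B. infinite B \<and> B \<subseteq> {m..} \<and> (\<forall>s\<in>\<Phi>. \<forall>k\<in>B. \<forall>l\<in>B. cmod (cis (s k - s l) - 1) < \<epsilon>)"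
    using assms(1)
  proof (induction \<Phi> rule: finite_induct)
    case empty
    then show ?case by (intro exI[of _ "{m..}"]) (auto simp: infinite_Ici)
  next
    case (insert s \<Phi>)
    then obtain B where B: "infinite B" "B \<subseteq> {m..}"
      "\<forall>s\<in>\<Phi>. \<forall>k\<in>B. \<forall>l\<in>B. cmod (cis (s k - s l) - 1) < \<epsilon>" by blast
    obtain D where D: "finite D" "sphere (0 :: complex) 1 \<subseteq> (\<Union>x\<in>D. ball x (\<epsilon> / 2))"
    proof -
      have "\<exists>k. finite k \<and> sphere (0 :: complex) 1 \<subseteq> (\<Union>x\<in>k. ball x (\<epsilon> / 2))"
        by (rule compact_eq_totally_bounded[THEN iffD1, OF compact_sphere, THEN conjunct2, rule_format])
          (use assms(2) in \<open>simp add: half_gt_zero\<close>)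
      then show ?thesis using that by blast
    qed
    have "\<exists>d. d \<in> D \<and> cmod (cis (s k) - d) < \<epsilon> / 2" for k
    proof -
      have "cis (s k) \<in> sphere 0 1" by simp
      then obtain d where "d \<in> D" "cis (s k) \<in> ball d (\<epsilon> / 2)" using D(2) by blast
      then show ?thesis by (auto simp: dist_norm norm_minus_commute)
    qed
    then obtain d where d: "\<And>k. d k \<in> D" "\<And>k. cmod (cis (s k) - d k) < \<epsilon> / 2" by metis
    have "finite (d ` B)" using D(1) d(1) by (auto intro: finite_subset)
    then obtain k0 where k0: "k0 \<in> B" "infinite {k \<in> B. d k = d k0}"
      using pigeonhole_infinite[OF B(1)] by blast
    have "cmod (cis (s k - s l) - 1) < \<epsilon>" if kl: "d k = d k0" "d l = d k0" for k l
    proof -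
      have "cmod (cis (s k) - cis (s l)) \<le> cmod (cis (s k) - d k) + cmod (cis (s l) - d l)"
        using norm_triangle_ineq4[of "cis (s k) - d k" "cis (s l) - d l"] kl by simp
      then show ?thesis using d(2)[of k] d(2)[of l] by (simp add: cmod_cis_diff)
    qed
    then show ?case using B k0(2) by (intro exI[of _ "{k \<in> B. d k = d k0}"]) auto
  qed
  then obtain B where B: "infinite B" "B \<subseteq> {m..}"
    "\<forall>s\<in>\<Phi>. \<forall>k\<in>B. \<forall>l\<in>B. cmod (cis (s k - s l) - 1) < \<epsilon>" by blast
  obtain k where k: "k \<in> B" using B(1) by fastforce
  obtain l where l: "l \<in> B" "l > k" using B(1) unfolding infinite_nat_iff_unbounded by blast
  show ?thesis using B(2,3) k l by (intro exI[of _ k] exI[of _ l]) auto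
qed

text \<open>It turns a condition on a character value into one on the integer coefficients alone, so
  the second coarsening can be defined by real phase sequences without mentioning
  characters.\<close>

lemma unit_char_int_comb:
  fixes \<theta> :: "'a::comm_ring_1 \<Rightarrow> complex"
  assumes \<theta>: "unit_char \<theta>"
  shows "\<theta> (int_comb u b n) = cis (\<Sum>k<n. of_int (b k) * Arg (\<theta> (u k)))"
proof -
  have nat: "\<theta> (of_nat m * x) = cis (real m * Arg (\<theta> x))" for m x
  proof -
    have "\<theta> x \<noteq> 0" using unit_char_norm[OF \<theta>, of x] by auto
    from cis_Arg[OF this] have "\<theta> x = cis (Arg (\<theta> x))"
      by (simp add: sgn_eq unit_char_norm[OF \<theta>])
    then have "\<theta> x ^ m = cis (real m * Arg (\<theta> x))" by (metis Complex.DeMoivre)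
    then show ?thesis by (simp add: unit_char_of_nat_mult[OF \<theta>])
  qed
  have int: "\<theta> (of_int i * x) = cis (of_int i * Arg (\<theta> x))" for i x
  proof (cases "i \<ge> 0")
    case True
    then show ?thesis using nat[of "nat i" x] by (simp add: of_nat_nat)
  next
    case False
    then have "i = - int (nat (- i))" by simp
    then obtain m where "i = - int m" by blast
    then show ?thesis using unit_char_minus[OF \<theta>, of "of_nat m * x"] by (simp add: nat cis_cnj)
  qed
  show ?thesis
    by (induction n) (simp_all add: int_comb_def unit_char_zero[OF \<theta>] unit_char_add[OF \<theta>] int cis_mult)
qed

locale minimal_free_group_base = minimal_group_base H N
  for H :: "('b \<Rightarrow> int) set" and N +
  fixes S :: "'b set"
  assumes H_eq: "H = {x. finite {i. x i \<noteq> 0} \<and> {i. x i \<noteq> 0} \<subseteq> S}"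

sublocale minimal_free_group_base \<subseteq> free_group_base H N S
  by unfold_locales (use H_eq recurrence[OF almost_precompact] in auto)

section \<open>Reduction of precompactness to prime multipliers\<close>

context group_base
begin

text \<open>It says that the quotient of \<open>H\<close> by the closure of \<open>cH\<close> is
  precompact.\<close>

definition cofinite_index :: "nat \<Rightarrow> bool"
  where "cofinite_index c \<longleftrightarrow>
    (\<forall>U\<in>N. \<exists>E. finite E \<and> E \<subseteq> H \<and> (\<forall>x\<in>H. \<exists>e\<in>E. \<exists>y\<in>H. x - e - of_nat c * y \<in> U))"

lemma cofinite_index_mult:
  assumes "cofinite_index c" "cofinite_index d"
  shows "cofinite_index (c * d)"
  unfolding cofinite_index_def
proof
  fix U assume U: "U \<in> N"
  obtain V where V: "V \<in> N" "\<And>x y. x \<in> V \<Longrightarrow> y \<in> V \<Longrightarrow> x + y \<in> U"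
    using half_diff[OF U] by metis
  obtain W where W: "W \<in> N" "\<And>x i. x \<in> W \<Longrightarrow> \<bar>i\<bar> \<le> int c \<Longrightarrow> of_int i * x \<in> V"
    using fraction_mult[OF V(1), of c] by metis
  obtain E where E: "finite E" "E \<subseteq> H" "\<forall>x\<in>H. \<exists>e\<in>E. \<exists>y\<in>H. x - e - of_nat c * y \<in> V"
    using assms(1)[unfolded cofinite_index_def, rule_format, OF V(1)] by blast
  obtain F where F: "finite F" "F \<subseteq> H" "\<forall>x\<in>H. \<exists>e\<in>F. \<exists>y\<in>H. x - e - of_nat d * y \<in> W"
    using assms(2)[unfolded cofinite_index_def, rule_format, OF W(1)] by blast
  let ?G = "(\<lambda>(e, f). e + of_nat c * f) ` (E \<times> F)"
  have "\<exists>g\<in>?G. \<exists>y\<in>H. x - g - of_nat (c * d) * y \<in> U" if x: "x \<in> H" for x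
  proof -
    obtain e y where ey: "e \<in> E" "y \<in> H" "x - e - of_nat c * y \<in> V" using E(3) x by blast
    obtain f z where fz: "f \<in> F" "z \<in> H" "y - f - of_nat d * z \<in> W" using F(3) ey(2) by blast
    have "of_nat c * (y - f - of_nat d * z) \<in> V" using W(2)[OF fz(3), of "int c"] by simp
    then have "(x - e - of_nat c * y) + of_nat c * (y - f - of_nat d * z) \<in> U" by (rule V(2)[OF ey(3)])
    also have "(x - e - of_nat c * y) + of_nat c * (y - f - of_nat d * z)
        = x - (e + of_nat c * f) - of_nat (c * d) * z" by (simp add: algebra_simps)
    finally show ?thesis using ey(1) fz(1,2) by (intro bexI[of _ "e + of_nat c * f"] bexI[of _ z]) auto
  qed
  moreover have "finite ?G" using E(1) F(1) by auto
  moreover have "?G \<subseteq> H" using E(2) F(2) by (auto intro!: add_mem of_nat_mult_mem)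
  ultimately show "\<exists>E. finite E \<and> E \<subseteq> H \<and> (\<forall>x\<in>H. \<exists>e\<in>E. \<exists>y\<in>H. x - e - of_nat (c * d) * y \<in> U)"
    by (intro exI[of _ ?G] conjI ballI)
qed

lemma cofinite_index_pos:
  assumes "\<And>p. prime p \<Longrightarrow> cofinite_index p"
  shows "c > 0 \<Longrightarrow> cofinite_index c"
proof (induction c rule: less_induct)
  case (less c)
  show ?case
  proof (cases "c = 1")
    case True
    have "\<exists>e\<in>{0}. \<exists>y\<in>H. x - e - of_nat c * y \<in> U" if "U \<in> N" "x \<in> H" for U x
      using that zero[of U] True by (auto intro!: bexI[of _ x])
    then show ?thesis unfolding cofinite_index_def using zero_mem by (intro ballI exI[of _ "{0}"]) auto
  next
    case False
    then obtain p where p: "prime p" "p dvd c" using prime_factor_nat by blast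
    then obtain d where d: "c = p * d" by blast
    have "d > 0" "d < c" using less.prems d prime_gt_1_nat[OF p(1)] by auto
    then show ?thesis using cofinite_index_mult assms p(1) less.IH d by blast
  qed
qed

text \<open>Up to a small error, \<open>H\<close> is a finite union of translates of
  \<open>cH\<close>, and by almost precompactness \<open>cH\<close> consists, up to a small error,
  of finitely many points.\<close>

lemma precompactI:
  assumes ap: almost_precompact and c: "\<And>p. prime p \<Longrightarrow> cofinite_index p"
  shows precompact
  unfolding precompact_def
proof
  fix U assume U: "U \<in> N"
  obtain V where V: "V \<in> N" "\<And>x y. x \<in> V \<Longrightarrow> y \<in> V \<Longrightarrow> x + y \<in> U"
    using half_diff[OF U] by metis
  obtain c E where E: "c > 0" "finite E" "E \<subseteq> H" "\<forall>x\<in>H. \<exists>e\<in>E. of_nat c * (x - e) \<in> V"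
    using ap[unfolded almost_precompact_def, rule_format, OF V(1)] by blast
  obtain F where F: "finite F" "F \<subseteq> H" "\<forall>x\<in>H. \<exists>e\<in>F. \<exists>y\<in>H. x - e - of_nat c * y \<in> V"
    using cofinite_index_pos[OF c E(1), unfolded cofinite_index_def, rule_format, OF _ V(1)] by blast
  let ?G = "(\<lambda>(e, f). f + of_nat c * e) ` (E \<times> F)"
  have "\<exists>g\<in>?G. x - g \<in> U" if x: "x \<in> H" for x
  proof -
    obtain f y where fy: "f \<in> F" "y \<in> H" "x - f - of_nat c * y \<in> V" using F(3) x by blast
    obtain e where e: "e \<in> E" "of_nat c * (y - e) \<in> V" using E(4) fy(2) by blast
    have "(x - f - of_nat c * y) + of_nat c * (y - e) \<in> U" by (rule V(2)[OF fy(3) e(2)])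
    also have "(x - f - of_nat c * y) + of_nat c * (y - e) = x - (f + of_nat c * e)"
      by (simp add: algebra_simps)
    finally show ?thesis using e(1) fy(1) by (intro bexI[of _ "f + of_nat c * e"]) auto
  qed
  moreover have "finite ?G" using E(2) F(1) by auto
  moreover have "?G \<subseteq> H" using E(3) F(2) by (auto intro!: add_mem of_nat_mult_mem)
  ultimately show "\<exists>E. finite E \<and> E \<subseteq> H \<and> (\<forall>x\<in>H. \<exists>e\<in>E. x - e \<in> U)"
    by (intro exI[of _ ?G] conjI ballI)
qed

text \<open>Each \<open>x k\<close> is chosen outside finitely many translates of
  \<open>pH + V\<close>, one for every combination of its predecessors with coefficients in
  \<open>[0, p)\<close>. If a last coefficient were prime to \<open>p\<close>, multiplying by its
  inverse modulo \<open>p\<close> would make it 1 and contradict the choice; \<open>U\<close> is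
  such that multiples of its elements by integers up to \<open>p\<close> stay in
  \<open>V\<close>.\<close>

lemma independent_mod_prime:
  assumes p: "prime p" and "\<not> cofinite_index p"
  shows "\<exists>x. \<exists>U\<in>N. (\<forall>k. x k \<in> H) \<and>
    (\<forall>n a. \<forall>y\<in>H. int_comb x a n - of_nat p * y \<in> U \<longrightarrow> (\<forall>k<n. int p dvd a k))"
proof -
  obtain V where V: "V \<in> N"
    "\<And>E. finite E \<Longrightarrow> E \<subseteq> H \<Longrightarrow> \<exists>x\<in>H. \<forall>e\<in>E. \<forall>y\<in>H. x - e - of_nat p * y \<notin> V"
    using assms(2) unfolding cofinite_index_def by meson
  obtain U where U: "U \<in> N" "\<And>x i. x \<in> U \<Longrightarrow> \<bar>i\<bar> \<le> int p \<Longrightarrow> of_int i * x \<in> V"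
    using fraction_mult[OF V(1), of p] by metis
  have p0: "int p > 0" using prime_gt_0_nat[OF p] by simp
  \<comment> \<open>Dependent choice asks for a next value after every prefix, even one that leaves
    \<open>H\<close>; the premise on \<open>x j\<close> makes \<open>Q\<close> satisfiable
    there.\<close>
  define Q where "Q x k y \<longleftrightarrow> y \<in> H \<and> ((\<forall>j<k. x j \<in> H) \<longrightarrow>
    (\<forall>a. (\<forall>j. 0 \<le> a j \<and> a j < int p) \<longrightarrow> (\<forall>z\<in>H. y + int_comb x a k - of_nat p * z \<notin> V)))" for x k y
  have "\<exists>x. \<forall>k. Q x k (x k)"
  proof (rule dependent_wf_choice[where R = less_than])
    fix x y :: "nat \<Rightarrow> 'a" and k r
    assume xy: "\<And>z. (z, k) \<in> less_than \<Longrightarrow> x z = y z"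
    then have "int_comb x a k = int_comb y a k" for a by (simp add: int_comb_def)
    then show "Q x k r = Q y k r" using xy by (simp add: Q_def)
  next
    fix k and x :: "nat \<Rightarrow> 'a"
    show "\<exists>r. Q x k r"
    proof (cases "\<forall>j<k. x j \<in> H")
      case True
      define B where "B = (\<Pi>\<^sub>E j\<in>{..<k}. {0..<int p})"
      define E where "E = (\<lambda>a. - int_comb x a k) ` B"
      have "finite E" unfolding E_def B_def by (intro finite_imageI finite_PiE) auto
      moreover have "E \<subseteq> H"
        unfolding E_def int_comb_def using True by (auto intro!: minus_mem sum_mem of_int_mult_mem)
      ultimately have "\<exists>y\<in>H. \<forall>e\<in>E. \<forall>z\<in>H. y - e - of_nat p * z \<notin> V" by (rule V(2))
      then obtain y where y: "y \<in> H" "\<And>e z. e \<in> E \<Longrightarrow> z \<in> H \<Longrightarrow> y - e - of_nat p * z \<notin> V" by blast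
      have "- int_comb x a k \<in> E" if "\<forall>j. 0 \<le> a j \<and> a j < int p" for a
        unfolding E_def
      proof (rule image_eqI)
        show "- int_comb x a k = - int_comb x (restrict a {..<k}) k" by (simp add: int_comb_def)
        show "restrict a {..<k} \<in> B" unfolding B_def using that by auto
      qed
      then show ?thesis unfolding Q_def using y by (metis diff_minus_eq_add)
    next
      case False
      then show ?thesis unfolding Q_def using zero_mem by blast
    qed
  qed auto
  then obtain x where x: "\<And>k. Q x k (x k)" by blast
  have xH: "x k \<in> H" for k using x[of k] by (simp add: Q_def)
  have sep: "x k + int_comb x a k - of_nat p * z \<notin> V" if "\<forall>j. 0 \<le> a j \<and> a j < int p" "z \<in> H" for k a z
    using x[of k] xH that by (simp add: Q_def)
  have "\<forall>k<n. int p dvd a k" if "y \<in> H" "int_comb x a n - of_nat p * y \<in> U" for n a y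
    using that
  proof (induction n arbitrary: y)
    case (Suc n)
    have dvd: "int p dvd a n"
    proof (rule ccontr)
      assume "\<not> int p dvd a n"
      then have "coprime (a n) (int p)" using p
        by (metis coprime_commute prime_imp_coprime prime_nat_int_transfer)
      then obtain r0 where r0: "[a n * r0 = 1] (mod int p)" using cong_solve_coprime_int by blast
      define r where "r = r0 mod int p"
      have r: "0 \<le> r" "r < int p" using p0 by (auto simp: r_def)
      have "[a n * r = 1] (mod int p)"
        using r0 unfolding r_def by (simp add: cong_def mod_mult_right_eq)
      then obtain t where t: "a n * r = 1 + int p * t"
        by (metis cong_iff_lin cong_sym)
      define a' where "a' j = (r * a j) mod int p" for j
      define t' where "t' j = (r * a j) div int p" for j
      have a': "r * a j = a' j + int p * t' j" for j by (simp add: a'_def t'_def)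
      \<comment> \<open>The scaled coefficients are split into residues \<open>a'\<close> and
        multiples of \<open>p\<close>; all multiples of \<open>p\<close> are absorbed into the
        element of \<open>pH\<close>.\<close>
      have eq: "of_int r * (int_comb x a (Suc n) - of_nat p * y)
          = x n + int_comb x a' n - of_nat p * (of_int r * y - of_int t * x n - int_comb x t' n)"
      proof -
        have "of_int r * int_comb x a n = int_comb x (\<lambda>k. a' k + int p * t' k) n"
          by (simp add: a' flip: int_comb_mult)
        then have 1: "of_int r * int_comb x a n = int_comb x a' n + of_nat p * int_comb x t' n"
          by (simp add: int_comb_add int_comb_mult)
        have "of_int r * (of_int (a n) * x n) = of_int (a n * r) * x n" by (simp add: mult_ac)
        then have 2: "of_int r * (of_int (a n) * x n) = x n + of_nat p * (of_int t * x n)"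
          unfolding t by (simp add: algebra_simps)
        show ?thesis unfolding int_comb_Suc right_diff_distrib distrib_left 1 2 by (simp add: algebra_simps)
      qed
      have "of_int r * (int_comb x a (Suc n) - of_nat p * y) \<in> V"
        using U(2)[OF Suc.prems(2), of r] r by simp
      moreover have "of_int r * y - of_int t * x n - int_comb x t' n \<in> H"
        using Suc.prems(1) xH int_comb_mem[of x] by (intro diff_mem of_int_mult_mem) auto
      ultimately show False
        unfolding eq using sep[of a'] p0 by (simp add: a'_def)
    qed
    then obtain t where t: "a n = int p * t" by blast
    have "int_comb x a n - of_nat p * (y - of_int t * x n) \<in> U"
      using Suc.prems(2) by (simp add: int_comb_Suc t algebra_simps)
    then have "\<forall>k<n. int p dvd a k"
      using Suc.IH Suc.prems(1) xH diff_mem of_int_mult_mem by blast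
    then show ?case using dvd by (auto simp: less_Suc_eq)
  qed simp
  then show ?thesis using U(1) xH by blast
qed

end

section \<open>The second coarsening and precompactness\<close>

context minimal_free_group_base
begin

theorem precompact: precompact
proof (rule precompactI[OF almost_precompact], rule ccontr)
  fix p :: nat assume p: "prime p" and "\<not> cofinite_index p"
  from independent_mod_prime[OF this] obtain x U where U: "U \<in> N" and xH: "\<And>k. x k \<in> H"
    and indep: "\<And>n a y k. y \<in> H \<Longrightarrow> int_comb x a n - of_nat p * y \<in> U \<Longrightarrow> k < n \<Longrightarrow> int p dvd a k"
    by blast
  have p0: "p > 0" using prime_gt_0_nat[OF p] .
  text \<open>Multiplying by the \<open>p\<close>-free part \<open>m k\<close> of \<open>k!\<close> makes the tails of the sequence divisible by
    any given integer prime to \<open>p\<close> without destroying independence modulo \<open>p\<close>.\<close>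
  define m where "m k = (\<Prod>i | i \<in> {1..k} \<and> \<not> p dvd i. i)" for k :: nat
  have m_coprime: "\<not> p dvd m k" for k
    unfolding m_def using p by (subst prime_dvd_prod_iff) auto
  have m_dvd: "c dvd m k" if "\<not> p dvd c" "c > 0" "c \<le> k" for c k
    unfolding m_def by (rule dvd_prodI) (use that in auto)
  define z where "z k = of_nat (m k) * x k" for k
  have zH: "z k \<in> H" for k unfolding z_def by (intro of_nat_mult_mem xH)
  have z_comb: "int_comb z a n = int_comb x (\<lambda>k. a k * int (m k)) n" for a n
    by (simp add: int_comb_def z_def mult.assoc)
  have indep_z: "int p dvd a k" if "int_comb z a n \<in> U" "k < n" for a n k
  proof -
    have "int p dvd a k * int (m k)"
      using indep[OF zero_mem, of "\<lambda>k. a k * int (m k)" n k] that by (simp add: z_comb)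
    moreover have "\<not> int p dvd int (m k)" using m_coprime by simp
    ultimately show ?thesis using p by (metis prime_dvd_mult_iff prime_nat_int_transfer)
  qed
  \<comment> \<open>One factor \<open>p\<close> is removed at a time: once all coefficients are
    divisible by \<open>p\<close>, \<open>mult_embedding\<close> makes the combination with the
    divided coefficients small too.\<close>
  have indep_pow: "\<exists>V\<in>N. \<forall>a n. int_comb z a n \<in> V \<longrightarrow> (\<forall>k<n. int p ^ s dvd a k)" for s
  proof (induction s)
    case 0
    then show ?case using U by auto
  next
    case (Suc s)
    then obtain V where V: "V \<in> N" "\<forall>a n. int_comb z a n \<in> V \<longrightarrow> (\<forall>k<n. int p ^ s dvd a k)" by blast
    obtain V' where V': "V' \<in> N" "\<forall>x\<in>H. of_nat p * x \<in> V' \<longrightarrow> x \<in> V" using mult_embedding[OF V(1) p0] by blast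
    obtain W where W: "W \<in> N" "W \<subseteq> V' \<inter> U" using inter[OF V'(1) U] by blast
    have "int p ^ Suc s dvd a k" if a: "int_comb z a n \<in> W" and k: "k < n" for a n k
    proof -
      have dvd: "int p dvd a k" if "k < n" for k using indep_z[OF _ that] a W(2) by blast
      have "int_comb z a n = int_comb z (\<lambda>k. int p * (a k div int p)) n"
        by (rule int_comb_cong) (use dvd in simp)
      also have "\<dots> = of_nat p * int_comb z (\<lambda>k. a k div int p) n" by (simp add: int_comb_mult)
      finally have "int_comb z (\<lambda>k. a k div int p) n \<in> V"
        using a W(2) V'(2) int_comb_mem[of z] zH by auto
      then have "int p ^ s dvd a k div int p" using V(2) k by blast
      then have "int p * int p ^ s dvd int p * (a k div int p)" by (rule mult_dvd_mono[OF dvd_refl])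
      then show ?thesis using dvd[OF k] by simp
    qed
    then show ?case using W(1) by blast
  qed
  \<comment> \<open>Neighbourhoods of Bohr type in the tail combinations: the coefficients are
    unbounded, but finitely many phases must be close to multiples of \<open>2 * pi\<close>.
    Arbitrary real sequences are allowed since the relevant characters depend on the point
    \<open>g\<close> to be separated.\<close>
  define S where "S K \<Phi> \<epsilon> = {int_comb z a n | a n. (\<forall>k. k < K \<or> k \<ge> n \<longrightarrow> a k = 0) \<and>
    (\<forall>s\<in>\<Phi>. cmod (cis (\<Sum>k<n. of_int (a k) * s k) - 1) < \<epsilon>)}"
    for K and \<Phi> :: "(nat \<Rightarrow> real) set" and \<epsilon>
  have SI: "int_comb z a n \<in> S K \<Phi> \<epsilon>"
    if "\<forall>k. k < K \<or> k \<ge> n \<longrightarrow> a k = 0" "\<forall>s\<in>\<Phi>. cmod (cis (\<Sum>k<n. of_int (a k) * s k) - 1) < \<epsilon>"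
    for a n K \<Phi> \<epsilon>
    unfolding S_def using that by blast
  have SE: "\<exists>a n. v = int_comb z a n \<and> (\<forall>k. k < K \<or> k \<ge> n \<longrightarrow> a k = 0) \<and>
      (\<forall>s\<in>\<Phi>. cmod (cis (\<Sum>k<n. of_int (a k) * s k) - 1) < \<epsilon>)" if "v \<in> S K \<Phi> \<epsilon>" for v K \<Phi> \<epsilon>
    using that unfolding S_def by blast
  define L where "L = {S K \<Phi> \<epsilon> | K \<Phi> \<epsilon>. finite \<Phi> \<and> \<epsilon> > 0}"
  have LI: "S K \<Phi> \<epsilon> \<in> L" if "finite \<Phi>" "\<epsilon> > 0" for K \<Phi> \<epsilon> unfolding L_def using that by blast
  have ext: "(\<Sum>k<n'. of_int (a k) * s k) = (\<Sum>k<n. of_int (a k) * s k)"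
    if "n \<le> n'" "\<forall>k\<ge>n. a k = 0" for n n' :: nat and a :: "nat \<Rightarrow> int" and s :: "nat \<Rightarrow> real"
    by (rule sum.mono_neutral_right) (use that in auto)
  have base: "group_base H L"
  proof
    show "0 \<in> H" by (rule zero_mem)
    show "y - y' \<in> H" if "y \<in> H" "y' \<in> H" for y y' using that by (rule diff_mem)
    show "L \<noteq> {}" using LI[of "{}" 1] by auto
  next
    fix W assume "W \<in> L"
    then obtain K \<Phi> \<epsilon> where W: "W = S K \<Phi> \<epsilon>" "finite \<Phi>" "\<epsilon> > 0" unfolding L_def by blast
    show "W \<subseteq> H" using SE[of _ K \<Phi> \<epsilon>] int_comb_mem[of z] zH unfolding W(1) by blast
    have "int_comb z (\<lambda>_. 0) 0 \<in> S K \<Phi> \<epsilon>" by (rule SI) (use W(3) in auto)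
    then show "0 \<in> W" by (simp add: W(1) int_comb_zero)
    show "- v \<in> W" if v: "v \<in> W" for v
    proof -
      obtain a n where a: "v = int_comb z a n" "\<forall>k. k < K \<or> k \<ge> n \<longrightarrow> a k = 0"
        "\<forall>s\<in>\<Phi>. cmod (cis (\<Sum>k<n. of_int (a k) * s k) - 1) < \<epsilon>"
        using SE[of v K \<Phi> \<epsilon>] v W(1) by blast
      have "cmod (cis (\<Sum>k<n. of_int (- a k) * s k) - 1) < \<epsilon>" if "s \<in> \<Phi>" for s
        using a(3)[rule_format, OF that] cmod_cis_minus[of "\<Sum>k<n. of_int (a k) * s k"]
        by (simp add: sum_negf)
      then show ?thesis unfolding W(1) a(1) int_comb_uminus[symmetric]
        by (intro SI) (use a(2) in auto)
    qed
    have "v + w \<in> W" if vw: "v \<in> S K \<Phi> (\<epsilon> / 2)" "w \<in> S K \<Phi> (\<epsilon> / 2)" for v w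
    proof -
      obtain a n where a: "v = int_comb z a n" "\<forall>k. k < K \<or> k \<ge> n \<longrightarrow> a k = 0"
        "\<forall>s\<in>\<Phi>. cmod (cis (\<Sum>k<n. of_int (a k) * s k) - 1) < \<epsilon> / 2"
        using SE[OF vw(1)] by blast
      obtain b l where b: "w = int_comb z b l" "\<forall>k. k < K \<or> k \<ge> l \<longrightarrow> b k = 0"
        "\<forall>s\<in>\<Phi>. cmod (cis (\<Sum>k<l. of_int (b k) * s k) - 1) < \<epsilon> / 2"
        using SE[OF vw(2)] by blast
      have "v + w = int_comb z (\<lambda>k. a k + b k) (max n l)"
        unfolding a(1) b(1) int_comb_add
        using int_comb_extend[of n "max n l" a z] int_comb_extend[of l "max n l" b z] a(2) b(2) by simp
      moreover have "cmod (cis (\<Sum>k<max n l. of_int (a k + b k) * s k) - 1) < \<epsilon>" if s: "s \<in> \<Phi>" for s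
      proof -
        have "(\<Sum>k<max n l. of_int (a k + b k) * s k)
            = (\<Sum>k<n. of_int (a k) * s k) + (\<Sum>k<l. of_int (b k) * s k)"
          using ext[of n "max n l" a s] ext[of l "max n l" b s] a(2) b(2)
          by (simp add: distrib_right sum.distrib)
        then show ?thesis
          using cmod_cis_add[of "\<Sum>k<n. of_int (a k) * s k" "\<Sum>k<l. of_int (b k) * s k"]
            a(3)[rule_format, OF s] b(3)[rule_format, OF s] by simp
      qed
      ultimately show ?thesis unfolding W(1) using a(2) b(2) by (auto intro!: SI)
    qed
    moreover have "S K \<Phi> (\<epsilon> / 2) \<in> L" by (rule LI) (use W in auto)
    ultimately show "\<exists>W'\<in>L. \<forall>v\<in>W'. \<forall>w\<in>W'. v + w \<in> W" by blast
  next
    fix W W' assume "W \<in> L" "W' \<in> L"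
    then obtain K \<Phi> \<epsilon> K' \<Phi>' \<epsilon>' where W: "W = S K \<Phi> \<epsilon>" "finite \<Phi>" "\<epsilon> > 0"
      and W': "W' = S K' \<Phi>' \<epsilon>'" "finite \<Phi>'" "\<epsilon>' > 0" unfolding L_def by blast
    have "S (max K K') (\<Phi> \<union> \<Phi>') (min \<epsilon> \<epsilon>') \<subseteq> W \<inter> W'"
    proof
      fix v assume "v \<in> S (max K K') (\<Phi> \<union> \<Phi>') (min \<epsilon> \<epsilon>')"
      from SE[OF this] obtain a n where a: "v = int_comb z a n"
        "\<forall>k. k < max K K' \<or> k \<ge> n \<longrightarrow> a k = 0"
        "\<forall>s\<in>\<Phi> \<union> \<Phi>'. cmod (cis (\<Sum>k<n. of_int (a k) * s k) - 1) < min \<epsilon> \<epsilon>'" by blast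
      have "v \<in> S K \<Phi> \<epsilon>" unfolding a(1) by (rule SI) (use a(2,3) in auto)
      moreover have "v \<in> S K' \<Phi>' \<epsilon>'" unfolding a(1) by (rule SI) (use a(2,3) in auto)
      ultimately show "v \<in> W \<inter> W'" using W(1) W'(1) by blast
    qed
    moreover have "S (max K K') (\<Phi> \<union> \<Phi>') (min \<epsilon> \<epsilon>') \<in> L" by (rule LI) (use W W' in auto)
    ultimately show "\<exists>W''\<in>L. W'' \<subseteq> W \<inter> W'" by blast
  qed
  have "\<exists>W\<in>L. W \<subseteq> U"
  proof (rule coarser_sum[OF base _ U])
    fix g assume g: "g \<in> H" "g \<noteq> 0"
    show "\<exists>Z\<in>N. \<exists>W\<in>L. \<forall>u\<in>Z. \<forall>v\<in>W. g \<noteq> u + v"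
    proof (rule ccontr)
      assume "\<not> ?thesis"
      then have near: "\<exists>u\<in>Z. \<exists>v\<in>W. g = u + v" if "Z \<in> N" "W \<in> L" for Z W using that by blast
      obtain Y where Y: "Y \<in> N" "g \<notin> Y" using hausdorff[OF g] by blast
      obtain Y1 where Y1: "Y1 \<in> N" and six: "\<And>u a b c d e. u \<in> Y1 \<Longrightarrow> a \<in> Y1 \<Longrightarrow> b \<in> Y1 \<Longrightarrow>
          c \<in> Y1 \<Longrightarrow> d \<in> Y1 \<Longrightarrow> e \<in> Y1 \<Longrightarrow> u + (a - b + c - d + e) \<in> Y"
        by (rule signed_sum6[OF Y(1)], rule that)
      obtain c E where c: "c > 0" and E: "finite E" "E \<subseteq> H" "\<forall>x\<in>H. \<exists>e\<in>E. of_nat c * (x - e) \<in> Y1"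
        using almost_precompact[unfolded almost_precompact_def, rule_format, OF Y1] by blast
      obtain Y2 where Y2: "Y2 \<in> N" "\<And>x i. x \<in> Y2 \<Longrightarrow> \<bar>i\<bar> \<le> int c \<Longrightarrow> of_int i * x \<in> Y1"
        using fraction_mult[OF Y1, of c] by metis
      \<comment> \<open>By the choice of \<open>c\<close>, finitely many translates of
        \<open>A\<close> cover \<open>H\<close>. Finitely many characters thus detect membership in
        \<open>A - A + A - A + Y2\<close>, and multiplication by \<open>c\<close> sends this set
        into signed sums of elements of \<open>Y1\<close>.\<close>
      define A where "A = {x \<in> H. of_nat c * x \<in> Y1}"
      have "\<forall>x\<in>H. \<exists>e\<in>E. x - e \<in> A" using E(2,3) diff_mem unfolding A_def by blast
      from folner_prodanov[OF Y2(1) E(1,2) this]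
      obtain \<Theta> where \<Theta>: "finite \<Theta>" "\<And>\<theta>. \<theta> \<in> \<Theta> \<Longrightarrow> continuous_char \<theta>"
        "\<And>y. y \<in> H \<Longrightarrow> \<forall>\<theta>\<in>\<Theta>. cmod (\<theta> y - 1) \<le> 1 / 8 \<Longrightarrow> y \<in> shifted_combs A Y2"
        unfolding A_def by auto
      have "c \<noteq> 0" "\<not> is_unit p" using c p not_prime_unit by auto
      \<comment> \<open>The two factors of \<open>c\<close> are divided out differently:
        \<open>p ^ q\<close> from the coefficients by \<open>indep_pow\<close>, and
        \<open>c'\<close> from \<open>z k\<close> through \<open>m k\<close> as soon as
        \<open>k \<ge> c'\<close>.\<close>
      from multiplicity_decompose'[OF this] obtain q c' where c': "c = p ^ q * c'" "\<not> p dvd c'" by blast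
      have c'0: "c' > 0" using c c'(1) by (cases c') auto
      obtain V where V: "V \<in> N" "\<And>a n k. int_comb z a n \<in> V \<Longrightarrow> k < n \<Longrightarrow> int p ^ q dvd a k"
        using indep_pow[of q] by blast
      obtain V1 where V1: "V1 \<in> N" "\<And>x y. x \<in> V1 \<Longrightarrow> y \<in> V1 \<Longrightarrow> x - y \<in> V" using half_diff[OF V(1)] by metis
      obtain Z where Z: "Z \<in> N" "Z \<subseteq> V1 \<inter> Y1" using inter[OF V1(1) Y1] by blast
      define u where "u k = of_nat (m k div c') * x k" for k
      have uH: "u k \<in> H" for k unfolding u_def by (intro of_nat_mult_mem xH)
      \<comment> \<open>With \<open>a k = p ^ q * b' k\<close>, the phase sum of \<open>a\<close>
        against \<open>\<sigma> \<theta>\<close> is the phase of \<open>\<theta>\<close> at the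
        quotient \<open>y\<close>, whose coefficients are \<open>b'\<close> with respect to
        \<open>u\<close>.\<close>
      define \<sigma> where "\<sigma> \<theta> k = Arg (\<theta> (u k)) / of_int (int p ^ q)" for \<theta> :: "('b \<Rightarrow> int) \<Rightarrow> complex" and k
      obtain u1 v where v: "u1 \<in> Z" "v \<in> S c' (\<sigma> ` \<Theta>) (1 / 8)" "g = u1 + v"
        using near[OF Z(1) LI[of "\<sigma> ` \<Theta>" "1 / 8" c']] \<Theta>(1) by auto
      obtain a n where a: "v = int_comb z a n" "\<forall>k. k < c' \<or> k \<ge> n \<longrightarrow> a k = 0"
        "\<forall>s\<in>\<sigma> ` \<Theta>. cmod (cis (\<Sum>k<n. of_int (a k) * s k) - 1) < 1 / 8"
        using SE[OF v(2)] by blast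
      \<comment> \<open>As in the first coarsening, a decomposition supported from \<open>n\<close>
        on exposes the coefficients of the first one. Only its support matters, so the phase set is
        empty.\<close>
      obtain u2 v' where v': "u2 \<in> Z" "v' \<in> S n {} 1" "g = u2 + v'"
        using near[OF Z(1) LI[of "{}" 1 n]] by auto
      obtain b l where b: "v' = int_comb z b l" "\<forall>k. k < n \<or> k \<ge> l \<longrightarrow> b k = 0"
        using SE[OF v'(2)] by blast
      have "int_comb z (\<lambda>k. a k - b k) (max n l) = v - v'"
        unfolding a(1) b(1) int_comb_diff
        using int_comb_extend[of n "max n l" a z] int_comb_extend[of l "max n l" b z] a(2) b(2) by simp
      also have "v - v' = u2 - u1" using v(3) v'(3) by (simp add: algebra_simps)
      also have "u2 - u1 \<in> V" using V1(2) Z(2) v(1) v'(1) by blast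
      finally have "int_comb z (\<lambda>k. a k - b k) (max n l) \<in> V" .
      from V(2)[OF this] have dvd: "int p ^ q dvd a k" if "k < n" for k
        using that b(2) by (metis diff_zero less_max_iff_disj)
      define b' where "b' k = a k div int p ^ q" for k
      have b': "a k = int p ^ q * b' k" for k
        using dvd[of k] a(2) by (cases "k < n") (auto simp: b'_def)
      define y where "y = int_comb u b' n"
      have yH: "y \<in> H" unfolding y_def by (intro int_comb_mem uH)
      have vy: "v = of_nat c * y"
      proof -
        have "of_int (a k) * z k = of_nat c * (of_int (b' k) * u k)" for k
        proof (cases "k < c'")
          case True
          then have "a k = 0" using a(2) by blast
          moreover have "b' k = 0" using \<open>a k = 0\<close> by (simp add: b'_def)
          ultimately show ?thesis by simp
        next
          case False
          then have "m k = c' * (m k div c')" using m_dvd[OF c'(2) c'0, of k] by simp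
          then have "z k = of_nat c' * u k" unfolding z_def u_def by (metis mult.assoc of_nat_mult)
          then show ?thesis unfolding b' c'(1) by (simp add: mult_ac)
        qed
        then show ?thesis unfolding a(1) y_def int_comb_def sum_distrib_left by simp
      qed
      have "cmod (\<theta> y - 1) \<le> 1 / 8" if \<theta>: "\<theta> \<in> \<Theta>" for \<theta>
      proof -
        have uc: "unit_char \<theta>" using \<Theta>(2)[OF \<theta>] by (simp add: continuous_char_def)
        have "of_int (a k) * \<sigma> \<theta> k = of_int (b' k) * Arg (\<theta> (u k))" for k
          using p0 by (simp add: \<sigma>_def b')
        then have "\<theta> y = cis (\<Sum>k<n. of_int (a k) * \<sigma> \<theta> k)"
          unfolding y_def unit_char_int_comb[OF uc] by simp
        then show ?thesis using a(3) \<theta> by (auto intro: less_imp_le)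
      qed
      then have "y \<in> shifted_combs A Y2" using \<Theta>(3)[OF yH] by blast
      then obtain a1 a2 a3 a4 e where A: "a1 \<in> A" "a2 \<in> A" "a3 \<in> A" "a4 \<in> A" "e \<in> Y2"
        "y = a1 - a2 + a3 - a4 + e" unfolding shifted_combs_def by blast
      have "g = u1 + (of_nat c * a1 - of_nat c * a2 + of_nat c * a3 - of_nat c * a4 + of_nat c * e)"
        unfolding v(3) vy A(6) by (simp add: algebra_simps)
      also have "\<dots> \<in> Y"
        using A(1-4) v(1) Z(2) Y2(2)[OF A(5), of "int c"] by (intro six) (auto simp: A_def)
      finally show False using Y(2) by blast
    qed
  qed
  then obtain K \<Phi> \<epsilon> where K: "finite \<Phi>" "\<epsilon> > 0" "S K \<Phi> \<epsilon> \<subseteq> U" unfolding L_def by blast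
  obtain k l where kl: "K \<le> k" "k < l" "\<forall>s\<in>\<Phi>. cmod (cis (s k - s l) - 1) < \<epsilon>"
    using almost_constant_phases[OF K(1,2), of K] by blast
  \<comment> \<open>The combination \<open>z k - z l\<close> satisfies the phase conditions, but its
    coefficient 1 is not divisible by \<open>p\<close>.\<close>
  define a where "a i = (if i = k then 1 else if i = l then - 1 else 0 :: int)" for i
  have "int_comb z a (Suc l) \<in> S K \<Phi> \<epsilon>"
  proof (rule SI)
    show "\<forall>i. i < K \<or> i \<ge> Suc l \<longrightarrow> a i = 0" using kl(1,2) by (auto simp: a_def)
    have "(\<Sum>i<Suc l. of_int (a i) * s i) = s k - s l" for s :: "nat \<Rightarrow> real"
    proof -
      have "(\<Sum>i<Suc l. of_int (a i) * s i) = (\<Sum>i\<in>{k, l}. of_int (a i) * s i)"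
        by (rule sum.mono_neutral_right) (use kl(2) in \<open>auto simp: a_def\<close>)
      then show ?thesis using kl(2) by (simp add: a_def)
    qed
    then show "\<forall>s\<in>\<Phi>. cmod (cis (\<Sum>i<Suc l. of_int (a i) * s i) - 1) < \<epsilon>" using kl(3) by simp
  qed
  then have "int p dvd a k" using indep_z[of a "Suc l" k] K(3) kl(2) by auto
  then show False using prime_gt_1_nat[OF p] by (simp add: a_def)
qed

end

section \<open>Connected neighbourhoods and characters\<close>

lemma cis_eq_1_imp_zero:
  assumes "cis x = 1" "\<bar>x\<bar> < 2 * pi"
  shows "x = 0"
proof -
  have "cos x = 1" using assms(1) by (metis cis.sel(1) one_complex.sel(1))
  then obtain n :: int where n: "x = real_of_int n * 2 * pi" by (auto simp: cos_one_2pi_int)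
  have "\<bar>real_of_int n\<bar> * (2 * pi) < 1 * (2 * pi)" using assms(2) by (simp add: n abs_mult)
  then have "\<bar>real_of_int n\<bar> < 1" by (rule mult_right_less_imp_less) simp
  then show ?thesis by (simp add: n)
qed

lemma Arg_eqI:
  assumes "z = cis x" "\<bar>x\<bar> < pi"
  shows "Arg z = x"
  by (rule cis_Arg_unique) (use assms in \<open>auto simp: sgn_eq\<close>)

lemma norm_1_cis_Arg: "cmod z = 1 \<Longrightarrow> z = cis (Arg z)"
  using cis_Arg[of z] by (cases "z = 0") (auto simp: sgn_eq)

lemma root_of_unity_near_1:
  assumes "c > 0"
  shows "\<exists>\<epsilon>>0. \<forall>z :: complex. z ^ c = 1 \<longrightarrow> cmod (z - 1) < \<epsilon> \<longrightarrow> z = 1"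
proof -
  have "finite {z :: complex. z ^ c = 1}" using finite_roots_unity[of c] assms by simp
  then obtain d where "d > 0" "\<forall>z\<in>{z :: complex. z ^ c = 1}. z \<noteq> 1 \<longrightarrow> d \<le> dist 1 z"
    using finite_set_avoid[of _ "1 :: complex"] by blast
  then show ?thesis by (force simp: dist_norm norm_minus_commute)
qed

context group_base
begin

lemma continuous_char_Arg:
  assumes \<theta>: "continuous_char \<theta>" and t: "t > 0"
  shows "\<exists>U\<in>N. \<forall>u\<in>U. \<bar>Arg (\<theta> u)\<bar> < t"
proof -
  have "isCont Arg 1" by (rule continuous_at_Arg) (simp add: complex_nonpos_Reals_iff)
  then obtain \<epsilon> where \<epsilon>: "\<epsilon> > 0" "\<And>z. cmod (z - 1) < \<epsilon> \<Longrightarrow> \<bar>Arg z - Arg 1\<bar> < t"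
    using t unfolding continuous_at_eps_delta by (auto simp: dist_norm)
  obtain U where "U \<in> N" "\<forall>u\<in>U. cmod (\<theta> u - 1) < \<epsilon>" using continuous_charD[OF \<theta> \<epsilon>(1)] by blast
  then show ?thesis using \<epsilon>(2) by force
qed

primrec nsums :: "'a set \<Rightarrow> nat \<Rightarrow> 'a set"
  where "nsums W 0 = {0}"
  | "nsums W (Suc n) = {x + w | x w. x \<in> nsums W n \<and> w \<in> W}"

text \<open>Sums suffice for the generated subgroup because members of \<open>N\<close> are
  symmetric.\<close>

definition gen :: "'a set \<Rightarrow> 'a set"
  where "gen W = (\<Union>n. nsums W n)"

text \<open>The consequence of connectedness that the argument uses: for each \<open>V\<close>, all
  of \<open>W\<close> is reachable from 0 by \<open>V\<close>-small steps inside \<open>W\<close>.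
  It is phrased as an induction principle instead of through explicit chains.\<close>

definition chain_connected :: "'a set \<Rightarrow> bool"
  where "chain_connected W \<longleftrightarrow> (\<forall>A. \<forall>V\<in>N. 0 \<in> A \<longrightarrow>
    (\<forall>a\<in>W. \<forall>w\<in>W. w - a \<in> V \<longrightarrow> (a \<in> A \<longleftrightarrow> w \<in> A)) \<longrightarrow> W \<subseteq> A)"

lemma chain_connectedD:
  assumes "chain_connected W" "V \<in> N" "0 \<in> A"
    "\<And>a w. a \<in> W \<Longrightarrow> w \<in> W \<Longrightarrow> w - a \<in> V \<Longrightarrow> a \<in> A \<longleftrightarrow> w \<in> A"
  shows "W \<subseteq> A"
  using assms(1)[unfolded chain_connected_def, rule_format, OF assms(2,3)] assms(4) by blast

context
  fixes W assumes W: "W \<in> N"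
begin

lemma nsums_add: "x \<in> nsums W n \<Longrightarrow> y \<in> nsums W m \<Longrightarrow> x + y \<in> nsums W (n + m)"
proof (induction m arbitrary: y)
  case (Suc m)
  then obtain y' w where "y = y' + w" "y' \<in> nsums W m" "w \<in> W" by auto
  then show ?case using Suc.IH[of y'] Suc.prems(1) by (auto simp: add.assoc[symmetric])
qed simp

lemma nsums_uminus: "x \<in> nsums W n \<Longrightarrow> - x \<in> nsums W n"
proof (induction n arbitrary: x)
  case (Suc n)
  then obtain y w where yw: "x = y + w" "y \<in> nsums W n" "w \<in> W" by auto
  have x: "- x = - y + - w" by (simp add: yw(1))
  show ?case unfolding x nsums.simps using Suc.IH[OF yw(2)] sym[OF W yw(3)] by blast
qed simp

lemma nsums_mono: "n \<le> m \<Longrightarrow> nsums W n \<subseteq> nsums W m"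
proof (induction m)
  case (Suc m)
  have "nsums W m \<subseteq> nsums W (Suc m)" using zero[OF W] by force
  then show ?case using Suc by (cases "n = Suc m") auto
qed simp

lemma nsums_subset: "nsums W n \<subseteq> H"
  by (induction n) (use subset[OF W] zero_mem add_mem in auto)

lemma gen_subset: "gen W \<subseteq> H"
  using nsums_subset by (auto simp: gen_def)

lemma gen_zero: "0 \<in> gen W"
  unfolding gen_def by (rule UN_I[of 0]) auto

lemma gen_add: "x \<in> gen W \<Longrightarrow> y \<in> gen W \<Longrightarrow> x + y \<in> gen W"
  using nsums_add unfolding gen_def by blast

lemma gen_uminus: "x \<in> gen W \<Longrightarrow> - x \<in> gen W"
  using nsums_uminus unfolding gen_def by blast

lemma gen_diff: "x \<in> gen W \<Longrightarrow> y \<in> gen W \<Longrightarrow> x - y \<in> gen W"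
  using gen_add[of x "- y"] gen_uminus by simp

lemma gen_of_nat_mult: "x \<in> gen W \<Longrightarrow> of_nat n * x \<in> gen W"
  by (induction n) (auto simp: gen_zero gen_add distrib_right)

lemma gen_incl: "W \<subseteq> gen W"
proof
  fix w assume "w \<in> W"
  then have "w \<in> nsums W (Suc 0)" by auto
  then show "w \<in> gen W" unfolding gen_def by blast
qed

lemma gen_minimal:
  assumes "W \<subseteq> B" "0 \<in> B" "\<And>x y. x \<in> B \<Longrightarrow> y \<in> B \<Longrightarrow> x + y \<in> B"
  shows "gen W \<subseteq> B"
proof -
  have "nsums W n \<subseteq> B" for n by (induction n) (use assms in auto)
  then show ?thesis by (auto simp: gen_def)
qed

lemma unit_char_gen:
  assumes \<theta>: "unit_char \<theta>" and 1: "\<And>w. w \<in> W \<Longrightarrow> \<theta> w = 1" and x: "x \<in> gen W"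
  shows "\<theta> x = 1"
  using gen_minimal[of "{x. \<theta> x = 1}"] 1 x unit_char_zero[OF \<theta>] unit_char_add[OF \<theta>] by auto

text \<open>Here the subgroup \<open>cC\<close> is the smallest neighbourhood of 0. Adding this base
  to \<open>N\<close> yields the pullback of the quotient topology on \<open>H / cC\<close>.\<close>

lemma group_base_mult_gen: "group_base H {(*) (of_nat c) ` gen W}"
proof
  show "0 \<in> H" by (rule zero_mem)
  show "x - y \<in> H" if "x \<in> H" "y \<in> H" for x y using that by (rule diff_mem)
  show "{(*) (of_nat c) ` gen W} \<noteq> {}" by simp
next
  fix V assume "V \<in> {(*) (of_nat c) ` gen W}"
  then have V: "V = (*) (of_nat c) ` gen W" by simp
  show "V \<subseteq> H" using V gen_subset of_nat_mult_mem by auto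
  show "0 \<in> V" unfolding V by (rule image_eqI[OF _ gen_zero]) simp
  show "- x \<in> V" if x: "x \<in> V" for x
  proof -
    obtain y where "x = of_nat c * y" "y \<in> gen W" using x V by blast
    then show ?thesis unfolding V by (intro image_eqI[of _ _ "- y"] gen_uminus) auto
  qed
  have "x + y \<in> V" if xy: "x \<in> V" "y \<in> V" for x y
  proof -
    obtain x' y' where "x = of_nat c * x'" "x' \<in> gen W" "y = of_nat c * y'" "y' \<in> gen W" using xy V by blast
    then show ?thesis unfolding V by (intro image_eqI[of _ _ "x' + y'"] gen_add) (auto simp: distrib_left)
  qed
  then show "\<exists>V'\<in>{(*) (of_nat c) ` gen W}. \<forall>x\<in>V'. \<forall>y\<in>V'. x + y \<in> V"
    unfolding V[symmetric] by simp
qed auto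

end

text \<open>Steps from \<open>W'\<close> never enter or leave the subgroup generated by
  \<open>W'\<close>, so a chain connected \<open>W\<close> lies inside it. The generated subgroup is
  thus the same for all chain connected neighbourhoods, and the neighbourhood may be chosen after
  the character.\<close>

lemma gen_subset_gen:
  assumes "W \<in> N" "chain_connected W" "W' \<in> N"
  shows "gen W \<subseteq> gen W'"
proof (rule gen_minimal[OF assms(1)])
  show "W \<subseteq> gen W'"
  proof (rule chain_connectedD[OF assms(2,3) gen_zero[OF assms(3)]])
    fix a w assume "w - a \<in> W'"
    then have d: "w - a \<in> gen W'" using gen_incl[OF assms(3)] by blast
    show "a \<in> gen W' \<longleftrightarrow> w \<in> gen W'"
      using gen_add[OF assms(3) d, of a] gen_diff[OF assms(3) _ d, of w] by auto
  qed
qed (use gen_zero gen_add assms(3) in auto)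

end

section \<open>Approximate division by c and triviality of characters\<close>

context minimal_free_group_base
begin

text \<open>Characters of the quotient by the closure of \<open>c * gen W\<close> take values in the \<open>c\<close>-th roots of
  unity on \<open>gen W\<close>, hence are trivial there by connectedness; so this closure is all of \<open>gen W\<close>.\<close>

lemma mult_gen_dense:
  assumes W: "W \<in> N" "chain_connected W" and c: "c > 0" and U: "U \<in> N" and x: "x \<in> gen W"
  shows "\<exists>y\<in>gen W. x - of_nat c * y \<in> U"
proof -
  define D where "D = (*) (of_nat c) ` gen W"
  define N' where "N' = (\<lambda>(U, V). {u + v | u v. u \<in> U \<and> v \<in> V}) ` (N \<times> {D})"
  have base: "group_base H N'"
    unfolding N'_def D_def by (rule group_base_sum[OF group_base_axioms group_base_mult_gen[OF W(1)]])
  have D0: "0 \<in> D" unfolding D_def by (rule image_eqI[OF _ gen_zero[OF W(1)]]) simp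
  have in_N': "{u + v | u v. u \<in> V \<and> v \<in> D} \<in> N'" if "V \<in> N" for V using that unfolding N'_def by auto
  have N'E: "\<exists>V\<in>N. V \<subseteq> V' \<and> D \<subseteq> V'" if V': "V' \<in> N'" for V'
  proof -
    obtain V where V: "V \<in> N" "V' = {u + v | u v. u \<in> V \<and> v \<in> D}" using V' unfolding N'_def by auto
    have "x + 0 \<in> V'" if "x \<in> V" for x unfolding V(2) using D0 that by blast
    moreover have "0 + x \<in> V'" if "x \<in> D" for x unfolding V(2) using zero[OF V(1)] that by blast
    ultimately show ?thesis using V(1) by (intro bexI[of _ V]) auto
  qed
  \<comment> \<open>Recurrence passes to the coarser base, since every member of \<open>N'\<close>
    contains a member of \<open>N\<close>.\<close>
  interpret Q: free_group_base H N' S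
  proof (rule free_group_base.intro[OF base], unfold_locales)
    show "H = {x. finite {i. x i \<noteq> 0} \<and> {i. x i \<noteq> 0} \<subseteq> S}" by (rule H_eq)
    fix V' W' m assume "V' \<in> N'" "finite W'" "W' \<subseteq> H"
    then show "\<exists>n\<ge>m. \<forall>w\<in>W'. of_nat n * w \<in> V'"
      using N'E[of V'] recur[of _ W' m] by blast
  qed
  obtain U1 where U1: "U1 \<in> N" and five: "\<And>a b c d e. a \<in> U1 \<Longrightarrow> b \<in> U1 \<Longrightarrow> c \<in> U1 \<Longrightarrow>
      d \<in> U1 \<Longrightarrow> e \<in> U1 \<Longrightarrow> a - b + c - d + e \<in> U"
    by (rule signed_sum5[OF U], rule that)
  define A where "A = {u + v | u v. u \<in> U1 \<and> v \<in> D}"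
  have A: "A \<in> N'" unfolding A_def by (rule in_N'[OF U1])
  obtain E where E: "finite E" "E \<subseteq> H" "\<forall>x\<in>H. \<exists>e\<in>E. x - e \<in> U1"
    using precompact[unfolded precompact_def, rule_format, OF U1] by blast
  have "x + 0 \<in> A" if "x \<in> U1" for x unfolding A_def using D0 that by blast
  then have "U1 \<subseteq> A" by auto
  then have "\<forall>x\<in>H. \<exists>e\<in>E. x - e \<in> A" using E(3) by blast
  from Q.folner_prodanov[OF A E(1,2) this Q.subset[OF A]]
  obtain \<Theta> where "finite \<Theta> \<and> (\<forall>\<theta>\<in>\<Theta>. Q.continuous_char \<theta>) \<and>
    (\<forall>y\<in>H. (\<forall>\<theta>\<in>\<Theta>. cmod (\<theta> y - 1) \<le> 1 / 8) \<longrightarrow> y \<in> Q.shifted_combs A A)"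
    by (elim exE)
  then have \<Theta>: "\<And>\<theta>. \<theta> \<in> \<Theta> \<Longrightarrow> Q.continuous_char \<theta>"
    "\<And>y. y \<in> H \<Longrightarrow> \<forall>\<theta>\<in>\<Theta>. cmod (\<theta> y - 1) \<le> 1 / 8 \<Longrightarrow> y \<in> Q.shifted_combs A A"
    by simp_all
  have triv: "\<theta> y = 1" if \<theta>: "\<theta> \<in> \<Theta>" and y: "y \<in> gen W" for \<theta> y
  proof -
    have uc: "unit_char \<theta>" using \<Theta>(1)[OF \<theta>] by (simp add: Q.continuous_char_def)
    have D1: "\<theta> z = 1" if z: "z \<in> D" for z
    proof (rule ccontr)
      assume "\<theta> z \<noteq> 1"
      then have "cmod (\<theta> z - 1) > 0" by simp
      from Q.continuous_charD[OF \<Theta>(1)[OF \<theta>] this] obtain V' where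
        "V' \<in> N'" "\<forall>u\<in>V'. cmod (\<theta> u - 1) < cmod (\<theta> z - 1)" by blast
      then show False using N'E[of V'] z by blast
    qed
    have root: "\<theta> x ^ c = 1" if "x \<in> gen W" for x
      using D1[of "of_nat c * x"] that by (simp add: D_def unit_char_of_nat_mult[OF uc])
    \<comment> \<open>The \<open>c\<close>-th roots of unity are isolated, so on small differences
      within \<open>gen W\<close> the character is exactly 1 and is constant along chains.\<close>
    obtain \<epsilon> where \<epsilon>: "\<epsilon> > 0" "\<And>z :: complex. z ^ c = 1 \<Longrightarrow> cmod (z - 1) < \<epsilon> \<Longrightarrow> z = 1"
      using root_of_unity_near_1[OF c] by blast
    obtain V' where V': "V' \<in> N'" "\<forall>u\<in>V'. cmod (\<theta> u - 1) < \<epsilon>"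
      using Q.continuous_charD[OF \<Theta>(1)[OF \<theta>] \<epsilon>(1)] by blast
    obtain V where V: "V \<in> N" "V \<subseteq> V'" using N'E[OF V'(1)] by blast
    have "W \<subseteq> {x. \<theta> x = 1}"
    proof (rule chain_connectedD[OF W(2) V(1)])
      show "0 \<in> {x. \<theta> x = 1}" by (simp add: unit_char_zero[OF uc])
      fix a w assume aw: "a \<in> W" "w \<in> W" "w - a \<in> V"
      have "w - a \<in> gen W" using aw(1,2) gen_incl[OF W(1)] gen_diff[OF W(1)] by blast
      then have "\<theta> (w - a) = 1" using \<epsilon>(2) root V'(2) V(2) aw(3) by blast
      then have "\<theta> w = \<theta> a" using unit_char_add[OF uc, of "w - a" a] by simp
      then show "a \<in> {x. \<theta> x = 1} \<longleftrightarrow> w \<in> {x. \<theta> x = 1}" by simp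
    qed
    then show ?thesis using unit_char_gen[OF W(1) uc _ y] by blast
  qed
  have "x \<in> H" using gen_subset[OF W(1)] x by blast
  then have "x \<in> Q.shifted_combs A A" 
  proof (rule \<Theta>(2), intro ballI)
    show "cmod (\<theta> x - 1) \<le> 1 / 8" if "\<theta> \<in> \<Theta>" for \<theta> using triv[OF that x] by simp
  qed
  then obtain a b c' d e where *: "a \<in> A" "b \<in> A" "c' \<in> A" "d \<in> A" "e \<in> A" "x = a - b + c' - d + e"
    unfolding Q.shifted_combs_def by blast
  have AE: "\<exists>u\<in>U1. \<exists>y\<in>gen W. a = u + of_nat c * y" if "a \<in> A" for a
    using that unfolding A_def D_def by blast
  obtain u1 y1 where 1: "u1 \<in> U1" "y1 \<in> gen W" "a = u1 + of_nat c * y1" using AE[OF *(1)] by blast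
  obtain u2 y2 where 2: "u2 \<in> U1" "y2 \<in> gen W" "b = u2 + of_nat c * y2" using AE[OF *(2)] by blast
  obtain u3 y3 where 3: "u3 \<in> U1" "y3 \<in> gen W" "c' = u3 + of_nat c * y3" using AE[OF *(3)] by blast
  obtain u4 y4 where 4: "u4 \<in> U1" "y4 \<in> gen W" "d = u4 + of_nat c * y4" using AE[OF *(4)] by blast
  obtain u5 y5 where 5: "u5 \<in> U1" "y5 \<in> gen W" "e = u5 + of_nat c * y5" using AE[OF *(5)] by blast
  have "x - of_nat c * (y1 - y2 + y3 - y4 + y5) = u1 - u2 + u3 - u4 + u5"
    unfolding *(6) 1(3) 2(3) 3(3) 4(3) 5(3) by (simp add: algebra_simps)
  moreover have "u1 - u2 + u3 - u4 + u5 \<in> U" using five 1(1) 2(1) 3(1) 4(1) 5(1) by blast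
  moreover have "y1 - y2 + y3 - y4 + y5 \<in> gen W"
    using 1(2) 2(2) 3(2) 4(2) 5(2) by (intro gen_add[OF W(1)] gen_diff[OF W(1)])
  ultimately show ?thesis by (intro bexI[of _ "y1 - y2 + y3 - y4 + y5"]) auto
qed

text \<open>The bound is propagated along chains in \<open>W\<close> and renews itself at each step.
  From a neighbour with bound \<open>2 / c\<close>, density and \<open>mult_embedding\<close> give
  \<open>\<theta> y' = cis s\<close> with \<open>c * \<bar>s\<bar> \<le> 5 / 2\<close>. Moreover
  \<open>c * s\<close> agrees modulo \<open>2 * pi\<close> with some \<open>t\<close> near
  \<open>Arg (\<theta> w)\<close>, where \<open>\<bar>t\<bar> \<le> 3 / 2\<close>. As
  \<open>5 / 2 + 3 / 2 < 2 * pi\<close>, the two are equal, so \<open>\<bar>s\<bar>\<close> is at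
  most \<open>(3 / 2) / c\<close> and no error accumulates.\<close>

lemma small_Arg_on_divisors:
  assumes W: "W \<in> N" "chain_connected W" and c: "c > 0"
    and \<theta>: "continuous_char \<theta>" and small: "\<And>w. w \<in> W \<Longrightarrow> \<bar>Arg (\<theta> w)\<bar> \<le> 1"
  shows "\<exists>V\<in>N. \<forall>w\<in>W. \<forall>y\<in>gen W. of_nat c * y - w \<in> V \<longrightarrow> \<bar>Arg (\<theta> y)\<bar> \<le> 2 / real c"
proof -
  have uc: "unit_char \<theta>" using \<theta> by (simp add: continuous_char_def)
  have cis: "\<theta> x = cis (Arg (\<theta> x))" for x by (rule norm_1_cis_Arg[OF unit_char_norm[OF uc]])
  have c1: "real c \<ge> 1" using c by simp
  obtain O2 where O2: "O2 \<in> N" "\<And>u. u \<in> O2 \<Longrightarrow> \<bar>Arg (\<theta> u)\<bar> < 1 / (2 * real c)"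
    using continuous_char_Arg[OF \<theta>, of "1 / (2 * real c)"] c1 by auto
  obtain O1 where O1: "O1 \<in> N" "\<And>x. x \<in> H \<Longrightarrow> of_nat c * x \<in> O1 \<Longrightarrow> x \<in> O2"
    using mult_embedding[OF O2(1) c] by blast
  obtain O3 where O3: "O3 \<in> N" "\<And>u. u \<in> O3 \<Longrightarrow> \<bar>Arg (\<theta> u)\<bar> < 1 / 2"
    using continuous_char_Arg[OF \<theta>, of "1 / 2"] by auto
  obtain O4 where O4: "O4 \<in> N" "O4 \<subseteq> O1"
    "\<And>x y z. x \<in> O4 \<Longrightarrow> y \<in> O4 \<Longrightarrow> z \<in> O4 \<Longrightarrow> x + y + z \<in> O1"
    using third[OF O1(1)] by metis
  obtain V where V: "V \<in> N" "V \<subseteq> O4 \<inter> O3" using inter[OF O4(1) O3(1)] by blast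
  define A where "A = {w. \<forall>y\<in>gen W. of_nat c * y - w \<in> V \<longrightarrow> \<bar>Arg (\<theta> y)\<bar> \<le> 2 / real c}"
  have step: "w \<in> A" if a: "a \<in> W" "a \<in> A" and w: "w \<in> W" and wa: "w - a \<in> V" for a w
    unfolding A_def
  proof (intro CollectI ballI impI)
    fix y' assume y': "y' \<in> gen W" "of_nat c * y' - w \<in> V"
    obtain y where y: "y \<in> gen W" "a - of_nat c * y \<in> V"
      using mult_gen_dense[OF W c V(1), of a] a(1) gen_incl[OF W(1)] by blast
    have y2: "of_nat c * y - a \<in> V" using sym[OF V(1) y(2)] by simp
    have "of_nat c * (y' - y) = (of_nat c * y' - w) + (w - a) + (a - of_nat c * y)"
      by (simp add: algebra_simps)
    also have "\<dots> \<in> O1" using O4(3) V(2) y'(2) wa y(2) by blast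
    finally have "y' - y \<in> O2"
      using O1(2) gen_diff[OF W(1) y'(1) y(1)] gen_subset[OF W(1)] by blast
    then have d: "\<bar>Arg (\<theta> (y' - y))\<bar> < 1 / (2 * real c)" by (rule O2(2))
    define s where "s = Arg (\<theta> y) + Arg (\<theta> (y' - y))"
    define t where "t = Arg (\<theta> w) + Arg (\<theta> (of_nat c * y' - w))"
    have "\<theta> y' = \<theta> y * \<theta> (y' - y)" using unit_char_add[OF uc, of y "y' - y"] by simp
    then have s: "\<theta> y' = cis s" unfolding s_def cis_mult[symmetric] cis[symmetric] .
    have "\<bar>Arg (\<theta> y)\<bar> \<le> 2 / real c" using a(2) y(1) y2 unfolding A_def by blast
    then have "\<bar>s\<bar> \<le> 2 / real c + 1 / (2 * real c)" using d unfolding s_def by linarith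
    then have "real c * \<bar>s\<bar> \<le> real c * (2 / real c + 1 / (2 * real c))" using c1 by (intro mult_left_mono) auto
    also have "\<dots> = 5 / 2" using c1 by (simp add: field_simps)
    finally have cs: "\<bar>real c * s\<bar> \<le> 5 / 2" using c1 by (simp add: abs_mult)
    have "\<bar>Arg (\<theta> (of_nat c * y' - w))\<bar> < 1 / 2" by (rule O3(2)) (use V(2) y'(2) in blast)
    then have ct: "\<bar>t\<bar> \<le> 3 / 2" using small[OF w] unfolding t_def by linarith
    have "cis (real c * s) = \<theta> y' ^ c" unfolding s by (simp add: Complex.DeMoivre)
    also have "\<dots> = \<theta> (of_nat c * y')" by (rule unit_char_of_nat_mult[OF uc, symmetric])
    also have "\<dots> = \<theta> w * \<theta> (of_nat c * y' - w)" using unit_char_add[OF uc, of w "of_nat c * y' - w"] by simp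
    also have "\<dots> = cis t" unfolding t_def cis_mult[symmetric] cis[symmetric] ..
    finally have "cis (real c * s - t) = 1" by (simp flip: cis_divide)
    moreover have "\<bar>real c * s - t\<bar> < 2 * pi" using cs ct pi_gt3 by linarith
    ultimately have "real c * s = t" using cis_eq_1_imp_zero[of "real c * s - t"] by simp
    then have "s = t / real c" using c1 by (simp add: field_simps)
    then have sle: "\<bar>s\<bar> \<le> (3 / 2) / real c" using divide_right_mono[OF ct, of "real c"] by (simp add: abs_divide)
    also have "\<dots> \<le> 3 / 2" using c1 by (simp add: field_simps)
    finally have "\<bar>s\<bar> < pi" using pi_gt3 by linarith
    from Arg_eqI[OF s this] have "\<bar>Arg (\<theta> y')\<bar> \<le> (3 / 2) / real c" using sle by simp
    also have "\<dots> \<le> 2 / real c" using c1 by (intro divide_right_mono) auto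
    finally show "\<bar>Arg (\<theta> y')\<bar> \<le> 2 / real c" .
  qed
  have "W \<subseteq> A"
  proof (rule chain_connectedD[OF W(2) V(1)])
    show "0 \<in> A" unfolding A_def
    proof (intro CollectI ballI impI)
      fix y assume y: "y \<in> gen W" "of_nat c * y - 0 \<in> V"
      have "of_nat c * y \<in> O1" using y(2) V(2) O4(2) by auto
      then have "y \<in> O2" using O1(2) gen_subset[OF W(1)] y(1) by blast
      then have "\<bar>Arg (\<theta> y)\<bar> < 1 / (2 * real c)" by (rule O2(2))
      also have "\<dots> \<le> 2 / real c" using c1 by (simp add: field_simps)
      finally show "\<bar>Arg (\<theta> y)\<bar> \<le> 2 / real c" by simp
    qed
    fix a w assume "a \<in> W" "w \<in> W" "w - a \<in> V"
    then show "a \<in> A \<longleftrightarrow> w \<in> A" using step[of a w] step[of w a] sym[OF V(1), of "w - a"] by auto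
  qed
  then show ?thesis using V(1) unfolding A_def by blast
qed

text \<open>Each of the finitely many representatives lying in \<open>gen W\<close> is a sum of a
  fixed length; a remainder in \<open>W\<close> adds one summand.\<close>

lemma nsums_bounded:
  assumes W: "W \<in> N"
  shows "\<exists>m. gen W \<subseteq> nsums W m"
proof -
  obtain E where E: "finite E" "E \<subseteq> H" "\<forall>x\<in>H. \<exists>e\<in>E. x - e \<in> W"
    using precompact[unfolded precompact_def, rule_format, OF W] by blast
  have "\<forall>e. \<exists>m. e \<in> gen W \<longrightarrow> e \<in> nsums W m" by (auto simp: gen_def)
  then obtain r where r: "\<And>e. e \<in> gen W \<Longrightarrow> e \<in> nsums W (r e)" by metis
  define m where "m = Max (insert 0 (r ` E))"
  have m: "r e \<le> m" if "e \<in> E" for e unfolding m_def using E(1) that by (intro Max_ge) auto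
  have "x \<in> nsums W (Suc m)" if x: "x \<in> gen W" for x
  proof -
    obtain e where e: "e \<in> E" "x - e \<in> W" using E(3) gen_subset[OF W] x by blast
    have "e = x - (x - e)" by simp
    then have "e \<in> gen W" using gen_diff[OF W x, of "x - e"] gen_incl[OF W] e(2) by auto
    then have "e \<in> nsums W m" using r nsums_mono[OF W m[OF e(1)]] by blast
    moreover have "x = e + (x - e)" by simp
    ultimately show ?thesis using e(2) by (metis (mono_tags, lifting) mem_Collect_eq nsums.simps(2))
  qed
  then show ?thesis by blast
qed

text \<open>The element decomposed is \<open>c * y\<close>: it is a sum of \<open>m\<close> elements
  of \<open>W\<close> with \<open>m\<close> independent of \<open>c\<close>. Dividing each summand
  approximately by \<open>c\<close> gives \<open>y'\<close> with phase at most
  \<open>2 * m / c\<close>. Since \<open>c * (y' - y)\<close> is small,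
  \<open>mult_embedding\<close> makes \<open>y' - y\<close> small, at a further cost of
  \<open>1 / c\<close>.\<close>

lemma char_trivial_on_small_gen:
  assumes W: "W \<in> N" "chain_connected W"
    and \<theta>: "continuous_char \<theta>" and small: "\<And>w. w \<in> W \<Longrightarrow> \<bar>Arg (\<theta> w)\<bar> \<le> 1" and y: "y \<in> gen W"
  shows "\<theta> y = 1"
proof -
  have uc: "unit_char \<theta>" using \<theta> by (simp add: continuous_char_def)
  have cis: "\<theta> x = cis (Arg (\<theta> x))" for x by (rule norm_1_cis_Arg[OF unit_char_norm[OF uc]])
  obtain m where m: "gen W \<subseteq> nsums W m" using nsums_bounded[OF W(1)] by blast
  have bound: "cmod (\<theta> y - 1) \<le> (2 * real m + 1) / real c" if c: "c > 0" for c
  proof -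
    obtain V where V: "V \<in> N"
      "\<And>w y. w \<in> W \<Longrightarrow> y \<in> gen W \<Longrightarrow> of_nat c * y - w \<in> V \<Longrightarrow> \<bar>Arg (\<theta> y)\<bar> \<le> 2 / real c"
      using small_Arg_on_divisors[OF W c \<theta> small] by blast
    \<comment> \<open>A real phase \<open>s\<close> is tracked instead of \<open>Arg\<close>, which
      is not additive.\<close>
    have approx: "\<exists>y\<in>gen W. \<exists>s. of_nat c * y - x \<in> P \<and> \<theta> y = cis s \<and> \<bar>s\<bar> \<le> 2 * real n / real c"
      if "x \<in> nsums W n" "P \<in> N" for n x P
      using that
    proof (induction n arbitrary: x P)
      case 0
      show ?case
      proof (intro bexI[of _ 0] exI[of _ 0] conjI)
        show "of_nat c * 0 - x \<in> P" using 0 zero[of P] by simp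
        show "\<theta> 0 = cis 0" using unit_char_zero[OF uc] by simp
        show "0 \<in> gen W" by (rule gen_zero[OF W(1)])
      qed simp
    next
      case (Suc n)
      obtain x' w where x: "x = x' + w" "x' \<in> nsums W n" "w \<in> W" using Suc.prems(1) by auto
      obtain P' where P': "P' \<in> N" "\<And>x y. x \<in> P' \<Longrightarrow> y \<in> P' \<Longrightarrow> x + y \<in> P"
        using half_diff[OF Suc.prems(2)] by metis
      obtain P'' where P'': "P'' \<in> N" "P'' \<subseteq> P' \<inter> V" using inter[OF P'(1) V(1)] by blast
      obtain y' s where y': "y' \<in> gen W" "of_nat c * y' - x' \<in> P'" "\<theta> y' = cis s" "\<bar>s\<bar> \<le> 2 * real n / real c"
        using Suc.IH[OF x(2) P'(1)] by blast
      obtain y'' where y'': "y'' \<in> gen W" "w - of_nat c * y'' \<in> P''"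
        using mult_gen_dense[OF W c P''(1), of w] x(3) gen_incl[OF W(1)] by blast
      have y3: "of_nat c * y'' - w \<in> P''" using sym[OF P''(1) y''(2)] by simp
      have "\<bar>Arg (\<theta> y'')\<bar> \<le> 2 / real c" using V(2)[OF x(3) y''(1)] y3 P''(2) by blast
      then have "\<bar>s + Arg (\<theta> y'')\<bar> \<le> 2 * real n / real c + 2 / real c" using y'(4) by linarith
      also have "\<dots> = 2 * real (Suc n) / real c" by (simp add: field_simps add_divide_distrib)
      finally have "\<bar>s + Arg (\<theta> y'')\<bar> \<le> 2 * real (Suc n) / real c" .
      moreover have "\<theta> (y' + y'') = cis (s + Arg (\<theta> y''))"
        unfolding unit_char_add[OF uc] y'(3) cis_mult[symmetric] cis[of y'', symmetric] ..
      moreover have "of_nat c * (y' + y'') - x = (of_nat c * y' - x') + (of_nat c * y'' - w)"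
        by (simp add: x(1) algebra_simps)
      then have "of_nat c * (y' + y'') - x \<in> P" using P'(2)[OF y'(2)] y3 P''(2) by auto
      ultimately show ?case using gen_add[OF W(1) y'(1) y''(1)] by blast
    qed
    obtain U where U: "U \<in> N" "\<And>u. u \<in> U \<Longrightarrow> cmod (\<theta> u - 1) < 1 / real c"
      using continuous_charD[OF \<theta>, of "1 / real c"] c by auto
    obtain P where P: "P \<in> N" "\<And>x. x \<in> H \<Longrightarrow> of_nat c * x \<in> P \<Longrightarrow> x \<in> U"
      using mult_embedding[OF U(1) c] by blast
    have "of_nat c * y \<in> nsums W m" using m gen_of_nat_mult[OF W(1) y] by blast
    from approx[OF this P(1)] obtain y' s where y': "y' \<in> gen W" "of_nat c * y' - of_nat c * y \<in> P"
      "\<theta> y' = cis s" "\<bar>s\<bar> \<le> 2 * real m / real c" by blast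
    have "y' - y \<in> H" using gen_diff[OF W(1) y'(1) y] gen_subset[OF W(1)] by blast
    then have "y' - y \<in> U" using P(2) y'(2) by (simp add: right_diff_distrib)
    then have 1: "cmod (\<theta> (y - y') - 1) < 1 / real c"
      using U(2) unit_char_dist_minus[OF uc, of "y' - y"] by simp
    have "cmod (\<theta> y' - 1) = 2 * \<bar>sin (s / 2)\<bar>"
      unfolding y'(3) cis_conv_exp by (rule dist_exp_i_1)
    also have "\<dots> \<le> \<bar>s\<bar>" using abs_sin_x_le_abs_x[of "s / 2"] by simp
    finally have "cmod (\<theta> y' - 1) \<le> 2 * real m / real c" using y'(4) by linarith
    then have "cmod (\<theta> y - 1) \<le> 2 * real m / real c + 1 / real c"
      using unit_char_dist_add[OF uc, of y' "y - y'"] 1 by simp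
    then show ?thesis by (simp add: add_divide_distrib)
  qed
  show ?thesis
  proof (rule ccontr)
    assume "\<theta> y \<noteq> 1"
    then have pos: "cmod (\<theta> y - 1) > 0" by simp
    obtain c :: nat where c: "(2 * real m + 1) / cmod (\<theta> y - 1) < real c" using reals_Archimedean2 by blast
    have "0 < (2 * real m + 1) / cmod (\<theta> y - 1)" using pos by (intro divide_pos_pos) auto
    then have "c > 0" using c by (metis of_nat_0_less_iff order_less_trans)
    then show False using bound[of c] c pos by (simp add: field_simps)
  qed
qed

theorem locally_connected_trivial:
  assumes lc: "\<And>U. U \<in> N \<Longrightarrow> \<exists>W\<in>N. W \<subseteq> U \<and> chain_connected W"
  shows "H = {0}"
proof -
  obtain U0 where "U0 \<in> N" using nonempty by blast
  then obtain W where W: "W \<in> N" "chain_connected W" using lc by blast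
  have triv: "\<theta> y = 1" if \<theta>: "continuous_char \<theta>" and y: "y \<in> gen W" for \<theta> y
  proof -
    obtain U where U: "U \<in> N" "\<forall>u\<in>U. \<bar>Arg (\<theta> u)\<bar> < 1" using continuous_char_Arg[OF \<theta>, of 1] by auto
    obtain W' where W': "W' \<in> N" "W' \<subseteq> U" "chain_connected W'" using lc[OF U(1)] by blast
    have "y \<in> gen W'" using gen_subset_gen[OF W W'(1)] y by blast
    moreover have "\<bar>Arg (\<theta> w)\<bar> \<le> 1" if "w \<in> W'" for w
      using U(2) W'(2) that by (meson less_imp_le subsetD)
    ultimately show ?thesis using char_trivial_on_small_gen[OF W'(1,3) \<theta>] by blast
  qed
  have "x = 0" if x: "x \<in> gen W" for x
  proof (rule ccontr)
    assume "x \<noteq> 0"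
    have xH: "x \<in> H" using gen_subset[OF W(1)] x by blast
    obtain U where U: "U \<in> N" "x \<notin> U" using hausdorff[OF xH \<open>x \<noteq> 0\<close>] by blast
    obtain U1 where U1: "U1 \<in> N" and five: "\<And>a b c d e. a \<in> U1 \<Longrightarrow> b \<in> U1 \<Longrightarrow> c \<in> U1 \<Longrightarrow>
        d \<in> U1 \<Longrightarrow> e \<in> U1 \<Longrightarrow> a - b + c - d + e \<in> U"
      by (rule signed_sum5[OF U(1)], rule that)
    obtain E where E: "finite E" "E \<subseteq> H" "\<forall>x\<in>H. \<exists>e\<in>E. x - e \<in> U1"
      using precompact[unfolded precompact_def, rule_format, OF U1] by blast
    from folner_prodanov[OF U1 E subset[OF U1]]
    obtain \<Theta> where "finite \<Theta> \<and> (\<forall>\<theta>\<in>\<Theta>. continuous_char \<theta>) \<and>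
      (\<forall>y\<in>H. (\<forall>\<theta>\<in>\<Theta>. cmod (\<theta> y - 1) \<le> 1 / 8) \<longrightarrow> y \<in> shifted_combs U1 U1)"
      by (elim exE)
    then have \<Theta>: "\<And>\<theta>. \<theta> \<in> \<Theta> \<Longrightarrow> continuous_char \<theta>"
      "\<And>y. y \<in> H \<Longrightarrow> \<forall>\<theta>\<in>\<Theta>. cmod (\<theta> y - 1) \<le> 1 / 8 \<Longrightarrow> y \<in> shifted_combs U1 U1"
      by simp_all
    have "x \<in> shifted_combs U1 U1" 
    proof (rule \<Theta>(2)[OF xH], intro ballI)
      show "cmod (\<theta> x - 1) \<le> 1 / 8" if "\<theta> \<in> \<Theta>" for \<theta> using triv[OF \<Theta>(1)[OF that] x] by simp
    qed
    then have "x \<in> U" unfolding shifted_combs_def using five by blast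
    then show False using U(2) by blast
  qed
  then have W0: "W = {0}" using gen_incl[OF W(1)] zero[OF W(1)] by blast
  obtain E where E: "finite E" "E \<subseteq> H" "\<forall>x\<in>H. \<exists>e\<in>E. x - e \<in> W"
    using precompact[unfolded precompact_def, rule_format, OF W(1)] by blast
  have "H \<subseteq> E"
  proof
    fix x assume "x \<in> H"
    then obtain e where "e \<in> E" "x - e = 0" using E(3) W0 by blast
    then show "x \<in> E" by simp
  qed
  then have fin: "finite H" using E(1) finite_subset by blast
  have "x = 0" if x: "x \<in> H" for x
  proof -
    have "\<not> inj_on (\<lambda>k :: nat. of_nat k * x) UNIV"
    proof
      assume "inj_on (\<lambda>k :: nat. of_nat k * x) UNIV"
      moreover have "finite (range (\<lambda>k :: nat. of_nat k * x))"
        by (rule finite_subset[OF _ fin]) (use of_nat_mult_mem x in auto)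
      ultimately show False using finite_imageD infinite_UNIV_nat by blast
    qed
    then obtain k l :: nat where kl: "of_nat k * x = of_nat l * x" "k \<noteq> l" unfolding inj_on_def by blast
    have aux: "x = 0" if "of_nat k * x = of_nat l * x" "k < l" for k l :: nat
    proof -
      have "of_nat (l - k) * x = 0" using that by (simp add: of_nat_diff left_diff_distrib)
      then show ?thesis using torsion_free[OF x, of "l - k"] that(2) by simp
    qed
    show ?thesis using aux[of k l] aux[of l k] kl by (cases "k < l") auto
  qed
  then show ?thesis using zero_mem by blast
qed

end

section \<open>Group topologies and neighbourhood bases\<close>

locale additive_embedding = group G for G :: "('a, 'm) monoid_scheme" (structure) +
  fixes \<phi> :: "'a \<Rightarrow> 'c::comm_ring_1"
  assumes inj: "inj_on \<phi> (carrier G)"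
    and \<phi>_mult: "x \<in> carrier G \<Longrightarrow> y \<in> carrier G \<Longrightarrow> \<phi> (x \<otimes> y) = \<phi> x + \<phi> y"
begin

lemma \<phi>_one: "\<phi> \<one> = 0"
  using \<phi>_mult[of \<one> \<one>] by simp

lemma \<phi>_inv: "x \<in> carrier G \<Longrightarrow> \<phi> (inv x) = - \<phi> x"
  using \<phi>_mult[of "inv x" x] by (simp add: \<phi>_one eq_neg_iff_add_eq_0)

lemma \<phi>_quot: "x \<in> carrier G \<Longrightarrow> y \<in> carrier G \<Longrightarrow> \<phi> (inv x \<otimes> y) = \<phi> y - \<phi> x"
  by (simp add: \<phi>_mult \<phi>_inv)

lemma zero_image: "0 \<in> \<phi> ` carrier G"
  using \<phi>_one by (metis imageI one_closed)

lemma diff_image: "u \<in> \<phi> ` carrier G \<Longrightarrow> v \<in> \<phi> ` carrier G \<Longrightarrow> u - v \<in> \<phi> ` carrier G"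
proof -
  assume "u \<in> \<phi> ` carrier G" "v \<in> \<phi> ` carrier G"
  then obtain x y where "x \<in> carrier G" "y \<in> carrier G" "u = \<phi> x" "v = \<phi> y" by blast
  then show ?thesis using \<phi>_quot[of y x] by (metis imageI inv_closed m_closed)
qed

definition base_topology :: "'c set set \<Rightarrow> 'a topology"
  where "base_topology M = topology (\<lambda>U. U \<subseteq> carrier G \<and>
    (\<forall>x\<in>U. \<exists>V\<in>M. \<forall>y\<in>carrier G. \<phi> y - \<phi> x \<in> V \<longrightarrow> y \<in> U))"

context
  fixes M assumes M: "group_base (\<phi> ` carrier G) M"
begin

interpretation M: group_base "\<phi> ` carrier G" M by (rule M)

lemma openin_base_topology: "openin (base_topology M) U \<longleftrightarrow> U \<subseteq> carrier G \<and>
    (\<forall>x\<in>U. \<exists>V\<in>M. \<forall>y\<in>carrier G. \<phi> y - \<phi> x \<in> V \<longrightarrow> y \<in> U)"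
proof -
  let ?P = "\<lambda>U. U \<subseteq> carrier G \<and> (\<forall>x\<in>U. \<exists>V\<in>M. \<forall>y\<in>carrier G. \<phi> y - \<phi> x \<in> V \<longrightarrow> y \<in> U)"
  have "istopology ?P"
    unfolding istopology_def
  proof (intro conjI allI impI)
    fix A B assume A: "?P A" and B: "?P B"
    show "A \<inter> B \<subseteq> carrier G" using A by blast
    show "\<forall>x\<in>A \<inter> B. \<exists>V\<in>M. \<forall>y\<in>carrier G. \<phi> y - \<phi> x \<in> V \<longrightarrow> y \<in> A \<inter> B"
    proof
      fix x assume x: "x \<in> A \<inter> B"
      obtain V where V: "V \<in> M" "\<forall>y\<in>carrier G. \<phi> y - \<phi> x \<in> V \<longrightarrow> y \<in> A" using A x by blast
      obtain V' where V': "V' \<in> M" "\<forall>y\<in>carrier G. \<phi> y - \<phi> x \<in> V' \<longrightarrow> y \<in> B" using B x by blast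
      obtain W where "W \<in> M" "W \<subseteq> V \<inter> V'" using M.inter[OF V(1) V'(1)] by blast
      then show "\<exists>V\<in>M. \<forall>y\<in>carrier G. \<phi> y - \<phi> x \<in> V \<longrightarrow> y \<in> A \<inter> B"
        using V(2) V'(2) by (intro bexI[of _ W]) auto
    qed
  next
    fix K assume K: "\<forall>A\<in>K. ?P A"
    show "\<Union>K \<subseteq> carrier G" using K by blast
    show "\<forall>x\<in>\<Union>K. \<exists>V\<in>M. \<forall>y\<in>carrier G. \<phi> y - \<phi> x \<in> V \<longrightarrow> y \<in> \<Union>K"
    proof
      fix x assume "x \<in> \<Union>K"
      then obtain A where A: "A \<in> K" "x \<in> A" by blast
      then obtain V where "V \<in> M" "\<forall>y\<in>carrier G. \<phi> y - \<phi> x \<in> V \<longrightarrow> y \<in> A" using K by blast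
      then show "\<exists>V\<in>M. \<forall>y\<in>carrier G. \<phi> y - \<phi> x \<in> V \<longrightarrow> y \<in> \<Union>K" using A(1) by blast
    qed
  qed
  then show ?thesis by (simp add: base_topology_def)
qed

lemma base_topology_nbhd:
  assumes x: "x \<in> carrier G" and V: "V \<in> M"
  shows "\<exists>I. openin (base_topology M) I \<and> x \<in> I \<and> (\<forall>y\<in>I. \<phi> y - \<phi> x \<in> V)"
proof -
  \<comment> \<open>The interior of \<open>x + V\<close>; members of a base are not assumed
    open.\<close>
  define I where "I = {y \<in> carrier G. \<exists>W\<in>M. \<forall>z\<in>carrier G. \<phi> z - \<phi> y \<in> W \<longrightarrow> \<phi> z - \<phi> x \<in> V}"
  have "openin (base_topology M) I"
    unfolding openin_base_topology
  proof (intro conjI ballI)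
    show "I \<subseteq> carrier G" by (auto simp: I_def)
    fix y assume "y \<in> I"
    then obtain W where W: "W \<in> M" "\<forall>z\<in>carrier G. \<phi> z - \<phi> y \<in> W \<longrightarrow> \<phi> z - \<phi> x \<in> V" by (auto simp: I_def)
    obtain W2 where W2: "W2 \<in> M" "\<forall>a\<in>W2. \<forall>b\<in>W2. a + b \<in> W" using M.half[OF W(1)] by blast
    have "y' \<in> I" if y': "y' \<in> carrier G" "\<phi> y' - \<phi> y \<in> W2" for y'
    proof -
      have "\<phi> z - \<phi> x \<in> V" if z: "z \<in> carrier G" "\<phi> z - \<phi> y' \<in> W2" for z
      proof -
        have "(\<phi> z - \<phi> y') + (\<phi> y' - \<phi> y) \<in> W" using W2(2) z(2) y'(2) by blast
        then show ?thesis using W(2) z(1) by simp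
      qed
      then show ?thesis unfolding I_def using y'(1) W2(1) by blast
    qed
    then show "\<exists>V\<in>M. \<forall>y'\<in>carrier G. \<phi> y' - \<phi> y \<in> V \<longrightarrow> y' \<in> I" using W2(1) by blast
  qed
  moreover have "x \<in> I" unfolding I_def using x V by blast
  moreover have "\<phi> y - \<phi> x \<in> V" if y: "y \<in> I" for y
  proof -
    obtain W where W: "W \<in> M" "\<forall>z\<in>carrier G. \<phi> z - \<phi> y \<in> W \<longrightarrow> \<phi> z - \<phi> x \<in> V" "y \<in> carrier G"
      using y by (auto simp: I_def)
    have "\<phi> y - \<phi> y \<in> W" using M.zero[OF W(1)] by simp
    then show ?thesis using W(2,3) by blast
  qed
  ultimately show ?thesis by blast
qed

lemma topspace_base_topology: "topspace (base_topology M) = carrier G"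
proof
  show "topspace (base_topology M) \<subseteq> carrier G"
    using openin_topspace[of "base_topology M"] unfolding openin_base_topology by blast
  have "openin (base_topology M) (carrier G)"
    unfolding openin_base_topology using M.nonempty by blast
  then show "carrier G \<subseteq> topspace (base_topology M)" by (rule openin_subset)
qed

lemma hausdorff_group_topology_base_topology:
  assumes comm: "\<And>x y. x \<in> carrier G \<Longrightarrow> y \<in> carrier G \<Longrightarrow> x \<otimes> y = y \<otimes> x"
    and sep: "\<forall>u\<in>\<phi> ` carrier G. u \<noteq> 0 \<longrightarrow> (\<exists>V\<in>M. u \<notin> V)"
  shows "hausdorff_group_topology G (base_topology M)"
  unfolding hausdorff_group_topology_def
proof (intro conjI)
  let ?T = "base_topology M"
  show "topspace ?T = carrier G" by (rule topspace_base_topology)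
  show "continuous_map (prod_topology ?T ?T) ?T (\<lambda>(x, y). x \<otimes> y)"
    unfolding continuous_map_def
  proof (intro conjI allI impI)
    show "(\<lambda>(x, y). x \<otimes> y) \<in> topspace (prod_topology ?T ?T) \<rightarrow> topspace ?T"
      by (auto simp: topspace_base_topology)
    fix U assume U: "openin ?T U"
    show "openin (prod_topology ?T ?T) {p \<in> topspace (prod_topology ?T ?T). (case p of (x, y) \<Rightarrow> x \<otimes> y) \<in> U}"
      unfolding openin_prod_topology_alt
    proof (intro allI impI)
      fix x y assume "(x, y) \<in> {p \<in> topspace (prod_topology ?T ?T). (case p of (x, y) \<Rightarrow> x \<otimes> y) \<in> U}"
      then have xy: "x \<in> carrier G" "y \<in> carrier G" "x \<otimes> y \<in> U" by (auto simp: topspace_base_topology)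
      obtain V where V: "V \<in> M" "\<forall>z\<in>carrier G. \<phi> z - \<phi> (x \<otimes> y) \<in> V \<longrightarrow> z \<in> U"
        using U xy(3) unfolding openin_base_topology by blast
      obtain W where W: "W \<in> M" "\<forall>a\<in>W. \<forall>b\<in>W. a + b \<in> V" using M.half[OF V(1)] by blast
      obtain I where I: "openin ?T I" "x \<in> I" "\<forall>a\<in>I. \<phi> a - \<phi> x \<in> W" using base_topology_nbhd[OF xy(1) W(1)] by blast
      obtain J where J: "openin ?T J" "y \<in> J" "\<forall>a\<in>J. \<phi> a - \<phi> y \<in> W" using base_topology_nbhd[OF xy(2) W(1)] by blast
      have IJ: "I \<subseteq> carrier G" "J \<subseteq> carrier G" using I(1) J(1) unfolding openin_base_topology by blast+
      have "a \<otimes> b \<in> U" if ab: "a \<in> I" "b \<in> J" for a b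
      proof -
        have "(\<phi> a - \<phi> x) + (\<phi> b - \<phi> y) \<in> V" using W(2) I(3) J(3) ab by blast
        moreover have "\<phi> (a \<otimes> b) - \<phi> (x \<otimes> y) = (\<phi> a - \<phi> x) + (\<phi> b - \<phi> y)"
          using ab IJ xy(1,2) by (simp add: \<phi>_mult subset_iff)
        ultimately show ?thesis using V(2) ab IJ by (metis m_closed subsetD)
      qed
      then have "I \<times> J \<subseteq> {p \<in> topspace (prod_topology ?T ?T). (case p of (x, y) \<Rightarrow> x \<otimes> y) \<in> U}"
        using IJ by (auto simp: topspace_base_topology)
      then show "\<exists>I J. openin ?T I \<and> openin ?T J \<and> x \<in> I \<and> y \<in> J \<and>
          I \<times> J \<subseteq> {p \<in> topspace (prod_topology ?T ?T). (case p of (x, y) \<Rightarrow> x \<otimes> y) \<in> U}"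
        using I(1,2) J(1,2) by blast
    qed
  qed
  show "continuous_map ?T ?T (\<lambda>x. inv x)"
    unfolding continuous_map_def
  proof (intro conjI allI impI)
    show "(\<lambda>x. inv x) \<in> topspace ?T \<rightarrow> topspace ?T" by (auto simp: topspace_base_topology)
    fix U assume U: "openin ?T U"
    show "openin ?T {x \<in> topspace ?T. inv x \<in> U}"
      unfolding openin_base_topology topspace_base_topology
    proof (intro conjI ballI)
      fix x assume "x \<in> {x \<in> carrier G. inv x \<in> U}"
      then have x: "x \<in> carrier G" "inv x \<in> U" by auto
      obtain V where V: "V \<in> M" "\<forall>z\<in>carrier G. \<phi> z - \<phi> (inv x) \<in> V \<longrightarrow> z \<in> U"
        using U x(2) unfolding openin_base_topology by blast
      have "inv y \<in> U" if y: "y \<in> carrier G" "\<phi> y - \<phi> x \<in> V" for y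
      proof -
        have "\<phi> (inv y) - \<phi> (inv x) = - (\<phi> y - \<phi> x)" using y(1) x(1) by (simp add: \<phi>_inv)
        then show ?thesis using V(2) M.sym[OF V(1) y(2)] y(1) by simp
      qed
      then show "\<exists>V\<in>M. \<forall>y\<in>carrier G. \<phi> y - \<phi> x \<in> V \<longrightarrow> y \<in> {x \<in> carrier G. inv x \<in> U}"
        using V(1) by blast
    qed auto
  qed
  show "Hausdorff_space ?T"
    unfolding Hausdorff_space_def topspace_base_topology
  proof (intro allI impI)
    fix x y assume xy: "x \<in> carrier G \<and> y \<in> carrier G \<and> x \<noteq> y"
    have "\<phi> y - \<phi> x \<in> \<phi> ` carrier G" using xy by (intro diff_image) auto
    moreover have "\<phi> y - \<phi> x \<noteq> 0" using xy inj by (auto dest: inj_onD)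
    ultimately obtain V where V: "V \<in> M" "\<phi> y - \<phi> x \<notin> V" using sep by blast
    obtain W where W: "W \<in> M" "\<And>a b. a \<in> W \<Longrightarrow> b \<in> W \<Longrightarrow> a - b \<in> V" using M.half_diff[OF V(1)] by metis
    obtain I where I: "openin ?T I" "x \<in> I" "\<forall>a\<in>I. \<phi> a - \<phi> x \<in> W" using base_topology_nbhd[OF _ W(1)] xy by blast
    obtain J where J: "openin ?T J" "y \<in> J" "\<forall>a\<in>J. \<phi> a - \<phi> y \<in> W" using base_topology_nbhd[OF _ W(1)] xy by blast
    have "I \<inter> J = {}"
    proof (rule ccontr)
      assume "I \<inter> J \<noteq> {}"
      then obtain z where "z \<in> I" "z \<in> J" by blast
      then have "(\<phi> z - \<phi> x) - (\<phi> z - \<phi> y) \<in> V" using W(2) I(3) J(3) by blast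
      then show False using V(2) by simp
    qed
    then show "\<exists>U V. openin ?T U \<and> openin ?T V \<and> x \<in> U \<and> y \<in> V \<and> disjnt U V"
      using I J by (auto simp: disjnt_def)
  qed
qed

end

end

section \<open>From a topological group to a neighbourhood base\<close>

locale embedded_topological_group = additive_embedding G \<phi>
  for G :: "('a, 'm) monoid_scheme" (structure) and \<phi> :: "'a \<Rightarrow> 'c::comm_ring_1" +
  fixes T :: "'a topology"
  assumes top: "hausdorff_group_topology G T"
begin

lemma topspace_T: "topspace T = carrier G"
  and mult_continuous: "continuous_map (prod_topology T T) T (\<lambda>(x, y). x \<otimes> y)"
  and inv_continuous: "continuous_map T T (\<lambda>x. inv x)"
  and Hausdorff_T: "Hausdorff_space T"
  using top by (auto simp: hausdorff_group_topology_def)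

text \<open>Restricting to symmetric open sets gives the symmetry axiom by construction; inversion
  is continuous, so they still form a base at the identity.\<close>

definition nbhds :: "'c set set"
  where "nbhds = {\<phi> ` U | U. openin T U \<and> \<one> \<in> U \<and> (\<forall>x\<in>U. inv x \<in> U)}"

lemma open_subset: "openin T U \<Longrightarrow> U \<subseteq> carrier G"
  using openin_subset topspace_T by blast

lemma open_inv: "openin T U \<Longrightarrow> openin T {x \<in> carrier G. inv x \<in> U}"
  using inv_continuous unfolding continuous_map_def topspace_T by blast

lemma open_translate:
  assumes a: "a \<in> carrier G" and U: "openin T U"
  shows "openin T {x \<in> carrier G. a \<otimes> x \<in> U}"
proof -
  have "continuous_map T (prod_topology T T) (\<lambda>x. (a, x))"
    using a by (simp add: continuous_map_pairwise o_def topspace_T)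
  then have "continuous_map T T ((\<lambda>(x, y). x \<otimes> y) \<circ> (\<lambda>x. (a, x)))"
    using mult_continuous by (rule continuous_map_compose)
  then show ?thesis using U unfolding continuous_map_def topspace_T by (simp add: o_def)
qed

lemma symmetric_nbhd:
  assumes "openin T U" "\<one> \<in> U"
  shows "\<exists>V. openin T V \<and> \<one> \<in> V \<and> (\<forall>x\<in>V. inv x \<in> V) \<and> V \<subseteq> U"
proof (intro exI conjI)
  let ?V = "U \<inter> {x \<in> carrier G. inv x \<in> U}"
  show "openin T ?V" using assms(1) open_inv by (intro openin_Int)
  show "\<forall>x\<in>?V. inv x \<in> ?V" using open_subset[OF assms(1)] by auto
qed (use assms in auto)

lemma nbhdsI: "openin T U \<Longrightarrow> \<one> \<in> U \<Longrightarrow> (\<forall>x\<in>U. inv x \<in> U) \<Longrightarrow> \<phi> ` U \<in> nbhds"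
  unfolding nbhds_def by blast

lemma nbhdsE:
  assumes "V \<in> nbhds"
  obtains U where "V = \<phi> ` U" "openin T U" "\<one> \<in> U" "\<forall>x\<in>U. inv x \<in> U" "U \<subseteq> carrier G"
  using assms open_subset unfolding nbhds_def by blast

lemma group_base_nbhds: "group_base (\<phi> ` carrier G) nbhds"
proof
  show "0 \<in> \<phi> ` carrier G" by (rule zero_image)
  show "u - v \<in> \<phi> ` carrier G" if "u \<in> \<phi> ` carrier G" "v \<in> \<phi> ` carrier G" for u v
    using that by (rule diff_image)
  have "\<phi> ` carrier G \<in> nbhds" by (rule nbhdsI) (use topspace_T openin_topspace[of T] in auto)
  then show "nbhds \<noteq> {}" by blast
next
  fix V assume "V \<in> nbhds"
  then obtain U where U: "V = \<phi> ` U" "openin T U" "\<one> \<in> U" "\<forall>x\<in>U. inv x \<in> U" "U \<subseteq> carrier G"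
    by (rule nbhdsE)
  show "V \<subseteq> \<phi> ` carrier G" using U by blast
  show "0 \<in> V" using U(1,3) \<phi>_one by force
  show "- u \<in> V" if u: "u \<in> V" for u
  proof -
    obtain x where "u = \<phi> x" "x \<in> U" using u U(1) by blast
    then show ?thesis using U(1,4,5) \<phi>_inv[of x] by (metis imageI subsetD)
  qed
  have "openin (prod_topology T T) {p \<in> topspace (prod_topology T T). (case p of (x, y) \<Rightarrow> x \<otimes> y) \<in> U}"
    using mult_continuous U(2) unfolding continuous_map_def by blast
  moreover have "(\<one>, \<one>) \<in> {p \<in> topspace (prod_topology T T). (case p of (x, y) \<Rightarrow> x \<otimes> y) \<in> U}"
    using U(3) by (simp add: topspace_T)
  ultimately obtain A B where AB: "openin T A" "openin T B" "\<one> \<in> A" "\<one> \<in> B"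
    "A \<times> B \<subseteq> {p \<in> topspace (prod_topology T T). (case p of (x, y) \<Rightarrow> x \<otimes> y) \<in> U}"
    unfolding openin_prod_topology_alt by meson
  obtain W where W: "openin T W" "\<one> \<in> W" "\<forall>x\<in>W. inv x \<in> W" "W \<subseteq> A \<inter> B"
    using symmetric_nbhd[of "A \<inter> B"] AB by auto
  have "u + v \<in> V" if uv: "u \<in> \<phi> ` W" "v \<in> \<phi> ` W" for u v
  proof -
    obtain x y where xy: "u = \<phi> x" "v = \<phi> y" "x \<in> W" "y \<in> W" using uv by blast
    have "(x, y) \<in> A \<times> B" using xy W(4) by blast
    then have "x \<otimes> y \<in> U" using AB(5) by auto
    moreover have "u + v = \<phi> (x \<otimes> y)" using xy open_subset[OF W(1)] by (simp add: \<phi>_mult subset_iff)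
    ultimately show ?thesis using U(1) by blast
  qed
  then show "\<exists>V'\<in>nbhds. \<forall>u\<in>V'. \<forall>v\<in>V'. u + v \<in> V" using nbhdsI[OF W(1,2,3)] by blast
next
  fix V V' assume "V \<in> nbhds" "V' \<in> nbhds"
  obtain U where U: "V = \<phi> ` U" "openin T U" "\<one> \<in> U" "\<forall>x\<in>U. inv x \<in> U" "U \<subseteq> carrier G"
    using \<open>V \<in> nbhds\<close> by (rule nbhdsE)
  obtain U' where U': "V' = \<phi> ` U'" "openin T U'" "\<one> \<in> U'" "\<forall>x\<in>U'. inv x \<in> U'" "U' \<subseteq> carrier G"
    using \<open>V' \<in> nbhds\<close> by (rule nbhdsE)
  have "\<phi> ` (U \<inter> U') \<in> nbhds" by (rule nbhdsI) (use U U' in auto)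
  then show "\<exists>W\<in>nbhds. W \<subseteq> V \<inter> V'"
    unfolding U(1) U'(1) by (intro bexI[of _ "\<phi> ` (U \<inter> U')"]) auto
qed

lemma nbhds_hausdorff:
  assumes u: "u \<in> \<phi> ` carrier G" "u \<noteq> 0"
  shows "\<exists>V\<in>nbhds. u \<notin> V"
proof -
  obtain x where x: "x \<in> carrier G" "u = \<phi> x" using u(1) by blast
  have "x \<noteq> \<one>" using u(2) x(2) \<phi>_one by auto
  then obtain U U' where U: "openin T U" "\<one> \<in> U" "openin T U'" "x \<in> U'" "disjnt U U'"
    using Hausdorff_T x(1) unfolding Hausdorff_space_def topspace_T by (metis one_closed)
  obtain V where V: "openin T V" "\<one> \<in> V" "\<forall>x\<in>V. inv x \<in> V" "V \<subseteq> U" using symmetric_nbhd[OF U(1,2)] by blast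
  have "x \<notin> V" using U(4,5) V(4) by (auto simp: disjnt_iff)
  then have "u \<notin> \<phi> ` V" unfolding x(2) using inj_on_image_mem_iff[OF inj x(1) open_subset[OF V(1)]] by simp
  then show ?thesis using nbhdsI[OF V(1-3)] by blast
qed

text \<open>The topology generated by \<open>M\<close> is Hausdorff and coarser than
  \<open>T\<close>, hence equal to \<open>T\<close>. An open set around the identity is then open
  for \<open>M\<close>, so it contains the preimage of a member of \<open>M\<close>.\<close>

lemma nbhds_minimal:
  assumes comm: "\<And>x y. x \<in> carrier G \<Longrightarrow> y \<in> carrier G \<Longrightarrow> x \<otimes> y = y \<otimes> x"
    and min: "minimal_group_topology G T"
    and M: "group_base (\<phi> ` carrier G) M" "\<forall>u\<in>\<phi> ` carrier G. u \<noteq> 0 \<longrightarrow> (\<exists>V\<in>M. u \<notin> V)"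
      "\<forall>V\<in>M. \<exists>U\<in>nbhds. U \<subseteq> V"
    and V: "V \<in> nbhds"
  shows "\<exists>W\<in>M. W \<subseteq> V"
proof -
  let ?T = "base_topology M"
  have "openin T U" if U: "openin ?T U" for U
  proof (subst openin_subopen, intro ballI)
    fix x assume x: "x \<in> U"
    have xG: "x \<in> carrier G" using U x unfolding openin_base_topology[OF M(1)] by blast
    obtain W where W: "W \<in> M" "\<forall>y\<in>carrier G. \<phi> y - \<phi> x \<in> W \<longrightarrow> y \<in> U"
      using U x unfolding openin_base_topology[OF M(1)] by blast
    obtain W' where W': "W' \<in> nbhds" "W' \<subseteq> W" using M(3) W(1) by blast
    obtain P where P: "W' = \<phi> ` P" "openin T P" "\<one> \<in> P" using W'(1) by (rule nbhdsE)
    have "{y \<in> carrier G. inv x \<otimes> y \<in> P} \<subseteq> U"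
    proof clarify
      fix y assume y: "y \<in> carrier G" "inv x \<otimes> y \<in> P"
      have "\<phi> y - \<phi> x \<in> W'" unfolding P(1) \<phi>_quot[OF xG y(1), symmetric] using y(2) by blast
      then show "y \<in> U" using W(2) W'(2) y(1) by blast
    qed
    moreover have "x \<in> {y \<in> carrier G. inv x \<otimes> y \<in> P}" using xG P(3) by simp
    ultimately show "\<exists>Q. openin T Q \<and> x \<in> Q \<and> Q \<subseteq> U"
      using open_translate[OF inv_closed[OF xG] P(2)] by blast
  qed
  then have T': "?T = T"
    using min hausdorff_group_topology_base_topology[OF M(1) comm M(2)]
    unfolding minimal_group_topology_def by blast
  obtain U where U: "V = \<phi> ` U" "openin T U" "\<one> \<in> U" using V by (rule nbhdsE)
  then obtain W where W: "W \<in> M" "\<forall>y\<in>carrier G. \<phi> y - \<phi> \<one> \<in> W \<longrightarrow> y \<in> U"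
    using T' openin_base_topology[OF M(1), of U] by auto
  have "W \<subseteq> V"
  proof
    fix u assume u: "u \<in> W"
    then obtain y where "y \<in> carrier G" "u = \<phi> y" using group_base.subset[OF M(1) W(1)] by blast
    then show "u \<in> V" using W(2) u U(1) \<phi>_one by auto
  qed
  then show ?thesis using W(1) by blast
qed

text \<open>A connected open \<open>K\<close> around the identity is made symmetric by adding its
  inverses; the union is connected because both parts contain the identity. A set respected by small
  steps cuts out an open subset of the union with open complement in it, so it contains
  everything.\<close>

lemma nbhds_chain_connected:
  assumes lc: "locally_connected_space T" and V: "V \<in> nbhds"
  shows "\<exists>W\<in>nbhds. W \<subseteq> V \<and> group_base.chain_connected nbhds W"
proof -
  interpret N: group_base "\<phi> ` carrier G" nbhds by (rule group_base_nbhds)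
  obtain U where U: "V = \<phi> ` U" "openin T U" "\<one> \<in> U" "\<forall>x\<in>U. inv x \<in> U" using V by (rule nbhdsE)
  obtain K where K: "openin T K" "connectedin T K" "\<one> \<in> K" "K \<subseteq> U"
    using lc U(2,3) unfolding locally_connected_space by meson
  have KG: "K \<subseteq> carrier G" by (rule open_subset[OF K(1)])
  define K' where "K' = (\<lambda>x. inv x) ` K"
  have K': "connectedin T K'"
    unfolding K'_def by (rule connectedin_continuous_map_image[OF inv_continuous K(2)])
  have "K' = {x \<in> carrier G. inv x \<in> K}"
    unfolding K'_def using KG by (auto intro!: image_eqI[of _ _ "inv _"])
  then have "openin T K'" using open_inv[OF K(1)] by simp
  define W where "W = K \<union> K'"
  have one: "\<one> \<in> K'" unfolding K'_def using K(3) by (metis imageI inv_one)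
  have W: "openin T W" "\<one> \<in> W" "W \<subseteq> U"
    unfolding W_def using K(1,3,4) \<open>openin T K'\<close> U(4) K'_def by auto
  have Wc: "connectedin T W"
    unfolding W_def by (rule connectedin_Un[OF K(2) K']) (use K(3) one in blast)
  have Wsym: "\<forall>x\<in>W. inv x \<in> W" unfolding W_def K'_def using KG by auto
  have WG: "W \<subseteq> carrier G" by (rule open_subset[OF W(1)])
  have "N.chain_connected (\<phi> ` W)"
    unfolding N.chain_connected_def
  proof (intro allI ballI impI)
    fix A P assume P: "P \<in> nbhds" and A: "0 \<in> A"
      and step: "\<forall>a\<in>\<phi> ` W. \<forall>w\<in>\<phi> ` W. w - a \<in> P \<longrightarrow> (a \<in> A \<longleftrightarrow> w \<in> A)"
    obtain Q where Q: "P = \<phi> ` Q" "openin T Q" "\<one> \<in> Q" using P by (rule nbhdsE)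
    have local: "\<exists>R. openin T R \<and> x \<in> R \<and> R \<subseteq> {y \<in> W. \<phi> y \<in> A \<longleftrightarrow> \<phi> x \<in> A}" if x: "x \<in> W" for x
    proof (intro exI conjI)
      let ?R = "W \<inter> {y \<in> carrier G. inv x \<otimes> y \<in> Q}"
      have xG: "x \<in> carrier G" using WG x by blast
      show "openin T ?R" using open_translate[OF inv_closed[OF xG] Q(2)] W(1) by (intro openin_Int)
      show "x \<in> ?R" using x xG Q(3) by simp
      show "?R \<subseteq> {y \<in> W. \<phi> y \<in> A \<longleftrightarrow> \<phi> x \<in> A}"
      proof clarify
        fix y assume y: "y \<in> W" "y \<in> carrier G" "inv x \<otimes> y \<in> Q"
        have "\<phi> y - \<phi> x \<in> P" using y \<phi>_quot[OF xG, of y] Q(1) by (metis imageI)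
        then show "\<phi> y \<in> A \<longleftrightarrow> \<phi> x \<in> A" using step x y(1) by blast
      qed
    qed
    define W1 where "W1 = {y \<in> W. \<phi> y \<in> A}"
    define W2 where "W2 = {y \<in> W. \<phi> y \<notin> A}"
    have "openin T W1"
    proof (subst openin_subopen, intro ballI)
      fix x assume "x \<in> W1"
      then show "\<exists>R. openin T R \<and> x \<in> R \<and> R \<subseteq> W1" using local[of x] unfolding W1_def by auto
    qed
    moreover have "openin T W2"
    proof (subst openin_subopen, intro ballI)
      fix x assume "x \<in> W2"
      then show "\<exists>R. openin T R \<and> x \<in> R \<and> R \<subseteq> W2" using local[of x] unfolding W2_def by auto
    qed
    moreover have "\<one> \<in> W1" unfolding W1_def using W(2) A \<phi>_one by simp
    ultimately have "W2 \<inter> W = {}"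
      using connectedinD[OF Wc, of W1 W2] W(2) unfolding W1_def W2_def by auto
    then show "\<phi> ` W \<subseteq> A" unfolding W2_def by auto
  qed
  then show ?thesis using nbhdsI[OF W(1,2) Wsym] W(3) U(1) by blast
qed

end

theorem corollary2p14:
  fixes G :: "('a, 'm) monoid_scheme" and S :: "'b set"
  assumes "group G"
    and "G \<cong> free_Abelian_group S"
    and "carrier G \<noteq> {\<one>\<^bsub>G\<^esub>}"
  shows "\<nexists>T. minimal_group_topology G T \<and> locally_connected_space T"
proof
  assume "\<exists>T. minimal_group_topology G T \<and> locally_connected_space T"
  then obtain T where min: "minimal_group_topology G T" and lc: "locally_connected_space T" by blast
  obtain h where h: "h \<in> iso G (free_Abelian_group S)" using assms(2) unfolding is_iso_def by blast
  have h_mult: "h (x \<otimes>\<^bsub>G\<^esub> y) = h x + h y" if "x \<in> carrier G" "y \<in> carrier G" for x y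
    using h that by (auto simp: iso_def hom_def)
  have h_bij: "bij_betw h (carrier G) {c. Poly_Mapping.keys c \<subseteq> S}"
    using h by (auto simp: iso_def free_Abelian_group_def)
  define \<phi> where "\<phi> x = Poly_Mapping.lookup (h x)" for x
  define H where "H = \<phi> ` carrier G"
  interpret G: group G by fact
  interpret E: embedded_topological_group G \<phi> T
  proof
    show "inj_on \<phi> (carrier G)"
    proof (rule inj_onI)
      fix x y assume "x \<in> carrier G" "y \<in> carrier G" "\<phi> x = \<phi> y"
      moreover from this have "h x = h y" unfolding \<phi>_def by (simp only: lookup_inject)
      ultimately show "x = y" using inj_onD[OF bij_betw_imp_inj_on[OF h_bij]] by blast
    qed
    show "\<phi> (x \<otimes>\<^bsub>G\<^esub> y) = \<phi> x + \<phi> y" if "x \<in> carrier G" "y \<in> carrier G" for x y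
      using h_mult[OF that] by (simp add: \<phi>_def fun_eq_iff Poly_Mapping.lookup_add)
    show "hausdorff_group_topology G T" using min by (simp add: minimal_group_topology_def)
  qed
  have comm: "x \<otimes>\<^bsub>G\<^esub> y = y \<otimes>\<^bsub>G\<^esub> x" if "x \<in> carrier G" "y \<in> carrier G" for x y
    using inj_onD[OF E.inj, of "x \<otimes>\<^bsub>G\<^esub> y" "y \<otimes>\<^bsub>G\<^esub> x"] that by (simp add: E.\<phi>_mult add.commute)
  have H_eq: "H = {f. finite {i. f i \<noteq> 0} \<and> {i. f i \<noteq> 0} \<subseteq> S}"
  proof
    show "H \<subseteq> {f. finite {i. f i \<noteq> 0} \<and> {i. f i \<noteq> 0} \<subseteq> S}"
    proof
      fix f assume "f \<in> H"
      then obtain x where x: "x \<in> carrier G" "f = Poly_Mapping.lookup (h x)" unfolding H_def \<phi>_def by blast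
      have "Poly_Mapping.keys (h x) \<subseteq> S" using bij_betwE[OF h_bij] x(1) by blast
      then show "f \<in> {f. finite {i. f i \<noteq> 0} \<and> {i. f i \<noteq> 0} \<subseteq> S}"
        unfolding x(2) by (simp add: Poly_Mapping.keys.rep_eq)
    qed
    show "{f. finite {i. f i \<noteq> 0} \<and> {i. f i \<noteq> 0} \<subseteq> S} \<subseteq> H"
    proof clarify
      fix f :: "'b \<Rightarrow> int" assume f: "finite {i. f i \<noteq> 0}" "{i. f i \<noteq> 0} \<subseteq> S"
      have l: "Poly_Mapping.lookup (Abs_poly_mapping f) = f" using f(1) by simp
      then have "Poly_Mapping.keys (Abs_poly_mapping f) \<subseteq> S" using f(2) by (simp add: Poly_Mapping.keys.rep_eq)
      then have "Abs_poly_mapping f \<in> h ` carrier G" using bij_betw_imp_surj_on[OF h_bij] by simp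
      then obtain x where "x \<in> carrier G" "h x = Abs_poly_mapping f" by force
      then show "f \<in> H" unfolding H_def \<phi>_def using l by (metis imageI)
    qed
  qed
  interpret M: minimal_free_group_base H E.nbhds S
  proof (intro minimal_free_group_base.intro minimal_group_base.intro)
    show "group_base H E.nbhds" unfolding H_def by (rule E.group_base_nbhds)
    show "minimal_group_base_axioms H E.nbhds"
    proof
      show "\<exists>U\<in>E.nbhds. x \<notin> U" if "x \<in> H" "x \<noteq> 0" for x
        using E.nbhds_hausdorff that unfolding H_def by blast
      show "x = 0" if "x \<in> H" "n > 0" "of_nat n * x = 0" for x and n :: nat
      proof
        fix i
        have "(of_nat n * x) i = 0" using that(3) by simp
        then show "x i = 0 i" using that(2) by simp
      qed
      show "\<exists>V\<in>M. V \<subseteq> U" if "group_base H M" "\<forall>x\<in>H. x \<noteq> 0 \<longrightarrow> (\<exists>V\<in>M. x \<notin> V)"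
        "\<forall>V\<in>M. \<exists>U\<in>E.nbhds. U \<subseteq> V" "U \<in> E.nbhds" for M U
        using E.nbhds_minimal[OF comm min] that unfolding H_def by blast
    qed
    show "minimal_free_group_base_axioms H S" by unfold_locales (rule H_eq)
  qed
  have "H = {0}"
    by (rule M.locally_connected_trivial) (rule E.nbhds_chain_connected[OF lc])
  then have "\<phi> x = \<phi> \<one>\<^bsub>G\<^esub>" if "x \<in> carrier G" for x
    using that E.\<phi>_one unfolding H_def by auto
  then have "carrier G \<subseteq> {\<one>\<^bsub>G\<^esub>}" using inj_onD[OF E.inj] by blast
  then show False using assms(3) by auto
qed

end
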